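(* Let $T>0$ and let $\bar\mu$ be a Borel probability measure on $H$ with $\int_H\|u_0\|_{H^1}^2\,d\bar\mu(u_0)<\infty$. Then there exists a phase space statistical solution $\{\mu_t\}_{0\le t\le T}$ of the 2D incompressible Euler equations on $\mathbb T^2$ with initial distribution $\bar\mu$, and it satisfies $\int_H\|u\|_{L^2}^2d\mu_t(u)\le\int_H\|u_0\|_{L^2}^2d\bar\mu(u_0)$ for a.e. $0\le t\le T$.
   Context: $\mathbb T^2$ is the 2-torus; $H$ is the closed subspace of weakly divergence-free fields in $L^2(\mathbb T^2;\mathbb R^2)$, with inner product $(\cdot,\cdot)_{L^2}$; $H_w$ is $H$ with the weak topology; $\|u_0\|_{H^1}:=+\infty$ if $u_0\notin H^1$. For matrix fields $(A,B)_{L^2}=\int A:B\,dx$, $(\nabla v)_{ij}=\partial_jv_i$. Fix $L>2$, $H^L:=H^L(\mathbb T^2;\mathbb R^2)\cap H$. $\mathcal T$ is the set of $\Phi:H\to\mathbb R$, $\Phi(u)=\phi((u,g_1)_{L^2},\dots,(u,g_k)_{L^2})$ with $k\in\mathbb N$, $\phi\in C^1_c(\mathbb R^k)$, $g_j\in H^L$, and $\Phi'(u):=\sum_j\partial_j\phi((u,g_1)_{L^2},\dots)g_j$. A phase space statistical solution of the 2D incompressible Euler equations on $[0,T]$ with initial distribution $\bar\mu$ (a Borel probability measure on $H$ with finite second $L^2$-moment) is a family $\{\mu_t\}_{0\le t\le T}$ of Borel probability measures on $H$ with $\mu_0=\bar\mu$ such that: (i) $t\mapsto\int_H\varphi\,d\mu_t$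 is Lebesgue measurable for every $\varphi\in C_b(H_w)$; (ii) $\int_H\|u\|^2_{L^2}d\mu_t\le\int_H\|u\|^2_{L^2}d\bar\mu$ for a.e. $t$; (iii) for every $\Phi\in\mathcal T$ and all $0\le t'\le t\le T$: $\int_H\Phi\,d\mu_t=\int_H\Phi\,d\mu_{t'}+\int_{t'}^t\int_H(\nabla\Phi'(u),u\otimes u)_{L^2}d\mu_s(u)\,ds$. *)

theory Defs
  imports "HOL-Probability.Probability"
begin

text \<open>Torus T^2 = R^2 / Z^2, realised through its fundamental cell Q = [0,1)^2.
  Vector fields are functions R^2 -> R^2; only their values on Q matter, and
  functions that agree a.e. on Q are indistinguishable by all notions below.\<close>

type_synonym vf = "real \<times> real \<Rightarrow> real \<times> real"

definition cellQ :: "(real \<times> real) set" where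
  "cellQ = {0..<1} \<times> {0..<1}"

definition C1per :: "(real \<times> real \<Rightarrow> real) \<Rightarrow> (real \<times> real \<Rightarrow> real \<times> real) \<Rightarrow> bool" where
  "C1per \<phi> D\<phi> \<longleftrightarrow>
     (\<forall>x. \<phi> (x + (1,0)) = \<phi> x \<and> \<phi> (x + (0,1)) = \<phi> x) \<and>
     continuous_on UNIV D\<phi> \<and>
     (\<forall>x. (\<phi> has_derivative (\<lambda>h. D\<phi> x \<bullet> h)) (at x))"

definition div_free :: "vf \<Rightarrow> bool" where
  "div_free u \<longleftrightarrow>
     (\<forall>\<phi> D\<phi>. C1per \<phi> D\<phi> \<longrightarrow> (LINT x:cellQ|lborel. u x \<bullet> D\<phi> x) = 0)"

definition Hset :: "vf set" where
  "Hset = {u. u \<in> borel_measurable lborel \<and>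
              set_integrable lborel cellQ (\<lambda>x. (norm (u x)) ^ 2) \<and> div_free u}"

definition L2inner :: "vf \<Rightarrow> vf \<Rightarrow> real" where
  "L2inner u v = (LINT x:cellQ|lborel. u x \<bullet> v x)"

definition L2norm :: "vf \<Rightarrow> real" where
  "L2norm u = sqrt (LINT x:cellQ|lborel. (norm (u x)) ^ 2)"

definition L2open :: "vf set \<Rightarrow> bool" where
  "L2open U \<longleftrightarrow> U \<subseteq> Hset \<and>
     (\<forall>u\<in>U. \<exists>e>0. \<forall>v\<in>Hset. L2norm (v - u) < e \<longrightarrow> v \<in> U)"

definition HBorel :: "vf set set" where
  "HBorel = sigma_sets Hset {U. L2open U}"

definition fcoef :: "(real \<times> real \<Rightarrow> real) \<Rightarrow> int \<times> int \<Rightarrow> complex" where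
  "fcoef f k = (LINT x:cellQ|lborel.
      complex_of_real (f x) *
      cis (- 2 * pi * (real_of_int (fst k) * fst x + real_of_int (snd k) * snd x)))"

definition Hs_sq :: "real \<Rightarrow> vf \<Rightarrow> ennreal" where
  "Hs_sq s u = (\<integral>\<^sup>+ k. ennreal ((1 + 4 * pi\<^sup>2 * (real_of_int (fst k) ^ 2 + real_of_int (snd k) ^ 2)) powr s *
        ((cmod (fcoef (\<lambda>x. fst (u x)) k)) ^ 2 + (cmod (fcoef (\<lambda>x. snd (u x)) k)) ^ 2))
      \<partial>count_space UNIV)"

definition HL :: "real \<Rightarrow> vf set" where
  "HL L = {g \<in> Hset. Hs_sq L g < \<infinity>}"

definition weak_pd :: "(real \<times> real \<Rightarrow> real) \<Rightarrow> real \<times> real \<Rightarrow> (real \<times> real \<Rightarrow> real) \<Rightarrow> bool" where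
  "weak_pd f j w \<longleftrightarrow> w \<in> borel_measurable lborel \<and> set_integrable lborel cellQ w \<and>
     (\<forall>\<phi> D\<phi>. C1per \<phi> D\<phi> \<longrightarrow>
        (LINT x:cellQ|lborel. f x * (D\<phi> x \<bullet> j)) = - (LINT x:cellQ|lborel. w x * \<phi> x))"

definition wgrad :: "vf \<Rightarrow> real \<times> real \<Rightarrow> real \<times> real \<Rightarrow> real \<times> real \<Rightarrow> real" where
  "wgrad v i j = (SOME w. weak_pd (\<lambda>x. v x \<bullet> i) j w)"

definition nonlin :: "vf \<Rightarrow> vf \<Rightarrow> real" where
  "nonlin v u = (LINT x:cellQ|lborel.
      (\<Sum>i\<in>Basis. \<Sum>j\<in>Basis. wgrad v i j x * (u x \<bullet> i) * (u x \<bullet> j)))"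

text \<open>phi in C^1_c(R^k), with R^k embedded in nat => real as the first k coordinates;
  d\<phi> j is the j-th partial derivative.\<close>
definition C1c :: "nat \<Rightarrow> ((nat \<Rightarrow> real) \<Rightarrow> real) \<Rightarrow> (nat \<Rightarrow> (nat \<Rightarrow> real) \<Rightarrow> real) \<Rightarrow> bool" where
  "C1c k \<phi> d\<phi> \<longleftrightarrow>
     (\<forall>y. \<phi> y = \<phi> (\<lambda>i. if i < k then y i else 0)) \<and>
     (\<forall>j<k. continuous_on UNIV (d\<phi> j) \<and>
        (\<forall>y. ((\<lambda>s. \<phi> (y(j := s))) has_real_derivative d\<phi> j y) (at (y j)))) \<and>
     (\<exists>R. \<forall>y. (\<exists>j<k. \<bar>y j\<bar> > R) \<longrightarrow> \<phi> y = 0)"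

definition cyl :: "real \<Rightarrow> nat \<Rightarrow> ((nat \<Rightarrow> real) \<Rightarrow> real) \<Rightarrow> (nat \<Rightarrow> (nat \<Rightarrow> real) \<Rightarrow> real)
                     \<Rightarrow> (nat \<Rightarrow> vf) \<Rightarrow> bool" where
  "cyl L k \<phi> d\<phi> gs \<longleftrightarrow> C1c k \<phi> d\<phi> \<and> (\<forall>j<k. gs j \<in> HL L)"

definition cylPhi :: "((nat \<Rightarrow> real) \<Rightarrow> real) \<Rightarrow> (nat \<Rightarrow> vf) \<Rightarrow> vf \<Rightarrow> real" where
  "cylPhi \<phi> gs u = \<phi> (\<lambda>j. L2inner u (gs j))"

definition cylDPhi :: "nat \<Rightarrow> (nat \<Rightarrow> (nat \<Rightarrow> real) \<Rightarrow> real) \<Rightarrow> (nat \<Rightarrow> vf) \<Rightarrow> vf \<Rightarrow> vf" where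
  "cylDPhi k d\<phi> gs u = (\<lambda>x. \<Sum>j<k. d\<phi> j (\<lambda>m. L2inner u (gs m)) *\<^sub>R gs j x)"

definition Cb_weak :: "(vf \<Rightarrow> real) \<Rightarrow> bool" where
  "Cb_weak \<psi> \<longleftrightarrow> (\<exists>B. \<forall>u\<in>Hset. \<bar>\<psi> u\<bar> \<le> B) \<and>
     (\<forall>u\<in>Hset. \<forall>e>0. \<exists>G \<delta>. finite G \<and> G \<subseteq> Hset \<and> \<delta> > 0 \<and>
        (\<forall>v\<in>Hset. (\<forall>g\<in>G. \<bar>L2inner (v - u) g\<bar> < \<delta>) \<longrightarrow> \<bar>\<psi> v - \<psi> u\<bar> < e))"

definition Borel_prob_H :: "vf measure \<Rightarrow> bool" where
  "Borel_prob_H M \<longleftrightarrow> prob_space M \<and> space M = Hset \<and> sets M = HBorel"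

definition stat_sol :: "real \<Rightarrow> real \<Rightarrow> vf measure \<Rightarrow> (real \<Rightarrow> vf measure) \<Rightarrow> bool" where
  "stat_sol L T \<mu>0 \<mu> \<longleftrightarrow>
     Borel_prob_H \<mu>0 \<and> (\<integral>\<^sup>+ u. ennreal ((L2norm u) ^ 2) \<partial>\<mu>0) < \<infinity> \<and>
     (\<forall>t\<in>{0..T}. Borel_prob_H (\<mu> t)) \<and> \<mu> 0 = \<mu>0 \<and>
     (\<forall>\<psi>. Cb_weak \<psi> \<longrightarrow> (\<lambda>t. \<integral>u. \<psi> u \<partial>\<mu> t) \<in> borel_measurable (lebesgue_on {0..T})) \<and>
     (AE t in lebesgue_on {0..T}.
        (\<integral>\<^sup>+ u. ennreal ((L2norm u) ^ 2) \<partial>\<mu> t) \<le> (\<integral>\<^sup>+ u. ennreal ((L2norm u) ^ 2) \<partial>\<mu>0)) \<and>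
     (\<forall>k \<phi> d\<phi> gs. cyl L k \<phi> d\<phi> gs \<longrightarrow>
        (AE s in lebesgue_on {0..T}. integrable (\<mu> s) (\<lambda>u. nonlin (cylDPhi k d\<phi> gs u) u)) \<and>
        set_integrable lborel {0..T} (\<lambda>s. \<integral>u. nonlin (cylDPhi k d\<phi> gs u) u \<partial>\<mu> s) \<and>
        (\<forall>t' t. 0 \<le> t' \<and> t' \<le> t \<and> t \<le> T \<longrightarrow>
           (\<integral>u. cylPhi \<phi> gs u \<partial>\<mu> t) =
             (\<integral>u. cylPhi \<phi> gs u \<partial>\<mu> t') +
             (LINT s:{t'..t}|lborel. (\<integral>u. nonlin (cylDPhi k d\<phi> gs u) u \<partial>\<mu> s))))"

end

theory Submission
  imports Defs
begin

text \<open>The flow is built path by path. Galerkin truncation in an orthonormal basis of divergence free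
  Hartley modes \<open>cas(2\<pi>k\<cdot>x) k\<^sup>\<bottom>/\<bar>k\<bar>\<close>, combined with explicit Euler steps so short that energy and
  enstrophy grow by \<open>O(1/N)\<close> only, gives approximate trajectories that are polynomial in the initial
  coefficients, hence measurable in the initial datum. For data in \<open>H\<^sup>1\<close> the coefficients are
  equicontinuous in time, so they converge along a subsequence. This subsequence depends on the
  datum, but taking successive limits superior of the coefficients at rational times selects its
  limit measurably. The enstrophy bound turns convergence of coefficients into strong \<open>L\<^sup>2\<close>
  convergence, so the limit trajectory solves the Euler equations, and \<open>\<mu>\<^sub>t\<close> is taken to be the law of
  the trajectory at time \<open>t\<close>. The evolution equation follows from the chain rule along each
  trajectory and dominated convergence.\<close>

section \<open>The Hilbert space of square integrable fields\<close>

text \<open>No uniqueness is used for data that are merely in \<open>H^1\<close>: different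
  subsequences may lead to different trajectories, so a law at time t makes sense only after one
  trajectory per datum has been chosen measurably. The selection rule can handle countably many real
  coordinates, here the pairs of a mode and a grid time, and equicontinuity recovers all other times
  from them.

  The enstrophy bound is special to dimension two, where the vorticity is a transported scalar. The
  restriction \<open>L > 2\<close> enters through one series: the modes form a two-dimensional
  lattice, so the sum of \<open>(1 + lam n) powr (1 - L)\<close> converges, and with it the
  differentiated mode expansion of every admissible test field.

  Fields are functions and not classes, hence the \<open>L^2\<close> distance is only a
  pseudometric, and coefficients determine a field up to null sets. A trajectory starts at its datum
  only in this sense; the initial condition for the laws rests on the fact that Borel sets of a
  pseudometric do not separate points at distance zero.\<close>

definition cell :: "(real \<times> real) measure" where
  "cell = restrict_space lborel cellQ"

lemma cellQ_sets [measurable]: "cellQ \<in> sets borel"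
  unfolding cellQ_def by (auto intro!: borel_Times)

lemma set_integral_cell: "(LINT x:cellQ|lborel. f x) = (\<integral>x. f x \<partial>cell)"
  for f :: "real \<times> real \<Rightarrow> 'b::{banach, second_countable_topology}"
  unfolding set_lebesgue_integral_def cell_def
  by (subst integral_restrict_space) auto

lemma set_integrable_cell: "set_integrable lborel cellQ f \<longleftrightarrow> integrable cell f"
  for f :: "real \<times> real \<Rightarrow> 'b::{banach, second_countable_topology}"
  unfolding set_integrable_def cell_def
  by (subst integrable_restrict_space) auto

lemma emeasure_cellQ: "emeasure lborel cellQ = 1"
proof -
  have "emeasure (lborel \<Otimes>\<^sub>M lborel) ({0..<1::real} \<times> {0..<1::real}) = 1"
    by (subst lborel.emeasure_pair_measure_Times) auto
  then show ?thesis
    by (simp add: cellQ_def lborel_prod)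
qed

interpretation cell: prob_space cell
  by standard (simp add: cell_def emeasure_restrict_space space_restrict_space emeasure_cellQ)

lemma space_cell [simp]: "space cell = cellQ"
  by (simp add: cell_def space_restrict_space)

lemma borel_measurable_cell:
  "f \<in> measurable borel N \<Longrightarrow> f \<in> measurable cell N"
  unfolding cell_def by (rule measurable_restrict_space1) simp

text \<open>Kept apart from \<open>div_free\<close> because inner products are also taken with
  gradients of test functions and with coordinate fields, which need not be solenoidal.\<close>

definition L2 :: "vf \<Rightarrow> bool" where
  "L2 u \<longleftrightarrow> u \<in> borel_measurable borel \<and> integrable cell (\<lambda>x. (norm (u x))\<^sup>2)"

lemma Hset_iff: "u \<in> Hset \<longleftrightarrow> L2 u \<and> div_free u"
  by (auto simp: Hset_def L2_def set_integrable_cell)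

lemma L2_measurable: "L2 u \<Longrightarrow> u \<in> borel_measurable borel"
  by (simp add: L2_def)

lemma Hset_L2: "u \<in> Hset \<Longrightarrow> L2 u"
  by (simp add: Hset_iff)

lemma L2inner_cell: "L2inner u v = (\<integral>x. u x \<bullet> v x \<partial>cell)"
  by (simp add: L2inner_def set_integral_cell)

lemma L2norm_cell: "L2norm u = sqrt (\<integral>x. (norm (u x))\<^sup>2 \<partial>cell)"
  by (simp add: L2norm_def set_integral_cell)

lemma integrable_norm_mult:
  assumes "L2 u" "L2 v"
  shows "integrable cell (\<lambda>x. norm (u x) * norm (v x))"
proof (rule Bochner_Integration.integrable_bound)
  show "integrable cell (\<lambda>x. (norm (u x))\<^sup>2 + (norm (v x))\<^sup>2)"
    using assms by (auto simp: L2_def)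
  show "(\<lambda>x. norm (u x) * norm (v x)) \<in> borel_measurable cell"
  proof -
    note [measurable] = assms[THEN L2_measurable]
    show ?thesis by (rule borel_measurable_cell) measurable
  qed
  have "a * b \<le> a\<^sup>2 + b\<^sup>2" for a b :: real
  proof -
    have "2 * a * b \<le> a\<^sup>2 + b\<^sup>2" "0 \<le> a\<^sup>2 + b\<^sup>2"
      by (auto simp: sum_squares_bound)
    then show ?thesis by linarith
  qed
  then show "AE x in cell. norm (norm (u x) * norm (v x)) \<le> norm ((norm (u x))\<^sup>2 + (norm (v x))\<^sup>2)"
    by (auto simp: abs_mult)
qed

lemma integrable_inner:
  assumes "L2 u" "L2 v"
  shows "integrable cell (\<lambda>x. u x \<bullet> v x)"
proof (rule Bochner_Integration.integrable_bound[OF integrable_norm_mult[OF assms]])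
  show "(\<lambda>x. u x \<bullet> v x) \<in> borel_measurable cell"
    using assms[THEN L2_measurable] by (intro borel_measurable_cell) measurable
qed (auto simp: abs_mult Cauchy_Schwarz_ineq2)

lemma L2_add:
  assumes "L2 u" "L2 v"
  shows "L2 (\<lambda>x. u x + v x)"
  unfolding L2_def
proof
  show "(\<lambda>x. u x + v x) \<in> borel_measurable borel"
    using assms[THEN L2_measurable] by measurable
  have eq: "(norm (u x + v x))\<^sup>2 = (norm (u x))\<^sup>2 + (norm (v x))\<^sup>2 + 2 * (u x \<bullet> v x)" for x
    by (simp add: power2_norm_eq_inner inner_add inner_commute)
  show "integrable cell (\<lambda>x. (norm (u x + v x))\<^sup>2)"
    unfolding eq using assms integrable_inner[OF assms] by (auto simp: L2_def)
qed

lemma L2_scale: "L2 u \<Longrightarrow> L2 (\<lambda>x. c *\<^sub>R u x)"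
  unfolding L2_def by (auto simp: power_mult_distrib)

lemma L2_zero: "L2 (\<lambda>x. 0)"
  unfolding L2_def by simp

lemma L2_diff: "L2 u \<Longrightarrow> L2 v \<Longrightarrow> L2 (\<lambda>x. u x - v x)"
  using L2_add[of u "\<lambda>x. (-1) *\<^sub>R v x"] L2_scale[of v "-1"] by simp

lemma L2_bounded:
  assumes "u \<in> borel_measurable borel" "\<And>x. x \<in> cellQ \<Longrightarrow> norm (u x) \<le> B"
  shows "L2 u"
  unfolding L2_def
proof
  show "integrable cell (\<lambda>x. (norm (u x))\<^sup>2)"
  proof (rule cell.integrable_const_bound[where B="B\<^sup>2"])
    show "AE x in cell. norm ((norm (u x))\<^sup>2) \<le> B\<^sup>2"
      using assms(2) by (auto intro!: AE_I2 power_mono)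
  qed (use assms(1) in \<open>intro borel_measurable_cell, measurable\<close>)
qed (rule assms)

lemma L2inner_commute: "L2inner u v = L2inner v u"
  by (simp add: L2inner_def inner_commute)

lemma L2inner_add_left:
  "L2 u \<Longrightarrow> L2 v \<Longrightarrow> L2 w \<Longrightarrow> L2inner (\<lambda>x. u x + v x) w = L2inner u w + L2inner v w"
  unfolding L2inner_cell by (simp add: inner_add_left integrable_inner)

lemma L2inner_scale_left: "L2inner (\<lambda>x. c *\<^sub>R u x) w = c * L2inner u w"
  unfolding L2inner_cell by simp

lemma L2inner_diff_left:
  "L2 u \<Longrightarrow> L2 v \<Longrightarrow> L2 w \<Longrightarrow> L2inner (\<lambda>x. u x - v x) w = L2inner u w - L2inner v w"
  unfolding L2inner_cell by (simp add: inner_diff_left integrable_inner)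

lemma L2inner_sum_left:
  assumes "L2 w" "\<And>i. i \<in> I \<Longrightarrow> L2 (f i)"
  shows "L2inner (\<lambda>x. \<Sum>i\<in>I. f i x) w = (\<Sum>i\<in>I. L2inner (f i) w)"
  unfolding L2inner_cell using assms by (simp add: inner_sum_left integrable_inner)

lemma L2inner_diff_right:
  "L2 u \<Longrightarrow> L2 v \<Longrightarrow> L2 w \<Longrightarrow> L2inner w (\<lambda>x. u x - v x) = L2inner w u - L2inner w v"
  by (simp add: L2inner_commute[of w] L2inner_diff_left)

lemma L2inner_add_right:
  "L2 u \<Longrightarrow> L2 v \<Longrightarrow> L2 w \<Longrightarrow> L2inner w (\<lambda>x. u x + v x) = L2inner w u + L2inner w v"
  by (simp add: L2inner_commute[of w] L2inner_add_left)

lemma L2inner_scale_right: "L2inner w (\<lambda>x. c *\<^sub>R u x) = c * L2inner w u"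
  by (simp add: L2inner_commute[of w] L2inner_scale_left)

lemma L2norm_power2: "(L2norm u)\<^sup>2 = (\<integral>x. (norm (u x))\<^sup>2 \<partial>cell)"
  unfolding L2norm_cell by (simp add: Bochner_Integration.integral_nonneg)

lemma L2inner_self: "L2inner u u = (L2norm u)\<^sup>2"
  unfolding L2norm_power2 by (simp add: L2inner_cell power2_norm_eq_inner)

lemma L2norm_nonneg [simp]: "0 \<le> L2norm u"
  unfolding L2norm_cell by (simp add: Bochner_Integration.integral_nonneg)

lemma L2norm_scale: "L2norm (\<lambda>x. c *\<^sub>R u x) = \<bar>c\<bar> * L2norm u"
  unfolding L2norm_cell by (simp add: power_mult_distrib real_sqrt_mult)

lemma L2norm_minus_commute: "L2norm (\<lambda>x. u x - v x) = L2norm (\<lambda>x. v x - u x)"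
  unfolding L2norm_cell by (simp add: norm_minus_commute)

lemma L2norm_add_power2:
  assumes "L2 u" "L2 v"
  shows "(L2norm (\<lambda>x. u x + v x))\<^sup>2 = (L2norm u)\<^sup>2 + 2 * L2inner u v + (L2norm v)\<^sup>2"
  using assms
  by (simp add: L2inner_self[symmetric] L2inner_add_left L2inner_add_right L2_add L2inner_commute)

lemma L2norm_diff_power2:
  assumes "L2 u" "L2 v"
  shows "(L2norm (\<lambda>x. u x - v x))\<^sup>2 = (L2norm u)\<^sup>2 - 2 * L2inner u v + (L2norm v)\<^sup>2"
  using assms
  by (simp add: L2inner_self[symmetric] L2inner_diff_left L2inner_diff_right L2_diff L2inner_commute)

lemma L2_Cauchy_Schwarz:
  assumes "L2 u" "L2 v"
  shows "\<bar>L2inner u v\<bar> \<le> L2norm u * L2norm v"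
proof -
  have key: "0 \<le> (L2norm u)\<^sup>2 - 2 * t * L2inner u v + t\<^sup>2 * (L2norm v)\<^sup>2" for t
  proof -
    have "0 \<le> (L2norm (\<lambda>x. u x - t *\<^sub>R v x))\<^sup>2" by simp
    then show ?thesis
      using assms by (simp add: L2norm_diff_power2 L2_scale L2inner_scale_right L2norm_scale power_mult_distrib)
  qed
  show ?thesis
  proof (cases "L2norm v = 0")
    case True
    have "L2inner u v = 0"
    proof (rule ccontr)
      assume ne: "L2inner u v \<noteq> 0"
      \<comment> \<open>With \<open>L2norm v = 0\<close> the lower bound is affine in
        \<open>t\<close>; this \<open>t\<close> gives it the value -1.\<close>
      show False
        using key[of "((L2norm u)\<^sup>2 + 1) / (2 * L2inner u v)"] True ne by simp
    qed
    then show ?thesis by simp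
  next
    case False
    have "0 \<le> (L2norm u)\<^sup>2 - (L2inner u v)\<^sup>2 / (L2norm v)\<^sup>2"
      using key[of "L2inner u v / (L2norm v)\<^sup>2"] False
      by (simp add: field_simps power2_eq_square)
    then have "(L2inner u v)\<^sup>2 \<le> (L2norm u * L2norm v)\<^sup>2"
      using False by (simp add: field_simps power_mult_distrib)
    then show ?thesis
      by (metis L2norm_nonneg abs_le_square_iff abs_of_nonneg mult_nonneg_nonneg)
  qed
qed

text \<open>Cauchy-Schwarz for the scalar functions |u| and |v|, placed in the first component of a
  field.\<close>

lemma integral_norm_mult_le:
  assumes "L2 u" "L2 v"
  shows "(\<integral>x. norm (u x) * norm (v x) \<partial>cell) \<le> L2norm u * L2norm v"
proof -
  have n: "L2 (\<lambda>x. (norm (w x), 0))" "L2norm (\<lambda>x. (norm (w x), 0)) = L2norm w" if "L2 w" for w :: vf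
    using that by (auto simp: L2_def L2norm_cell)
  have "L2inner (\<lambda>x. (norm (u x), 0)) (\<lambda>x. (norm (v x), 0)) = (\<integral>x. norm (u x) * norm (v x) \<partial>cell)"
    by (simp add: L2inner_cell)
  then show ?thesis
    using L2_Cauchy_Schwarz[OF n(1)[OF assms(1)] n(1)[OF assms(2)]] n(2) assms by simp
qed

lemma L2norm_triangle:
  assumes "L2 u" "L2 v"
  shows "L2norm (\<lambda>x. u x + v x) \<le> L2norm u + L2norm v"
proof (rule power2_le_imp_le)
  show "(L2norm (\<lambda>x. u x + v x))\<^sup>2 \<le> (L2norm u + L2norm v)\<^sup>2"
    using L2_Cauchy_Schwarz[OF assms] by (simp add: L2norm_add_power2 assms power2_sum)
qed simp

lemma L2norm_triangle_diff:
  assumes "L2 u" "L2 v" "L2 w"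
  shows "L2norm (\<lambda>x. u x - w x) \<le> L2norm (\<lambda>x. u x - v x) + L2norm (\<lambda>x. v x - w x)"
  using L2norm_triangle[OF L2_diff[OF assms(1,2)] L2_diff[OF assms(2,3)]] by simp

lemma L2norm_le_add:
  assumes "L2 u" "L2 v"
  shows "L2norm u \<le> L2norm (\<lambda>x. u x - v x) + L2norm v"
  using L2norm_triangle[OF L2_diff[OF assms] assms(2)] by simp

lemma L2norm_eq_0_iff:
  assumes "L2 u"
  shows "L2norm u = 0 \<longleftrightarrow> (AE x in cell. u x = 0)"
proof -
  have "L2norm u = 0 \<longleftrightarrow> (\<integral>x. (norm (u x))\<^sup>2 \<partial>cell) = 0"
    by (metis L2norm_power2 zero_eq_power2)
  also have "\<dots> \<longleftrightarrow> (AE x in cell. (norm (u x))\<^sup>2 = 0)"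
    using assms by (intro integral_nonneg_eq_0_iff_AE) (auto simp: L2_def)
  finally show ?thesis by simp
qed

lemma L2norm_cong_AE:
  assumes "L2 u" "L2 v" "AE x in cell. u x = v x"
  shows "L2norm u = L2norm v"
  unfolding L2norm_cell using assms(3) assms(1,2)[THEN L2_measurable]
  by (intro arg_cong[where f=sqrt] integral_cong_AE borel_measurable_cell) auto

lemma L2inner_tendsto:
  assumes "\<And>n. L2 (s n)" "L2 u" "L2 w" "(\<lambda>n. L2norm (\<lambda>x. s n x - u x)) \<longlonglongrightarrow> 0"
  shows "(\<lambda>n. L2inner (s n) w) \<longlonglongrightarrow> L2inner u w"
proof -
  have "(\<lambda>n. L2inner (s n) w - L2inner u w) \<longlonglongrightarrow> 0"
  proof (rule Lim_null_comparison)
    show "\<forall>\<^sub>F n in sequentially. norm (L2inner (s n) w - L2inner u w) \<le> L2norm (\<lambda>x. s n x - u x) * L2norm w"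
      using L2_Cauchy_Schwarz[of "\<lambda>x. s _ x - u x" w] assms(1-3)
      by (simp add: L2inner_diff_left L2_diff)
    show "(\<lambda>n. L2norm (\<lambda>x. s n x - u x) * L2norm w) \<longlonglongrightarrow> 0"
      using tendsto_mult_right[OF assms(4), of "L2norm w"] by simp
  qed
  then show ?thesis by (simp add: LIM_zero_iff)
qed

lemma L2norm_tendsto:
  assumes "\<And>n. L2 (s n)" "L2 u" "(\<lambda>n. L2norm (\<lambda>x. s n x - u x)) \<longlonglongrightarrow> 0"
  shows "(\<lambda>n. L2norm (s n)) \<longlonglongrightarrow> L2norm u"
proof -
  have "(\<lambda>n. L2norm (s n) - L2norm u) \<longlonglongrightarrow> 0"
  proof (rule Lim_null_comparison[OF _ assms(3)])
    show "\<forall>\<^sub>F n in sequentially. norm (L2norm (s n) - L2norm u) \<le> L2norm (\<lambda>x. s n x - u x)"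
      using L2norm_le_add[OF assms(1) assms(2)] L2norm_le_add[OF assms(2) assms(1)]
      by (intro always_eventually) (auto simp: abs_le_iff L2norm_minus_commute[of u] algebra_simps)
  qed
  then show ?thesis by (simp add: LIM_zero_iff)
qed

section \<open>Divergence-free fields as a closed subspace\<close>

lemma C1per_bounded_derivative:
  assumes "C1per \<phi> D"
  obtains B where "\<And>x. x \<in> {0..1} \<times> {0..1} \<Longrightarrow> norm (D x) \<le> B"
proof -
  have "compact (D ` ({0..1} \<times> {0..1}))"
    using assms
    by (intro compact_continuous_image compact_Times) (auto simp: C1per_def intro: continuous_on_subset)
  then show ?thesis
    using that compact_imp_bounded bounded_iff by (metis imageI)
qed

lemma C1per_L2_derivative:
  assumes "C1per \<phi> D"
  shows "L2 D"
proof -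
  obtain B where "\<And>x. x \<in> {0..1} \<times> {0..1} \<Longrightarrow> norm (D x) \<le> B"
    using C1per_bounded_derivative[OF assms] by blast
  then show ?thesis
    using assms by (intro L2_bounded[where B=B] borel_measurable_continuous_onI)
      (auto simp: cellQ_def C1per_def)
qed

lemma div_free_add_scale:
  assumes "L2 u" "L2 v" "div_free u" "div_free v"
  shows "div_free (\<lambda>x. u x + c *\<^sub>R v x)"
  unfolding div_free_def set_integral_cell
proof (intro allI impI)
  fix \<phi> D assume C: "C1per \<phi> D"
  have "L2 D" using C by (rule C1per_L2_derivative)
  then show "(\<integral>x. (u x + c *\<^sub>R v x) \<bullet> D x \<partial>cell) = 0"
    using assms C integrable_inner[OF assms(1)] integrable_inner[OF assms(2)]
    by (simp add: inner_add_left div_free_def set_integral_cell)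
qed

lemma Hset_add: "u \<in> Hset \<Longrightarrow> v \<in> Hset \<Longrightarrow> (\<lambda>x. u x + v x) \<in> Hset"
  using div_free_add_scale[of u v 1] by (simp add: Hset_iff L2_add)

lemma Hset_zero: "(\<lambda>x. 0) \<in> Hset"
  by (simp add: Hset_iff L2_zero div_free_def set_integral_cell)

lemma Hset_scale: "u \<in> Hset \<Longrightarrow> (\<lambda>x. c *\<^sub>R u x) \<in> Hset"
  using div_free_add_scale[of "\<lambda>x. 0" u c] Hset_zero by (simp add: Hset_iff L2_scale)

lemma Hset_diff: "u \<in> Hset \<Longrightarrow> v \<in> Hset \<Longrightarrow> (\<lambda>x. u x - v x) \<in> Hset"
  using Hset_add[of u "\<lambda>x. (-1) *\<^sub>R v x"] Hset_scale[of v "-1"] by simp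

lemma Hset_sum: "(\<And>i. i \<in> I \<Longrightarrow> f i \<in> Hset) \<Longrightarrow> (\<lambda>x. \<Sum>i\<in>I. f i x) \<in> Hset"
  by (induction I rule: infinite_finite_induct) (auto simp: Hset_zero Hset_add)

text \<open>Each divergence test is an inner product with a bounded gradient, hence continuous in
  \<open>L^2\<close>.\<close>

lemma Hset_L2_closed:
  assumes "\<And>n. s n \<in> Hset" "L2 u" "(\<lambda>n. L2norm (\<lambda>x. s n x - u x)) \<longlonglongrightarrow> 0"
  shows "u \<in> Hset"
proof -
  have "div_free u"
    unfolding div_free_def
  proof (intro allI impI)
    fix \<phi> D assume C: "C1per \<phi> D"
    have "(\<lambda>n. L2inner (s n) D) \<longlonglongrightarrow> L2inner u D"
      by (rule L2inner_tendsto) (use assms C in \<open>auto simp: Hset_iff C1per_L2_derivative\<close>)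
    moreover have "L2inner (s n) D = 0" for n
      using assms(1)[of n] C by (auto simp: Hset_iff div_free_def L2inner_def)
    ultimately show "(LINT x:cellQ|lborel. u x \<bullet> D x) = 0"
      by (simp add: LIMSEQ_const_iff L2inner_def)
  qed
  then show ?thesis using assms(2) by (simp add: Hset_iff)
qed

section \<open>Calculus on the torus\<close>

lemma C1per_const: "C1per (\<lambda>x. c) (\<lambda>x. 0)"
  by (auto simp: C1per_def)

lemma C1per_add:
  "C1per f D \<Longrightarrow> C1per g E \<Longrightarrow> C1per (\<lambda>x. f x + g x) (\<lambda>x. D x + E x)"
  unfolding C1per_def
  by (auto intro!: continuous_intros derivative_eq_intros simp: inner_add_left)

lemma C1per_mult:
  "C1per f D \<Longrightarrow> C1per g E \<Longrightarrow> C1per (\<lambda>x. f x * g x) (\<lambda>x. f x *\<^sub>R E x + g x *\<^sub>R D x)"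
  unfolding C1per_def
proof (intro conjI allI; (elim conjE)?)
  assume f: "\<forall>x. (f has_derivative (\<bullet>) (D x)) (at x)" and g: "\<forall>x. (g has_derivative (\<bullet>) (E x)) (at x)"
    and DE: "continuous_on UNIV D" "continuous_on UNIV E"
  have "continuous_on UNIV f" "continuous_on UNIV g"
    using f g by (meson continuous_at_imp_continuous_on has_derivative_continuous)+
  then show "continuous_on UNIV (\<lambda>x. f x *\<^sub>R E x + g x *\<^sub>R D x)"
    using DE by (intro continuous_intros)
  show "((\<lambda>x. f x * g x) has_derivative (\<bullet>) (f x *\<^sub>R E x + g x *\<^sub>R D x)) (at x)" for x
    by (rule has_derivative_eq_rhs[OF has_derivative_mult[OF f[rule_format] g[rule_format]]])
       (auto simp: inner_add_left algebra_simps)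
qed auto

lemma C1per_cmult: "C1per f D \<Longrightarrow> C1per (\<lambda>x. c * f x) (\<lambda>x. c *\<^sub>R D x)"
  using C1per_mult[OF C1per_const[of c]] by simp

lemma C1per_sum:
  "(\<And>i. i \<in> I \<Longrightarrow> C1per (f i) (D i)) \<Longrightarrow> C1per (\<lambda>x. \<Sum>i\<in>I. f i x) (\<lambda>x. \<Sum>i\<in>I. D i x)"
  by (induction I rule: infinite_finite_induct) (auto simp: C1per_const C1per_add)

lemma C1per_continuous: "C1per f D \<Longrightarrow> continuous_on UNIV f"
  unfolding C1per_def by (meson continuous_at_imp_continuous_on has_derivative_continuous)

section \<open>Integration by parts for periodic functions\<close>

lemma integral_periodic_derivative:
  fixes g :: "real \<Rightarrow> real"
  assumes "\<And>y. (g has_real_derivative g' y) (at y)" "continuous_on UNIV g'" "g 1 = g 0"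
  shows "(\<integral>y. indicator {0..<1} y * g' y \<partial>lborel) = 0"
proof -
  have "(\<integral>y. indicator {0..<1} y * g' y \<partial>lborel) = (\<integral>y. g' y * indicator {0..1} y \<partial>lborel)"
  proof (rule integral_cong_AE)
    have [measurable]: "g' \<in> borel_measurable borel"
      by (rule borel_measurable_continuous_onI[OF assms(2)])
    show "(\<lambda>y. indicator {0..<1} y * g' y) \<in> borel_measurable lborel"
      "(\<lambda>y. g' y * indicator {0..1} y) \<in> borel_measurable lborel"
      by measurable
    show "AE y in lborel. indicator {0..<1} y * g' y = g' y * indicator {0..1} y"
      using AE_lborel_singleton[of 1] by eventually_elim (auto simp: indicator_def)
  qed
  also have "\<dots> = g 1 - g 0"
    by (rule integral_FTC_Icc_real)
       (use assms in \<open>auto simp: continuous_on_eq_continuous_at\<close>)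
  finally show ?thesis using assms(3) by simp
qed

text \<open>Fubini and the fundamental theorem of calculus along each axis. Applied to single waves
  it gives orthogonality; applied to products it is the integration by parts behind the divergence
  freeness of the modes and the weak gradients.\<close>

lemma integral_C1per_derivative:
  assumes "C1per \<phi> D"
  shows "(\<integral>x. D x \<bullet> h \<partial>cell) = 0"
proof -
  have D: "continuous_on UNIV D" "\<And>x. (\<phi> has_derivative (\<lambda>h. D x \<bullet> h)) (at x)"
    and per: "\<And>x. \<phi> (x + (1, 0)) = \<phi> x" "\<And>x. \<phi> (x + (0, 1)) = \<phi> x"
    using assms by (auto simp: C1per_def)
  have int: "integrable cell (\<lambda>x. D x \<bullet> h)" for h
    by (rule integrable_inner[OF C1per_L2_derivative[OF assms] L2_bounded[of _ "norm h"]]) auto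
  have "integrable (lborel \<Otimes>\<^sub>M lborel) (\<lambda>(x, y). indicator cellQ (x, y) *\<^sub>R (D (x, y) \<bullet> h))" for h
    using int[of h] unfolding set_integrable_cell[symmetric] set_integrable_def lborel_prod
    by (simp add: case_prod_unfold)
  note fub = lborel_pair.integral_fst[OF this] lborel_pair.integral_snd[OF this]
  have eq: "(\<integral>x. D x \<bullet> h \<partial>cell)
      = integral\<^sup>L (lborel \<Otimes>\<^sub>M lborel) (\<lambda>(x, y). indicator cellQ (x, y) *\<^sub>R (D (x, y) \<bullet> h))" for h
    unfolding set_integral_cell[symmetric] set_lebesgue_integral_def lborel_prod
    by (simp add: case_prod_unfold)
  have ind: "indicator cellQ (x, y) = (indicator {0..<1} x * indicator {0..<1} y :: real)" for x y
    by (simp add: cellQ_def indicator_times)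
  have x: "(\<integral>x. D x \<bullet> (1, 0) \<partial>cell) = 0"
  proof -
    have "(\<integral>x. indicator {0..<1} x * (D (x, y) \<bullet> (1, 0)) \<partial>lborel) = 0" for y
    proof (rule integral_periodic_derivative)
      show "((\<lambda>x. \<phi> (x, y)) has_real_derivative D (x, y) \<bullet> (1, 0)) (at x)" for x
        unfolding has_field_derivative_def
        by (rule has_derivative_eq_rhs[OF has_derivative_compose[OF _ D(2), where f="\<lambda>x. (x, y)" and f'="\<lambda>h. (h, 0)"]])
           (auto intro!: derivative_eq_intros simp: inner_prod_def)
      show "continuous_on UNIV (\<lambda>x. D (x, y) \<bullet> (1, 0))"
        by (intro continuous_intros continuous_on_compose2[OF D(1)]) auto
      show "\<phi> (1, y) = \<phi> (0, y)"
        using per(1)[of "(0, y)"] by simp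
    qed
    then have "(\<integral>x. indicator {0..<1} y * (indicator {0..<1} x * (D (x, y) \<bullet> (1, 0))) \<partial>lborel) = 0" for y
      by (simp only: integral_mult_right_zero mult_zero_right)
    moreover have "indicator cellQ (x, y) *\<^sub>R (D (x, y) \<bullet> (1, 0))
        = indicator {0..<1} y * (indicator {0..<1} x * (D (x, y) \<bullet> (1, 0)))" for x y
      by (simp add: ind)
    ultimately have "(\<integral>x. indicator cellQ (x, y) *\<^sub>R (D (x, y) \<bullet> (1, 0)) \<partial>lborel) = 0" for y
      by (simp only:)
    then show ?thesis unfolding eq fub(2)[symmetric] by simp
  qed
  have y: "(\<integral>x. D x \<bullet> (0, 1) \<partial>cell) = 0"
  proof -
    have "(\<integral>y. indicator {0..<1} y * (D (x, y) \<bullet> (0, 1)) \<partial>lborel) = 0" for x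
    proof (rule integral_periodic_derivative)
      show "((\<lambda>y. \<phi> (x, y)) has_real_derivative D (x, y) \<bullet> (0, 1)) (at y)" for y
        unfolding has_field_derivative_def
        by (rule has_derivative_eq_rhs[OF has_derivative_compose[OF _ D(2), where f="\<lambda>y. (x, y)" and f'="\<lambda>h. (0, h)"]])
           (auto intro!: derivative_eq_intros simp: inner_prod_def)
      show "continuous_on UNIV (\<lambda>y. D (x, y) \<bullet> (0, 1))"
        by (intro continuous_intros continuous_on_compose2[OF D(1)]) auto
      show "\<phi> (x, 1) = \<phi> (x, 0)"
        using per(2)[of "(x, 0)"] by simp
    qed
    then have "(\<integral>y. indicator cellQ (x, y) *\<^sub>R (D (x, y) \<bullet> (0, 1)) \<partial>lborel) = 0" for x
      by (simp add: ind mult.assoc)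
    then show ?thesis unfolding eq fub(1)[symmetric] by simp
  qed
  have "D x \<bullet> h = fst h * (D x \<bullet> (1, 0)) + snd h * (D x \<bullet> (0, 1))" for x
    by (simp add: inner_prod_def)
  then show ?thesis using int x y by simp
qed

text \<open>Unlike sines and cosines, which need a half lattice of wave vectors, the functions
  \<open>cas(2\<pi>k\<cdot>x)\<close>, \<open>k\<close> ranging over all of \<open>\<int>\<^sup>2\<close>, are already orthonormal.\<close>

definition cas :: "real \<Rightarrow> real" where
  "cas t = cos t + sin t"

lemma cas_0 [simp]: "cas 0 = 1"
  by (simp add: cas_def)

lemma abs_cas_le: "\<bar>cas t\<bar> \<le> 2"
  using abs_cos_le_one[of t] abs_sin_le_one[of t] unfolding cas_def by linarith

lemma continuous_on_cas [continuous_intros]: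
  fixes f :: "'a::t2_space \<Rightarrow> real"
  shows "continuous_on S f \<Longrightarrow> continuous_on S (\<lambda>x. cas (f x))"
  unfolding cas_def by (auto intro: continuous_on_add continuous_on_cos continuous_on_sin)

lemma cas_mult: "cas a * cas b = cos (a - b) + sin (a + b)"
  by (simp add: cas_def cos_diff sin_add algebra_simps)

lemma cos_eq_cas: "cos t = (cas t + cas (- t)) / 2"
  and sin_eq_cas: "sin t = (cas t - cas (- t)) / 2"
  by (simp_all add: cas_def)

definition Z2 :: "(real \<times> real) set" where
  "Z2 = \<int> \<times> \<int>"

text \<open>The derivative of \<open>cas t\<close> is \<open>cas (- t)\<close>, so Hartley functions
  are closed under differentiation up to a reflection of the argument; this explains the reflected
  arguments in all later gradients.\<close>

lemma C1per_trig:
  assumes "k \<in> Z2"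
  shows "C1per (\<lambda>x. cas (2 * pi * (k \<bullet> x))) (\<lambda>x. (2 * pi * cas (- (2 * pi * (k \<bullet> x)))) *\<^sub>R k)" (is ?cas)
    and "C1per (\<lambda>x. cas (- (2 * pi * (k \<bullet> x)))) (\<lambda>x. (- 2 * pi * cas (2 * pi * (k \<bullet> x))) *\<^sub>R k)" (is ?cas')
    and "C1per (\<lambda>x. cos (2 * pi * (k \<bullet> x))) (\<lambda>x. (- 2 * pi * sin (2 * pi * (k \<bullet> x))) *\<^sub>R k)" (is ?cos)
    and "C1per (\<lambda>x. sin (2 * pi * (k \<bullet> x))) (\<lambda>x. (2 * pi * cos (2 * pi * (k \<bullet> x))) *\<^sub>R k)" (is ?sin)
proof -
  have shift: "cos (t + 2 * pi * m) = cos t" "sin (t + 2 * pi * m) = sin t" if "m \<in> \<int>" for t m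
    using that by (auto simp: cos_add sin_add cos_integer_2pi sin_integer_2pi elim!: Ints_cases)
  have k: "fst k \<in> \<int>" "snd k \<in> \<int>" using assms by (auto simp: Z2_def)
  have per: "k \<bullet> (x + (1, 0)) = k \<bullet> x + fst k" "k \<bullet> (x + (0, 1)) = k \<bullet> x + snd k" for x
    by (simp_all add: inner_prod_def algebra_simps)
  show c: ?cos
    unfolding C1per_def
    by (auto intro!: continuous_intros derivative_eq_intros simp: per shift k distrib_left inner_commute)
  show s: ?sin
    unfolding C1per_def
    by (auto intro!: continuous_intros derivative_eq_intros simp: per shift k distrib_left inner_commute)
  show ?cas
    using C1per_add[OF c s] by (simp add: cas_def algebra_simps scaleR_add_left[symmetric] flip: scaleR_diff_left)
  show ?cas'
    using C1per_add[OF c C1per_cmult[OF s, of "-1"]]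
    by (simp add: cas_def algebra_simps)
qed

text \<open>Cosine and sine are derivatives of one another up to sign: paired with \<open>k\<close>
  itself, the gradient is the function times a multiple of \<open>k \<bullet> k\<close>, which is
  nonzero unless \<open>k = 0\<close>.\<close>

lemma integral_trig_nonzero:
  assumes "k \<in> Z2"
  shows "k \<noteq> 0 \<Longrightarrow> (\<integral>x. cos (2 * pi * (k \<bullet> x)) \<partial>cell) = 0"
    and "(\<integral>x. sin (2 * pi * (k \<bullet> x)) \<partial>cell) = 0"
proof -
  show "(\<integral>x. cos (2 * pi * (k \<bullet> x)) \<partial>cell) = 0" if "k \<noteq> 0"
    using integral_C1per_derivative[OF C1per_trig(4)[OF assms], of k] that by simp
  show "(\<integral>x. sin (2 * pi * (k \<bullet> x)) \<partial>cell) = 0"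
    using integral_C1per_derivative[OF C1per_trig(3)[OF assms], of k] by (cases "k = 0") auto
qed

lemma integrable_bounded_cell:
  fixes f :: "real \<times> real \<Rightarrow> real"
  assumes "continuous_on UNIV f" "\<And>x. \<bar>f x\<bar> \<le> B"
  shows "integrable cell f"
  by (rule cell.integrable_const_bound[where B=B])
     (use assms in \<open>auto intro!: borel_measurable_cell borel_measurable_continuous_onI\<close>)

text \<open>The product is the cosine of the difference plus the sine of the sum. The sine has mean
  zero for every wave vector, zero included, so \<open>k = - l\<close> is no exception and only
  \<open>k = l\<close> leaves a contribution.\<close>

lemma integral_cas_mult:
  assumes "k \<in> Z2" "l \<in> Z2"
  shows "(\<integral>x. cas (2 * pi * (k \<bullet> x)) * cas (2 * pi * (l \<bullet> x)) \<partial>cell) = (if k = l then 1 else 0)"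
proof -
  have kl: "k - l \<in> Z2" "k + l \<in> Z2" using assms by (auto simp: Z2_def mem_Times_iff)
  have "(\<integral>x. cas (2 * pi * (k \<bullet> x)) * cas (2 * pi * (l \<bullet> x)) \<partial>cell)
      = (\<integral>x. cos (2 * pi * ((k - l) \<bullet> x)) + sin (2 * pi * ((k + l) \<bullet> x)) \<partial>cell)"
    by (simp add: cas_mult inner_add_left inner_diff_left algebra_simps)
  also have "\<dots> = (\<integral>x. cos (2 * pi * ((k - l) \<bullet> x)) \<partial>cell) + (\<integral>x. sin (2 * pi * ((k + l) \<bullet> x)) \<partial>cell)"
    by (intro Bochner_Integration.integral_add integrable_bounded_cell[of _ 1] continuous_intros) auto
  also have "\<dots> = (if k = l then 1 else 0)"
    using integral_trig_nonzero[OF kl(1)] integral_trig_nonzero[OF kl(2)] cell.prob_space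
    by auto
  finally show ?thesis .
qed

section \<open>An orthonormal basis of divergence free fields\<close>

text \<open>\<open>Some k\<close> is the mode with wave vector \<open>k\<close>; divergence freeness leaves one direction for it,
  except that \<open>k = 0\<close> admits two, the second of which is \<open>None\<close>.\<close>

type_synonym mode = "(int \<times> int) option"

fun wave :: "mode \<Rightarrow> real \<times> real" where
  "wave None = 0"
| "wave (Some k) = (real_of_int (fst k), real_of_int (snd k))"

fun direction :: "mode \<Rightarrow> real \<times> real" where
  "direction None = (0, 1)"
| "direction (Some k) = (if k = 0 then (1, 0)
     else (1 / norm (wave (Some k))) *\<^sub>R (- snd (wave (Some k)), fst (wave (Some k))))"

definition mode :: "nat \<Rightarrow> mode" where
  "mode = from_nat_into UNIV"

abbreviation kk :: "nat \<Rightarrow> real \<times> real" where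
  "kk n \<equiv> wave (mode n)"

abbreviation dd :: "nat \<Rightarrow> real \<times> real" where
  "dd n \<equiv> direction (mode n)"

definition ee :: "nat \<Rightarrow> vf" where
  "ee n = (\<lambda>x. cas (2 * pi * (kk n \<bullet> x)) *\<^sub>R dd n)"

lemma bij_mode: "bij mode"
  unfolding mode_def by (rule bij_betw_from_nat_into) (simp_all add: infinite_UNIV_char_0 finite_prod)

lemma wave_eq_0_iff: "wave (Some k) = 0 \<longleftrightarrow> k = 0"
  by (cases k) (simp add: zero_prod_def)

lemma norm_direction [simp]: "norm (direction m) = 1"
proof (cases m)
  case (Some k)
  have "norm (- snd w, fst w) = norm w" for w :: "real \<times> real"
    by (simp add: norm_prod_def add.commute)
  then have "norm ((1 / norm w) *\<^sub>R (- snd w, fst w)) = 1" if "w \<noteq> 0" for w :: "real \<times> real"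
    using that by (simp only: norm_scaleR) simp
  then show ?thesis
    using Some wave_eq_0_iff[of k] by (simp del: wave.simps scaleR_Pair norm_scaleR)
qed auto

lemma wave_direction [simp]: "wave m \<bullet> direction m = 0"
  by (cases m) (auto simp: inner_prod_def)

lemma direction_orthogonal:
  assumes "wave m = wave n" "m \<noteq> n"
  shows "direction m \<bullet> direction n = 0"
  using assms
  by (cases m; cases n) (auto simp: wave_eq_0_iff[symmetric] zero_prod_def prod_eq_iff)

lemma wave_Z2 [simp]: "wave m \<in> Z2"
  by (cases m) (auto simp: Z2_def zero_prod_def)

lemma continuous_on_ee: "continuous_on UNIV (ee n)"
  unfolding ee_def by (intro continuous_intros)

lemma norm_ee_le: "norm (ee n x) \<le> 2"
  using abs_cas_le by (simp add: ee_def)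

text \<open>Because \<open>dd n\<close> is orthogonal to \<open>kk n\<close>, pairing the mode with
  a gradient gives the derivative of a periodic product, \<open>\<phi>\<close> times the wave, in
  direction \<open>dd n\<close>.\<close>

lemma ee_Hset [simp]: "ee n \<in> Hset"
proof -
  have "L2 (ee n)"
    by (rule L2_bounded[where B=2]) (auto intro: borel_measurable_continuous_onI continuous_on_ee norm_ee_le)
  moreover have "div_free (ee n)"
    unfolding div_free_def set_integral_cell
  proof (intro allI impI)
    fix \<phi> D assume C: "C1per \<phi> D"
    have "ee n x \<bullet> D x = (\<phi> x *\<^sub>R ((2 * pi * cas (- (2 * pi * (kk n \<bullet> x)))) *\<^sub>R kk n) + cas (2 * pi * (kk n \<bullet> x)) *\<^sub>R D x) \<bullet> dd n" for x
      by (simp add: ee_def inner_add_left inner_commute[of "dd n"])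
    then show "(\<integral>x. ee n x \<bullet> D x \<partial>cell) = 0"
      using integral_C1per_derivative[OF C1per_mult[OF C C1per_trig(1)[OF wave_Z2]], of "mode n" "dd n"]
      by simp
  qed
  ultimately show ?thesis by (simp add: Hset_iff)
qed

lemma ee_L2 [simp]: "L2 (ee n)"
  using ee_Hset Hset_L2 by blast

lemma ee_orthonormal: "L2inner (ee m) (ee n) = (if m = n then 1 else 0)"
proof -
  have "L2inner (ee m) (ee n)
      = (\<integral>x. cas (2 * pi * (kk m \<bullet> x)) * cas (2 * pi * (kk n \<bullet> x)) \<partial>cell) * (dd m \<bullet> dd n)"
    unfolding L2inner_cell integral_mult_left_zero[symmetric]
    by (rule Bochner_Integration.integral_cong) (simp_all add: ee_def)
  also have "\<dots> = (if m = n then 1 else 0)"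
  proof (cases "m = n")
    case False
    then have "mode m \<noteq> mode n" using bij_mode by (simp add: bij_def inj_eq)
    then show ?thesis using False direction_orthogonal by (simp add: integral_cas_mult)
  qed (simp add: integral_cas_mult dot_square_norm)
  finally show ?thesis .
qed

definition coef :: "nat \<Rightarrow> vf \<Rightarrow> real" where
  "coef n u = L2inner u (ee n)"

definition psum :: "nat \<Rightarrow> (nat \<Rightarrow> real) \<Rightarrow> vf" where
  "psum N a = (\<lambda>x. \<Sum>i<N. a i *\<^sub>R ee i x)"

lemma psum_Hset [simp]: "psum N a \<in> Hset"
  unfolding psum_def by (intro Hset_sum Hset_scale ee_Hset)

lemma psum_L2 [simp]: "L2 (psum N a)"
  using psum_Hset Hset_L2 by blast

lemma coef_psum: "coef n (psum N a) = (if n < N then a n else 0)"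
proof -
  have "coef n (psum N a) = (\<Sum>i<N. a i * (if i = n then 1 else 0))"
    unfolding coef_def psum_def
    by (simp add: L2inner_sum_left L2_scale L2inner_scale_left ee_orthonormal)
  also have "\<dots> = (if n < N then a n else 0)" by (simp add: sum.If_cases if_distrib cong: if_cong)
  finally show ?thesis .
qed

lemma L2inner_psum: "L2 u \<Longrightarrow> L2inner u (psum N a) = (\<Sum>i<N. a i * coef i u)"
  unfolding coef_def psum_def
  by (simp add: L2inner_commute[of u] L2inner_sum_left L2_scale L2inner_scale_left)

lemma L2norm_psum: "(L2norm (psum N a))\<^sup>2 = (\<Sum>i<N. (a i)\<^sup>2)"
  unfolding L2inner_self[symmetric] by (simp add: L2inner_psum coef_psum power2_eq_square)

lemma L2norm_diff_psum:
  "L2 u \<Longrightarrow> (L2norm (\<lambda>x. u x - psum N (\<lambda>i. coef i u) x))\<^sup>2 = (L2norm u)\<^sup>2 - (\<Sum>i<N. (coef i u)\<^sup>2)"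
  by (simp add: L2norm_diff_power2 L2inner_psum L2norm_psum flip: power2_eq_square)

lemma Bessel: "L2 u \<Longrightarrow> (\<Sum>i<N. (coef i u)\<^sup>2) \<le> (L2norm u)\<^sup>2"
  using L2norm_diff_psum[of u N] zero_le_power2[of "L2norm (\<lambda>x. u x - psum N (\<lambda>i. coef i u) x)"] by linarith

section \<open>Uniqueness of Fourier coefficients\<close>

text \<open>Generated by sums of \<open>cas\<close> terms only, so vanishing coefficients annihilate
  it term by term; closure under products, needed for Stone-Weierstrass, is derived from
  \<open>cas_mult\<close>.\<close>

inductive trig_poly :: "(real \<times> real \<Rightarrow> real) \<Rightarrow> bool" where
  cas: "k \<in> Z2 \<Longrightarrow> trig_poly (\<lambda>x. c * cas (2 * pi * (k \<bullet> x)))"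
| add: "trig_poly f \<Longrightarrow> trig_poly g \<Longrightarrow> trig_poly (\<lambda>x. f x + g x)"

lemma Z2_closed: "k \<in> Z2 \<Longrightarrow> l \<in> Z2 \<Longrightarrow> k + l \<in> Z2" "k \<in> Z2 \<Longrightarrow> l \<in> Z2 \<Longrightarrow> k - l \<in> Z2"
  "k \<in> Z2 \<Longrightarrow> - k \<in> Z2" "0 \<in> Z2" "(1, 0) \<in> Z2" "(0, 1) \<in> Z2"
  by (auto simp: Z2_def mem_Times_iff)

lemma trig_poly_cos:
  assumes "k \<in> Z2"
  shows "trig_poly (\<lambda>x. c * cos (2 * pi * (k \<bullet> x)))"
proof -
  have "trig_poly (\<lambda>x. (c / 2) * cas (2 * pi * (k \<bullet> x)) + (c / 2) * cas (2 * pi * ((- k) \<bullet> x)))"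
    using assms by (intro trig_poly.intros Z2_closed)
  moreover have "(\<lambda>x. (c / 2) * cas (2 * pi * (k \<bullet> x)) + (c / 2) * cas (2 * pi * ((- k) \<bullet> x)))
      = (\<lambda>x. c * cos (2 * pi * (k \<bullet> x)))"
    by (auto simp: cos_eq_cas field_simps)
  ultimately show ?thesis by simp
qed

lemma trig_poly_sin:
  assumes "k \<in> Z2"
  shows "trig_poly (\<lambda>x. c * sin (2 * pi * (k \<bullet> x)))"
proof -
  have "trig_poly (\<lambda>x. (c / 2) * cas (2 * pi * (k \<bullet> x)) + (- c / 2) * cas (2 * pi * ((- k) \<bullet> x)))"
    using assms by (intro trig_poly.intros Z2_closed)
  moreover have "(\<lambda>x. (c / 2) * cas (2 * pi * (k \<bullet> x)) + (- c / 2) * cas (2 * pi * ((- k) \<bullet> x)))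
      = (\<lambda>x. c * sin (2 * pi * (k \<bullet> x)))"
    by (auto simp: sin_eq_cas field_simps)
  ultimately show ?thesis by simp
qed

lemma trig_poly_mult:
  assumes "trig_poly f" "trig_poly g"
  shows "trig_poly (\<lambda>x. f x * g x)"
  using assms(1)
proof induction
  case (cas k c)
  note k = this
  from assms(2) show ?case
  proof induction
    case (cas l d)
    have "trig_poly (\<lambda>x. (c * d) * cos (2 * pi * ((k - l) \<bullet> x)) + (c * d) * sin (2 * pi * ((k + l) \<bullet> x)))"
      using k cas by (intro trig_poly.add trig_poly_cos trig_poly_sin Z2_closed)
    moreover have "(c * d) * cos (2 * pi * ((k - l) \<bullet> x)) + (c * d) * sin (2 * pi * ((k + l) \<bullet> x))
        = c * cas (2 * pi * (k \<bullet> x)) * (d * cas (2 * pi * (l \<bullet> x)))" for x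
    proof -
      have "c * cas (2 * pi * (k \<bullet> x)) * (d * cas (2 * pi * (l \<bullet> x)))
          = c * d * (cas (2 * pi * (k \<bullet> x)) * cas (2 * pi * (l \<bullet> x)))" by simp
      then show ?thesis
        by (simp add: cas_mult inner_add_left inner_diff_left algebra_simps)
    qed
    ultimately show ?case by simp
  next
    case (add f g)
    then show ?case using trig_poly.add by (simp add: distrib_left)
  qed
next
  case (add f1 f2)
  then show ?case using trig_poly.add by (simp add: distrib_right)
qed

lemma trig_poly_continuous: "trig_poly p \<Longrightarrow> continuous_on UNIV p"
  by (induction rule: trig_poly.induct) (auto intro!: continuous_intros)

lemma trig_poly_bounded: "trig_poly p \<Longrightarrow> \<exists>B. \<forall>x. \<bar>p x\<bar> \<le> B"
proof (induction rule: trig_poly.induct)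
  case (cas k c)
  then show ?case
    using abs_cas_le by (intro exI[of _ "\<bar>c\<bar> * 2"]) (auto simp: abs_mult intro: mult_left_mono)
next
  case (add f g)
  then obtain A B where "\<And>x. \<bar>f x\<bar> \<le> A" "\<And>x. \<bar>g x\<bar> \<le> B" by auto
  then show ?case
    by (intro exI[of _ "A + B"] allI order_trans[OF abs_triangle_ineq] add_mono)
qed

lemma integrable_mult_bounded_cell:
  fixes f g :: "real \<times> real \<Rightarrow> real"
  assumes "integrable cell f" "g \<in> borel_measurable borel" "\<And>x. \<bar>g x\<bar> \<le> B"
  shows "integrable cell (\<lambda>x. f x * g x)"
proof (rule Bochner_Integration.integrable_bound)
  show "integrable cell (\<lambda>x. B * f x)" using assms(1) by simp
  show "(\<lambda>x. f x * g x) \<in> borel_measurable cell"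
    using assms(1) borel_measurable_cell[OF assms(2)] by measurable
  have "0 \<le> B" using assms(3)[of undefined] by linarith
  then show "AE x in cell. norm (f x * g x) \<le> norm (B * f x)"
    using assms(3) by (intro AE_I2) (auto simp: abs_mult mult.commute[of B] intro!: mult_left_mono)
qed

lemma trig_poly_integral_eq_0:
  assumes "trig_poly p" "integrable cell f" "\<And>k. k \<in> Z2 \<Longrightarrow> (\<integral>x. f x * cas (2 * pi * (k \<bullet> x)) \<partial>cell) = 0"
  shows "(\<integral>x. f x * p x \<partial>cell) = 0"
  using assms(1)
proof (induction rule: trig_poly.induct)
  case (cas k c)
  have "(\<integral>x. f x * (c * cas (2 * pi * (k \<bullet> x))) \<partial>cell) = (\<integral>x. c * (f x * cas (2 * pi * (k \<bullet> x))) \<partial>cell)"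
    by (rule Bochner_Integration.integral_cong) auto
  then show ?case using assms(3)[OF cas] by simp
next
  case (add g h)
  have "integrable cell (\<lambda>x. f x * q x)" if q: "trig_poly q" for q
  proof -
    obtain B where "\<And>x. \<bar>q x\<bar> \<le> B" using trig_poly_bounded[OF q] by auto
    then show ?thesis
      by (rule integrable_mult_bounded_cell[OF assms(2) borel_measurable_continuous_onI[OF trig_poly_continuous[OF q]]])
  qed
  then show ?case using add by (simp add: distrib_left)
qed

text \<open>Wraps the plane onto the product of two unit circles. A function of this image is
  automatically periodic, and the product of circles is compact, as Stone-Weierstrass
  requires.\<close>

definition torus_map :: "real \<times> real \<Rightarrow> complex \<times> complex" where
  "torus_map x = (cis (2 * pi * fst x), cis (2 * pi * snd x))"

lemma continuous_on_torus_map: "continuous_on UNIV torus_map"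
  unfolding torus_map_def by (intro continuous_intros)

context
  fixes f :: "real \<times> real \<Rightarrow> real"
  assumes int: "integrable cell f"
    and zero: "\<And>k. k \<in> Z2 \<Longrightarrow> (\<integral>x. f x * cas (2 * pi * (k \<bullet> x)) \<partial>cell) = 0"
begin

lemma integral_torus_continuous:
  assumes F: "continuous_on UNIV F" "\<And>z. \<bar>F z\<bar> \<le> 1"
  shows "(\<integral>x. f x * F (torus_map x) \<partial>cell) = 0"
proof -
  define S :: "(complex \<times> complex) set" where "S = sphere 0 1 \<times> sphere 0 1"
  define R where "R = {G. continuous_on S G \<and> trig_poly (\<lambda>x. G (torus_map x))}"
  have [simp]: "torus_map x \<in> S" for x by (simp add: S_def torus_map_def)
  interpret function_ring_on R S
  proof
    show "compact S" unfolding S_def by (intro compact_Times compact_sphere)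
    show "(\<lambda>_. c) \<in> R" for c
      using trig_poly.cas[OF Z2_closed(4), of c] by (auto simp: R_def)
    show "\<exists>f\<in>R. f z \<noteq> f w" if "z \<in> S" "w \<in> S" "z \<noteq> w" for z w
    proof -
      have "(\<lambda>z. Re (fst z)) \<in> R" "(\<lambda>z. Im (fst z)) \<in> R" "(\<lambda>z. Re (snd z)) \<in> R" "(\<lambda>z. Im (snd z)) \<in> R"
        using trig_poly_cos[OF Z2_closed(5), of 1] trig_poly_cos[OF Z2_closed(6), of 1]
          trig_poly_sin[OF Z2_closed(5), of 1] trig_poly_sin[OF Z2_closed(6), of 1]
        by (auto simp: R_def torus_map_def inner_prod_def intro!: continuous_intros)
      then show ?thesis using that by (metis complex_eqI prod_eqI)
    qed
  qed (auto simp: R_def intro: continuous_intros trig_poly.add trig_poly_mult)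
  have mF: "(\<lambda>x. F (torus_map x)) \<in> borel_measurable borel"
    by (rule borel_measurable_continuous_onI[OF continuous_on_compose2[OF F(1) continuous_on_torus_map]]) simp
  have intF: "integrable cell (\<lambda>x. f x * F (torus_map x))"
    by (rule integrable_mult_bounded_cell[OF int mF F(2)])
  have "\<bar>\<integral>x. f x * F (torus_map x) \<partial>cell\<bar> \<le> 0"
  proof (rule field_le_epsilon)
    fix e :: real assume "e > 0"
    \<comment> \<open>The summand 1 covers the case that the integral of |f| is zero.\<close>
    define d where "d = e / ((\<integral>x. \<bar>f x\<bar> \<partial>cell) + 1)"
    have "0 \<le> (\<integral>x. \<bar>f x\<bar> \<partial>cell)"
      by (intro Bochner_Integration.integral_nonneg) auto
    then have pos: "(\<integral>x. \<bar>f x\<bar> \<partial>cell) + 1 > 0" by linarith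
    then have "d > 0" using \<open>e > 0\<close> by (simp add: d_def)
    then obtain G where G: "G \<in> R" "\<And>z. z \<in> S \<Longrightarrow> \<bar>F z - G z\<bar> < d"
      using Stone_Weierstrass_basic[OF continuous_on_subset[OF F(1)]] by blast
    have tp: "trig_poly (\<lambda>x. G (torus_map x))" using G by (simp add: R_def)
    obtain B where B: "\<And>x. \<bar>G (torus_map x)\<bar> \<le> B" using trig_poly_bounded[OF tp] by auto
    have intG: "integrable cell (\<lambda>x. f x * G (torus_map x))"
      by (rule integrable_mult_bounded_cell[OF int borel_measurable_continuous_onI[OF trig_poly_continuous[OF tp]] B])
    have "\<bar>\<integral>x. f x * F (torus_map x) \<partial>cell\<bar> = \<bar>\<integral>x. f x * F (torus_map x) - f x * G (torus_map x) \<partial>cell\<bar>"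
      using trig_poly_integral_eq_0[OF tp int zero] intF intG by simp
    also have "\<dots> \<le> (\<integral>x. \<bar>f x * F (torus_map x) - f x * G (torus_map x)\<bar> \<partial>cell)"
      by (rule integral_abs_bound)
    also have "\<dots> \<le> (\<integral>x. d * \<bar>f x\<bar> \<partial>cell)"
    proof (rule integral_mono)
      show "\<bar>f x * F (torus_map x) - f x * G (torus_map x)\<bar> \<le> d * \<bar>f x\<bar>" for x
        using G(2)[of "torus_map x"]
        by (auto simp: right_diff_distrib[symmetric] abs_mult mult.commute[of d] intro!: mult_left_mono)
    qed (use int intF intG in auto)
    also have "\<dots> \<le> e"
      using pos \<open>e > 0\<close> by (simp add: d_def field_simps)
    finally show "\<bar>\<integral>x. f x * F (torus_map x) \<partial>cell\<bar> \<le> 0 + e" by simp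
  qed
  then show ?thesis by simp
qed

text \<open>The continuous cut-offs \<open>F n\<close> decrease to the indicator of
  \<open>C\<close>, since the distance to a closed set is positive off the set; domination by |f|
  permits the limit.\<close>

lemma integral_torus_closed:
  assumes "closed C"
  shows "(\<integral>x. f x * indicator C (torus_map x) \<partial>cell) = 0"
proof (cases "C = {}")
  case False
  define F where "F n z = max 0 (1 - real n * infdist z C)" for n z
  have F0: "(\<integral>x. f x * F n (torus_map x) \<partial>cell) = 0" for n
  proof (rule integral_torus_continuous)
    show "continuous_on UNIV (F n)" unfolding F_def by (intro continuous_intros)
    show "\<bar>F n z\<bar> \<le> 1" for z
      using infdist_nonneg[of z C] by (auto simp: F_def max_def)
  qed
  have [measurable]: "torus_map \<in> borel_measurable borel" "C \<in> sets borel"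
    using assms by (auto intro: borel_measurable_continuous_onI continuous_on_torus_map)
  have mF: "F n \<in> borel_measurable borel" for n
    unfolding F_def by (intro borel_measurable_continuous_onI continuous_intros)
  have "(\<lambda>n. \<integral>x. f x * F n (torus_map x) \<partial>cell) \<longlonglongrightarrow> (\<integral>x. f x * indicator C (torus_map x) \<partial>cell)"
  proof (rule integral_dominated_convergence[where w="\<lambda>x. \<bar>f x\<bar>"])
    show "(\<lambda>x. f x * indicator C (torus_map x)) \<in> borel_measurable cell"
      by (intro borel_measurable_times borel_measurable_cell[of "\<lambda>x. indicator C (torus_map x)"])
         (use int in auto)
    show "(\<lambda>x. f x * F n (torus_map x)) \<in> borel_measurable cell" for n
      by (intro borel_measurable_times borel_measurable_cell[of "\<lambda>x. F n (torus_map x)"]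
            measurable_compose[OF _ mF]) (use int in auto)
    have "\<bar>F n z\<bar> \<le> 1" for n z
      using infdist_nonneg[of z C] by (auto simp: F_def max_def)
    then show "AE x in cell. norm (f x * F n (torus_map x)) \<le> \<bar>f x\<bar>" for n
      by (intro AE_I2) (simp add: abs_mult mult_left_le)
    have "(\<lambda>n. F n z) \<longlonglongrightarrow> indicator C z" for z
    proof (cases "z \<in> C")
      case True
      then show ?thesis by (simp add: F_def)
    next
      case nz: False
      have pos: "infdist z C > 0" by (rule infdist_pos_not_in_closed[OF assms False nz])
      obtain N where N: "1 < real N * infdist z C" using reals_Archimedean3[OF pos] by blast
      have "F n z = 0" if "n \<ge> N" for n
      proof -
        have "real N * infdist z C \<le> real n * infdist z C"
          using that pos by (intro mult_right_mono) auto
        then show ?thesis using N by (simp add: F_def)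
      qed
      then show ?thesis
        using nz by (auto intro!: tendsto_eventually eventually_sequentiallyI[of N])
    qed
    then show "AE x in cell. (\<lambda>n. f x * F n (torus_map x)) \<longlonglongrightarrow> f x * indicator C (torus_map x)"
      by (intro AE_I2 tendsto_mult_left)
  qed (use int in auto)
  then show ?thesis unfolding F0 by (simp add: LIMSEQ_const_iff)
qed simp

lemma integral_atMost_eq_0: "(\<integral>x. f x * indicator {..a} x \<partial>cell) = 0"
proof -
  \<comment> \<open>Capping at 1 keeps the arc from winding around the circle more than
    once.\<close>
  define arc where "arc b = (\<lambda>s. cis (2 * pi * s)) ` {0..min b 1}" for b
  have "closed (arc b)" for b
    unfolding arc_def by (intro compact_imp_closed compact_continuous_image continuous_intros) auto
  then have cl: "closed (arc (fst a) \<times> arc (snd a))" by (intro closed_Times) auto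
  have arc: "cis (2 * pi * s) \<in> arc b \<longleftrightarrow> s \<le> b" if s: "0 \<le> s" "s < 1" for s b
  proof
    assume "cis (2 * pi * s) \<in> arc b"
    then obtain t where t: "0 \<le> t" "t \<le> b" "t \<le> 1" "cis (2 * pi * s) = cis (2 * pi * t)"
      by (auto simp: arc_def)
    then obtain n :: int where "2 * pi * s = 2 * pi * t + 2 * pi * n"
      using sin_cos_eq_iff[of "2 * pi * s" "2 * pi * t"] by (auto simp: complex_eq_iff)
    then have "2 * pi * s = 2 * pi * (t + n)" by (simp add: distrib_left)
    then have n: "s = t + n" by simp
    \<comment> \<open>The value \<open>n = -1\<close> occurs only for \<open>s = 0\<close> and
      \<open>t = 1\<close>, where the circle closes up; then \<open>t \<le> b\<close> still gives
      \<open>s \<le> b\<close>.\<close>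
    then have "n = 0 \<or> n = -1" using s t by linarith
    then show "s \<le> b" using n t s by auto
  qed (use s in \<open>auto simp: arc_def\<close>)
  have "(\<integral>x. f x * indicator {..a} x \<partial>cell)
      = (\<integral>x. f x * indicator (arc (fst a) \<times> arc (snd a)) (torus_map x) \<partial>cell)"
  proof (rule Bochner_Integration.integral_cong)
    show "f x * indicator {..a} x = f x * indicator (arc (fst a) \<times> arc (snd a)) (torus_map x)"
      if "x \<in> space cell" for x
      using that arc[of "fst x" "fst a"] arc[of "snd x" "snd a"]
      by (auto simp: cellQ_def torus_map_def indicator_def less_eq_prod_def)
  qed simp
  then show ?thesis using integral_torus_closed[OF cl] by simp
qed

text \<open>Dynkin's argument: quadrants are stable under intersection and generate the Borel sets,
  complements are covered because the total integral vanishes (\<open>k = 0\<close>), and disjoint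
  unions by countable additivity.\<close>

lemma integral_borel_eq_0:
  assumes "A \<in> sets borel"
  shows "(LINT x:A|cell. f x) = 0"
proof -
  have A: "A \<in> sigma_sets UNIV (range (\<lambda>a::real \<times> real. {..a}))"
    using assms by (simp add: borel_eq_atMost)
  have mono: "set_integrable cell B f" if "B \<in> sets borel" for B
    unfolding set_integrable_def
    using integrable_mult_bounded_cell[OF int, of "indicator B" 1] that
    by (simp add: mult.commute indicator_def)
  have all: "(LINT x:UNIV|cell. f x) = 0"
    using zero[OF Z2_closed(4)] by (simp add: set_lebesgue_integral_def)
  have sb: "sigma_sets UNIV (range (\<lambda>a::real \<times> real. {..a})) = sets borel"
    by (simp add: borel_eq_atMost)
  have "Int_stable (range (\<lambda>a::real \<times> real. {..a}))"
  proof (rule Int_stableI, elim imageE)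
    fix A B and a b :: "real \<times> real" assume "A = {..a}" "B = {..b}"
    then have "A \<inter> B = {..inf a b}" by auto
    then show "A \<inter> B \<in> range (\<lambda>a. {..a})" by blast
  qed
  moreover have "range (\<lambda>a::real \<times> real. {..a}) \<subseteq> Pow UNIV" by simp
  ultimately show ?thesis using A
  proof (induction rule: sigma_sets_induct_disjoint)
    case (basic A)
    then show ?case
      using integral_atMost_eq_0 by (auto simp: set_lebesgue_integral_def mult.commute)
  next
    case (compl A)
    then have "A \<in> sets borel" by (simp add: sb)
    then have "(LINT x:UNIV|cell. f x) = (LINT x:A|cell. f x) + (LINT x:UNIV - A|cell. f x)"
      using set_integral_Un[of A "UNIV - A" cell f] mono[of A] mono[of "UNIV - A"] by (simp add: Un_Diff_cancel)
    then show ?case using compl all by simp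
  next
    case (union A)
    \<comment> \<open>Countable additivity asks for sets of the space \<open>cell\<close>, so the
      pieces are cut down to \<open>cellQ\<close>.\<close>
    have eq: "(LINT x:B|cell. f x) = (LINT x:B \<inter> cellQ|cell. f x)" for B
      unfolding set_lebesgue_integral_def
      by (rule Bochner_Integration.integral_cong) (auto simp: indicator_def)
    have "(LINT x:(\<Union>i. A i \<inter> cellQ)|cell. f x) = (\<Sum>i. LINT x:A i \<inter> cellQ|cell. f x)"
    proof (rule lebesgue_integral_countable_add)
      have Ab: "A i \<in> sets borel" for i using union by (auto simp: sb)
      then show "A i \<inter> cellQ \<in> sets cell" for i
        by (auto simp: cell_def sets_restrict_space)
      show "A i \<inter> cellQ \<inter> (A j \<inter> cellQ) = {}" if "i \<noteq> j" for i j
        using union(1) that by (auto simp: disjoint_family_on_def)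
      show "set_integrable cell (\<Union>i. A i \<inter> cellQ) f" using Ab by (intro mono) auto
    qed
    then show ?case
      using union(3) eq[of "\<Union>i. A i"] eq[of "A _"] by (simp add: Int_UN_distrib2)
  qed (auto simp: set_lebesgue_integral_def)
qed

text \<open>Integrating over the set where \<open>f\<close>, respectively \<open>- f\<close>, is
  nonnegative makes both parts vanish. Integrability of \<open>f\<close> suffices, which matters for
  weak derivatives: they are only assumed integrable.\<close>

theorem fourier_uniqueness: "AE x in cell. f x = 0"
proof -
  have [measurable]: "f \<in> borel_measurable cell" using int by simp
  have "AE x in cell. g x * indicator {x \<in> cellQ. 0 \<le> g x} x = 0" if g: "g = f \<or> g = (\<lambda>x. - f x)" for g
  proof -
    have gm[measurable]: "g \<in> borel_measurable cell" using g by auto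
    have "{x \<in> space cell. 0 \<le> g x} \<in> sets cell" by measurable
    then have A: "{x \<in> cellQ. 0 \<le> g x} \<in> sets borel"
      by (auto simp: cell_def sets_restrict_space)
    have i: "integrable cell (\<lambda>x. g x * indicator {x \<in> cellQ. 0 \<le> g x} x)"
      using g int
      by (intro integrable_mult_bounded_cell[where B=1] borel_measurable_indicator A) (auto simp: indicator_def)
    have "(\<integral>x. g x * indicator {x \<in> cellQ. 0 \<le> g x} x \<partial>cell) = 0"
      using integral_borel_eq_0[OF A] g by (auto simp: set_lebesgue_integral_def mult.commute)
    then show ?thesis
      using integral_nonneg_eq_0_iff_AE[OF i] by (auto simp: indicator_def)
  qed
  note * = this[of f] this[of "\<lambda>x. - f x"]
  from AE_space *(1)[OF disjI1[OF refl]] *(2)[OF disjI2[OF refl]] show ?thesis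
    by eventually_elim (auto simp: indicator_def split: if_splits)
qed

end

section \<open>Completeness and Parseval's identity\<close>

lemma coef_diff: "L2 u \<Longrightarrow> L2 v \<Longrightarrow> coef n (\<lambda>x. u x - v x) = coef n u - coef n v"
  by (simp add: coef_def L2inner_diff_left)

lemma coef_scale: "coef n (\<lambda>x. c *\<^sub>R u x) = c * coef n u"
  by (simp add: coef_def L2inner_scale_left)

lemma coef_sum: "(\<And>i. i \<in> I \<Longrightarrow> L2 (f i)) \<Longrightarrow> coef n (\<lambda>x. \<Sum>i\<in>I. f i x) = (\<Sum>i\<in>I. coef n (f i))"
  by (simp add: coef_def L2inner_sum_left)

lemma perp_eq_0:
  fixes p k :: "real \<times> real"
  assumes "p \<bullet> k = 0" "p \<bullet> (- snd k, fst k) = 0" "k \<noteq> 0"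
  shows "p = 0"
proof -
  obtain a b c d where p: "p = (a, b)" and k: "k = (c, d)" by fastforce
  have 1: "a * c + b * d = 0" "b * c - a * d = 0"
    using assms(1,2) by (auto simp: p k inner_prod_def algebra_simps)
  have "(a\<^sup>2 + b\<^sup>2) * (c\<^sup>2 + d\<^sup>2) = (a * c + b * d)\<^sup>2 + (b * c - a * d)\<^sup>2"
    by algebra
  then have "(a\<^sup>2 + b\<^sup>2) * (c\<^sup>2 + d\<^sup>2) = 0" using 1 by simp
  moreover have "c\<^sup>2 + d\<^sup>2 \<noteq> 0" using assms(3) by (auto simp: k zero_prod_def sum_power2_eq_zero_iff)
  ultimately have "a\<^sup>2 + b\<^sup>2 = 0" using mult_eq_0_iff by blast
  then show ?thesis by (simp add: p zero_prod_def sum_power2_eq_zero_iff)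
qed

text \<open>The vector of Hartley coefficients at \<open>k\<close> has no component along
  \<open>k\<close> by divergence freeness and none along the rotated \<open>k\<close> by hypothesis,
  so it is zero. At \<open>k = 0\<close> the two constant modes \<open>Some 0\<close> and
  \<open>None\<close> supply both components.\<close>

lemma Hset_coef_eq_0:
  assumes u: "u \<in> Hset" and c: "\<And>n. coef n u = 0"
  shows "AE x in cell. u x = 0"
proof -
  have L: "L2 u" using u by (rule Hset_L2)
  have Lc: "L2 (\<lambda>x. cas (2 * pi * (k \<bullet> x)) *\<^sub>R d)" for k d
    by (rule L2_bounded[where B="2 * norm d"])
       (auto intro!: borel_measurable_continuous_onI continuous_intros mult_right_mono abs_cas_le)
  define P where "P k d = (\<integral>x. (u x \<bullet> d) * cas (2 * pi * (k \<bullet> x)) \<partial>cell)" for k d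
  have int: "integrable cell (\<lambda>x. (u x \<bullet> d) * cas (2 * pi * (k \<bullet> x)))" for k d
    using integrable_inner[OF L Lc[of k d]] by (simp add: mult.commute)
  define p where "p k = (P k (1, 0), P k (0, 1))" for k
  have P: "P k d = p k \<bullet> d" for k d
  proof -
    have "P k d = (\<integral>x. fst d * ((u x \<bullet> (1, 0)) * cas (2 * pi * (k \<bullet> x)))
        + snd d * ((u x \<bullet> (0, 1)) * cas (2 * pi * (k \<bullet> x))) \<partial>cell)"
      unfolding P_def by (rule Bochner_Integration.integral_cong) (auto simp: inner_prod_def algebra_simps)
    also have "\<dots> = p k \<bullet> d"
      using int[of "(1, 0)" k] int[of "(0, 1)" k] by (simp add: p_def P_def inner_prod_def[of _ d])
    finally show ?thesis .
  qed
  have dir: "p (wave m) \<bullet> direction m = 0" for m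
  proof -
    obtain n where n: "mode n = m" using bij_mode by (metis bij_pointE)
    have "P (wave m) (direction m) = coef n u"
      unfolding coef_def L2inner_cell P_def by (simp add: ee_def n mult.commute)
    then show ?thesis using c P by simp
  qed
  have div: "p k \<bullet> k = 0" if "k \<in> Z2" for k
  proof -
    \<comment> \<open>The test function is the reflected wave, whose gradient is a multiple of
      \<open>cas (2 * pi * (k \<bullet> x))\<close> in direction \<open>k\<close>.\<close>
    have "(\<integral>x. u x \<bullet> ((- 2 * pi * cas (2 * pi * (k \<bullet> x))) *\<^sub>R k) \<partial>cell) = 0"
      using u C1per_trig(2)[OF that] unfolding Hset_iff div_free_def set_integral_cell by blast
    moreover have "(\<integral>x. u x \<bullet> ((- 2 * pi * cas (2 * pi * (k \<bullet> x))) *\<^sub>R k) \<partial>cell) = - 2 * pi * P k k"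
      unfolding P_def integral_mult_right_zero[symmetric]
      by (rule Bochner_Integration.integral_cong) auto
    ultimately show ?thesis using P by simp
  qed
  have p0: "p k = 0" if k: "k \<in> Z2" for k
  proof -
    obtain a b where ab: "k = (real_of_int a, real_of_int b)"
      using k by (auto simp: Z2_def elim!: Ints_cases)
    show ?thesis
    proof (cases "k = 0")
      case True
      have "p 0 \<bullet> (0, 1) = 0" using dir[of None] by simp
      moreover have "p 0 \<bullet> (1, 0) = 0" using dir[of "Some 0"] by (simp add: zero_prod_def)
      ultimately have "p 0 = 0" by (simp add: prod_eq_iff inner_prod_def)
      then show ?thesis using True by simp
    next
      case False
      then have "(a, b) \<noteq> 0" using ab by (auto simp: zero_prod_def)
      then have "p k \<bullet> (- snd k, fst k) = 0"
        using dir[of "Some (a, b)"] False by (simp add: ab[symmetric] del: scaleR_Pair)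
      then show ?thesis using perp_eq_0[OF div[OF k]] False by blast
    qed
  qed
  have "AE x in cell. u x \<bullet> d = 0" for d
  proof (rule fourier_uniqueness)
    show "integrable cell (\<lambda>x. u x \<bullet> d)"
      using int[of d 0] by simp
    show "(\<integral>x. (u x \<bullet> d) * cas (2 * pi * (k \<bullet> x)) \<partial>cell) = 0" if "k \<in> Z2" for k
      using P[of k d] p0[OF that] by (simp add: P_def)
  qed
  from this[of "(1, 0)"] this[of "(0, 1)"] show ?thesis
    by eventually_elim (simp add: inner_prod_def prod_eq_iff)
qed

lemma psum_diff: "(\<lambda>x. psum N a x - psum N b x) = psum N (\<lambda>i. a i - b i)"
  by (simp add: psum_def sum_subtractf scaleR_diff_left)

lemma psum_tail:
  assumes "N \<le> M"
  shows "(\<lambda>x. psum M a x - psum N a x) = psum M (\<lambda>i. if i < N then 0 else a i)"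
proof
  fix x
  have "psum N a x = (\<Sum>i<M. (if i < N then a i else 0) *\<^sub>R ee i x)"
    unfolding psum_def using assms by (intro sum.mono_neutral_cong_left) auto
  then show "psum M a x - psum N a x = psum M (\<lambda>i. if i < N then 0 else a i) x"
    by (simp add: psum_def sum_subtractf[symmetric] scaleR_diff_left[symmetric] if_distrib cong: if_cong)
       (rule sum.cong, auto)
qed

lemma L2norm_psum_diff_le:
  assumes "summable (\<lambda>n. (a n)\<^sup>2)" "N \<le> M"
  shows "(L2norm (\<lambda>x. psum M a x - psum N a x))\<^sup>2 \<le> (\<Sum>n. (a n)\<^sup>2) - (\<Sum>n<N. (a n)\<^sup>2)"
proof -
  have "(\<Sum>i<M. (if i < N then 0 else a i)\<^sup>2) + (\<Sum>i<N. (a i)\<^sup>2) = (\<Sum>i<M. (a i)\<^sup>2)"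
  proof -
    have "(\<Sum>i<N. (a i)\<^sup>2) = (\<Sum>i<M. if i < N then (a i)\<^sup>2 else 0)"
      using assms(2) by (intro sum.mono_neutral_cong_left) auto
    then show ?thesis by (simp add: sum.distrib[symmetric]) (rule sum.cong, auto)
  qed
  moreover have "(\<Sum>i<M. (a i)\<^sup>2) \<le> (\<Sum>n. (a n)\<^sup>2)"
    by (rule sum_le_suminf[OF assms(1)]) auto
  ultimately show ?thesis
    unfolding psum_tail[OF assms(2)] L2norm_psum by linarith
qed

text \<open>Along a subsequence with tails below 4^(-k) the increments are summable in
  \<open>L^1\<close>, so the partial sums converge almost everywhere; Fatou's lemma then carries the
  tail estimate over to the limit.\<close>

lemma Riesz_Fischer:
  assumes a: "summable (\<lambda>n. (a n)\<^sup>2)"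
  obtains u where "u \<in> Hset" "(\<lambda>N. L2norm (\<lambda>x. psum N a x - u x)) \<longlonglongrightarrow> 0"
proof -
  define tail where "tail N = (\<Sum>n. (a n)\<^sup>2) - (\<Sum>n<N. (a n)\<^sup>2)" for N
  have tail0: "tail \<longlonglongrightarrow> 0"
    unfolding tail_def using summable_LIMSEQ[OF a]
    by (auto intro!: tendsto_eq_intros)
  have tail_nonneg: "0 \<le> tail N" for N
    unfolding tail_def using sum_le_suminf[OF a, of "{..<N}"] by simp
  have "\<exists>n. \<forall>m\<ge>n. tail m < (1/4) ^ k" for k
    using order_tendstoD(2)[OF tail0, of "(1/4) ^ k"] by (simp add: eventually_sequentially)
  then obtain r0 where r0: "\<And>k m. r0 k \<le> m \<Longrightarrow> tail m < (1/4) ^ k" by metis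
  \<comment> \<open>Summing the thresholds makes \<open>r\<close> nondecreasing, and the summand
    \<open>k\<close> sends it to infinity.\<close>
  define r where "r k = k + (\<Sum>j\<le>k. r0 j)" for k
  have r_Suc: "r k \<le> r (Suc k)" and r_ge: "r0 k \<le> r k" and r_k: "k \<le> r k" for k
    by (auto simp: r_def intro: trans_le_add2 member_le_sum)
  define D where "D k x = psum (r (Suc k)) a x - psum (r k) a x" for k x
  have DL: "L2 (D k)" for k unfolding D_def by (intro L2_diff psum_L2)
  have pow: "((1/2) ^ k)\<^sup>2 = ((1/4) ^ k :: real)" for k :: nat
  proof -
    have "((1/2) ^ k)\<^sup>2 = (((1/2)\<^sup>2) ^ k :: real)" by (simp only: power_mult[symmetric] mult.commute)
    then show ?thesis by (simp add: power2_eq_square)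
  qed
  have "(L2norm (D k))\<^sup>2 \<le> ((1/2) ^ k)\<^sup>2" for k
    unfolding pow using L2norm_psum_diff_le[OF a r_Suc, of k] r0[OF r_ge, of k]
    by (simp add: D_def[abs_def] tail_def)
  then have Dn: "L2norm (D k) \<le> (1/2) ^ k" for k
    by (rule power2_le_imp_le) simp
  \<comment> \<open>Cauchy-Schwarz against a constant unit field turns the \<open>L^2\<close> bound
    on \<open>D k\<close> into an \<open>L^1\<close> bound.\<close>
  have c1: "L2 (\<lambda>x. (1, 0))" "L2norm (\<lambda>x. (1, 0)) = 1"
    using cell.prob_space by (auto intro!: L2_bounded[where B=1] simp: L2norm_cell)
  have Di: "integrable cell (\<lambda>x. norm (D k x))" "(\<integral>x. norm (D k x) \<partial>cell) \<le> (1/2) ^ k" for k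
    using integrable_norm_mult[OF DL c1(1), of k] integral_norm_mult_le[OF DL c1(1), of k] Dn[of k]
    by (auto simp: c1(2))
  have [measurable]: "D k \<in> borel_measurable cell" for k
    using DL[of k] L2_measurable borel_measurable_cell by blast
  have "AE x in cell. summable (\<lambda>k. norm (D k x))"
  proof -
    have "(\<integral>\<^sup>+x. (\<Sum>k. ennreal (norm (D k x))) \<partial>cell) = (\<Sum>k. \<integral>\<^sup>+x. ennreal (norm (D k x)) \<partial>cell)"
      by (rule nn_integral_suminf) simp
    also have "\<dots> = (\<Sum>k. ennreal (\<integral>x. norm (D k x) \<partial>cell))"
      using Di(1) by (intro suminf_cong nn_integral_eq_integral) auto
    also have "\<dots> \<le> (\<Sum>k. ennreal ((1/2) ^ k))"
      using Di(2) by (intro suminf_le ennreal_leI) auto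
    also have "\<dots> = ennreal (\<Sum>k. (1/2) ^ k)"
      by (rule suminf_ennreal2) (auto intro: summable_geometric)
    finally have "(\<integral>\<^sup>+x. (\<Sum>k. ennreal (norm (D k x))) \<partial>cell) \<noteq> \<infinity>"
      by (metis ennreal_less_top infinity_ennreal_def leD)
    then have "AE x in cell. (\<Sum>k. ennreal (norm (D k x))) \<noteq> \<infinity>"
      by (intro nn_integral_PInf_AE) auto
    then show ?thesis
      by eventually_elim (auto intro: summable_suminf_not_top)
  qed
  then have conv: "AE x in cell. convergent (\<lambda>k. psum (r k) a x)"
  proof eventually_elim
    case (elim x)
    then have "summable (\<lambda>k. D k x)" by (rule summable_norm_cancel)
    then have "convergent (\<lambda>n. (\<Sum>k<n. D k x) + psum (r 0) a x)"
      unfolding summable_iff_convergent by (intro convergent_add convergent_const)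
    then show ?case
      using sum_lessThan_telescope[of "\<lambda>k. psum (r k) a x"] by (simp add: D_def)
  qed
  \<comment> \<open>Where the sequence diverges, \<open>lim\<close> has an unspecified value;
    measurability survives, and only almost every point matters.\<close>
  define u where "u x = lim (\<lambda>k. psum (r k) a x)" for x
  have pm [measurable]: "psum N a \<in> borel_measurable borel" for N
    using psum_L2 L2_measurable by blast
  have um [measurable]: "u \<in> borel_measurable borel"
    unfolding u_def by (rule borel_measurable_lim_metric) simp
  have fatou: "(\<integral>\<^sup>+x. ennreal ((norm (u x - psum N a x))\<^sup>2) \<partial>cell) \<le> ennreal (tail N)" for N
  proof -
    have "(\<integral>\<^sup>+x. ennreal ((norm (u x - psum N a x))\<^sup>2) \<partial>cell)
        = (\<integral>\<^sup>+x. liminf (\<lambda>k. ennreal ((norm (psum (r k) a x - psum N a x))\<^sup>2)) \<partial>cell)"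
    proof (rule nn_integral_cong_AE)
      show "AE x in cell. ennreal ((norm (u x - psum N a x))\<^sup>2)
          = liminf (\<lambda>k. ennreal ((norm (psum (r k) a x - psum N a x))\<^sup>2))"
        using conv
      proof eventually_elim
        case (elim x)
        then have "(\<lambda>k. psum (r k) a x) \<longlonglongrightarrow> u x"
          by (simp add: u_def convergent_LIMSEQ_iff)
        then have "(\<lambda>k. ennreal ((norm (psum (r k) a x - psum N a x))\<^sup>2)) \<longlonglongrightarrow> ennreal ((norm (u x - psum N a x))\<^sup>2)"
          by (intro tendsto_ennrealI tendsto_intros)
        then show ?case by (intro lim_imp_Liminf[symmetric]) simp_all
      qed
    qed
    also have "\<dots> \<le> liminf (\<lambda>k. \<integral>\<^sup>+x. ennreal ((norm (psum (r k) a x - psum N a x))\<^sup>2) \<partial>cell)"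
      by (intro nn_integral_liminf borel_measurable_cell) measurable
    also have "\<dots> \<le> ennreal (tail N)"
    proof -
      have "\<forall>\<^sub>F k in sequentially. (\<integral>\<^sup>+x. ennreal ((norm (psum (r k) a x - psum N a x))\<^sup>2) \<partial>cell) \<le> ennreal (tail N)"
        using eventually_ge_at_top[of N]
      proof eventually_elim
        case (elim k)
        then have Nk: "N \<le> r k" using r_k[of k] by linarith
        have "L2 (\<lambda>x. psum (r k) a x - psum N a x)" by (intro L2_diff psum_L2)
        then have "(\<integral>\<^sup>+x. ennreal ((norm (psum (r k) a x - psum N a x))\<^sup>2) \<partial>cell)
            = ennreal ((L2norm (\<lambda>x. psum (r k) a x - psum N a x))\<^sup>2)"
          unfolding L2norm_power2 by (intro nn_integral_eq_integral) (auto simp: L2_def)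
        also have "\<dots> \<le> ennreal (tail N)"
          unfolding tail_def by (intro ennreal_leI L2norm_psum_diff_le a Nk)
        finally show ?case .
      qed
      then show ?thesis by (intro Liminf_le) simp
    qed
    finally show ?thesis .
  qed
  have uL': "L2 (\<lambda>x. u x - psum N a x)" for N
    unfolding L2_def
  proof
    show "(\<lambda>x. u x - psum N a x) \<in> borel_measurable borel" by measurable
    have "(\<integral>\<^sup>+x. ennreal (norm ((norm (u x - psum N a x))\<^sup>2)) \<partial>cell) < \<infinity>"
      using le_less_trans[OF fatou[of N] ennreal_less_top] by simp
    then show "integrable cell (\<lambda>x. (norm (u x - psum N a x))\<^sup>2)"
      by (intro integrableI_bounded borel_measurable_cell) measurable
  qed
  have uL: "L2 u" using L2_add[OF uL'[of 0] psum_L2[of 0 a]] by simp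
  have nb: "(L2norm (\<lambda>x. psum N a x - u x))\<^sup>2 \<le> tail N" for N
  proof -
    have "ennreal ((L2norm (\<lambda>x. u x - psum N a x))\<^sup>2) = (\<integral>\<^sup>+x. ennreal ((norm (u x - psum N a x))\<^sup>2) \<partial>cell)"
      unfolding L2norm_power2 by (intro nn_integral_eq_integral[symmetric]) (use uL' in \<open>auto simp: L2_def\<close>)
    then have "ennreal ((L2norm (\<lambda>x. u x - psum N a x))\<^sup>2) \<le> ennreal (tail N)"
      using fatou[of N] by simp
    then show ?thesis using tail_nonneg by (subst L2norm_minus_commute) simp
  qed
  have lim: "(\<lambda>N. L2norm (\<lambda>x. psum N a x - u x)) \<longlonglongrightarrow> 0"
  proof -
    have "(\<lambda>N. (L2norm (\<lambda>x. psum N a x - u x))\<^sup>2) \<longlonglongrightarrow> 0"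
      by (rule tendsto_sandwich[OF _ _ tendsto_const tail0]) (auto simp: nb)
    then have "(\<lambda>N. sqrt ((L2norm (\<lambda>x. psum N a x - u x))\<^sup>2)) \<longlonglongrightarrow> sqrt 0"
      by (intro tendsto_real_sqrt)
    then show ?thesis by simp
  qed
  moreover have "u \<in> Hset"
    by (rule Hset_L2_closed[OF psum_Hset uL lim])
  ultimately show ?thesis using that by blast
qed

lemma coef_limit:
  assumes "L2 u" "(\<lambda>N. L2norm (\<lambda>x. psum N a x - u x)) \<longlonglongrightarrow> 0"
  shows "coef n u = a n"
proof -
  have "(\<lambda>N. coef n (psum N a)) \<longlonglongrightarrow> coef n u"
    unfolding coef_def by (intro L2inner_tendsto assms psum_L2 ee_L2)
  moreover have "(\<lambda>N. coef n (psum N a)) \<longlonglongrightarrow> a n"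
    by (intro tendsto_eventually eventually_sequentiallyI[of "Suc n"]) (simp add: coef_psum)
  ultimately show ?thesis by (rule LIMSEQ_unique)
qed

lemma summable_coef: "L2 u \<Longrightarrow> summable (\<lambda>n. (coef n u)\<^sup>2)"
  by (rule summableI_nonneg_bounded[where x="(L2norm u)\<^sup>2"]) (auto intro: Bessel)

lemma Hset_eqI:
  assumes "u \<in> Hset" "v \<in> Hset" "\<And>n. coef n u = coef n v"
  shows "AE x in cell. u x = v x"
  using Hset_coef_eq_0[OF Hset_diff[OF assms(1,2)]] assms by (simp add: coef_diff Hset_L2)

text \<open>The limit supplied by Riesz-Fischer has the same coefficients as \<open>u\<close>, and
  coefficients determine a field of H almost everywhere.\<close>

lemma psum_coef_tendsto:
  assumes u: "u \<in> Hset"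
  shows "(\<lambda>N. L2norm (\<lambda>x. psum N (\<lambda>n. coef n u) x - u x)) \<longlonglongrightarrow> 0"
proof -
  obtain w where w: "w \<in> Hset" "(\<lambda>N. L2norm (\<lambda>x. psum N (\<lambda>n. coef n u) x - w x)) \<longlonglongrightarrow> 0"
    using Riesz_Fischer[OF summable_coef[OF Hset_L2[OF u]]] by blast
  have "AE x in cell. w x = u x"
    using coef_limit[OF Hset_L2[OF w(1)] w(2)] by (intro Hset_eqI w u) simp
  then have "L2norm (\<lambda>x. psum N (\<lambda>n. coef n u) x - w x) = L2norm (\<lambda>x. psum N (\<lambda>n. coef n u) x - u x)" for N
    by (intro L2norm_cong_AE L2_diff psum_L2 Hset_L2 w u) auto
  then show ?thesis using w(2) by simp
qed

lemma Parseval: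
  assumes u: "u \<in> Hset" and v: "L2 v"
  shows "(\<lambda>n. coef n u * coef n v) sums L2inner u v"
proof -
  have "(\<lambda>N. L2inner (psum N (\<lambda>n. coef n u)) v) \<longlonglongrightarrow> L2inner u v"
    by (intro L2inner_tendsto psum_L2 Hset_L2 psum_coef_tendsto u v)
  then show ?thesis
    by (simp add: sums_def L2inner_commute[of _ v] L2inner_psum v)
qed

lemma Parseval_norm: "u \<in> Hset \<Longrightarrow> (\<lambda>n. (coef n u)\<^sup>2) sums (L2norm u)\<^sup>2"
  using Parseval[of u u] by (simp add: Hset_L2 L2inner_self power2_eq_square)

text \<open>Picks one representative, since coefficients fix a field only up to null sets; the value
  is unspecified when \<open>a\<close> is not square summable.\<close>

definition synth :: "(nat \<Rightarrow> real) \<Rightarrow> vf" where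
  "synth a = (SOME u. u \<in> Hset \<and> (\<forall>n. coef n u = a n))"

lemma synth:
  assumes "summable (\<lambda>n. (a n)\<^sup>2)"
  shows "synth a \<in> Hset" "coef n (synth a) = a n"
proof -
  obtain w where "w \<in> Hset" "(\<lambda>N. L2norm (\<lambda>x. psum N a x - w x)) \<longlonglongrightarrow> 0"
    using Riesz_Fischer[OF assms] by blast
  then have "w \<in> Hset \<and> (\<forall>n. coef n w = a n)" using coef_limit Hset_L2 by blast
  then have "synth a \<in> Hset \<and> (\<forall>n. coef n (synth a) = a n)"
    unfolding synth_def by (rule someI[where P="\<lambda>u. u \<in> Hset \<and> (\<forall>n. coef n u = a n)"])
  then show "synth a \<in> Hset" "coef n (synth a) = a n" by auto
qed

section \<open>The Borel sigma algebra of the Hilbert space\<close>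

text \<open>Sequences suffice because \<open>L2open\<close> is defined by balls. Constant sequences
  show that such an \<open>F\<close> cannot distinguish fields at distance zero.\<close>

definition L2cont :: "(vf \<Rightarrow> real) \<Rightarrow> bool" where
  "L2cont F \<longleftrightarrow> (\<forall>u v. u \<in> Hset \<longrightarrow> (\<forall>n::nat. v n \<in> Hset) \<longrightarrow>
     (\<lambda>n. L2norm (\<lambda>x. v n x - u x)) \<longlonglongrightarrow> 0 \<longrightarrow> (\<lambda>n. F (v n)) \<longlonglongrightarrow> F u)"

lemma L2cont_measurable:
  assumes F: "L2cont F" and M: "space M = Hset" "sets M = HBorel"
  shows "F \<in> borel_measurable M"
proof (rule borel_measurableI)
  fix S :: "real set" assume S: "open S"
  have "L2open (F -` S \<inter> Hset)"
    unfolding L2open_def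
  proof (intro conjI ballI)
    fix u assume u: "u \<in> F -` S \<inter> Hset"
    show "\<exists>e>0. \<forall>v\<in>Hset. L2norm (v - u) < e \<longrightarrow> v \<in> F -` S \<inter> Hset"
    proof (rule ccontr)
      assume "\<not> ?thesis"
      then have "\<forall>n. \<exists>v. v \<in> Hset \<and> L2norm (v - u) < 1 / real (Suc n) \<and> F v \<notin> S"
        by (metis IntI divide_pos_pos of_nat_0_less_iff vimageI zero_less_Suc zero_less_one)
      then obtain v where v: "\<And>n. v n \<in> Hset" "\<And>n. L2norm (v n - u) < 1 / real (Suc n)" "\<And>n. F (v n) \<notin> S"
        by metis
      have "(\<lambda>n. L2norm (\<lambda>x. v n x - u x)) \<longlonglongrightarrow> 0"
        by (rule tendsto_sandwich[OF _ _ tendsto_const LIMSEQ_inverse_real_of_nat])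
           (use v(2) in \<open>auto simp: fun_diff_def inverse_eq_divide intro!: always_eventually less_imp_le\<close>)
      then have "(\<lambda>n. F (v n)) \<longlonglongrightarrow> F u"
        using F u v(1) unfolding L2cont_def by blast
      then have "\<forall>\<^sub>F n in sequentially. F (v n) \<in> S"
        using topological_tendstoD[OF _ S] u by blast
      then show False using v(3) by simp
    qed
  qed simp
  then show "F -` S \<inter> space M \<in> sets M"
    using M unfolding HBorel_def by auto
qed

lemma L2cont_L2inner: "L2 g \<Longrightarrow> L2cont (\<lambda>u. L2inner u g)"
  unfolding L2cont_def by (blast intro: L2inner_tendsto Hset_L2)

lemma L2cont_L2norm: "L2cont L2norm"
  unfolding L2cont_def by (blast intro: L2norm_tendsto Hset_L2)

lemma L2cont_coef: "L2cont (coef n)"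
  using L2cont_L2inner[OF ee_L2] by (simp add: coef_def[abs_def])

text \<open>Separability of H in the form used below: finite rational lists and rational radii index
  countably many balls, and those inside an open set exhaust it.\<close>

lemma L2open_rational_ball:
  assumes U: "L2open U" and u: "u \<in> U"
  shows "\<exists>(l :: rat list) (q :: rat).
     L2norm (\<lambda>x. u x - psum (length l) (\<lambda>i. of_rat (l ! i)) x) < of_rat q \<and>
     (\<forall>v\<in>Hset. L2norm (\<lambda>x. v x - psum (length l) (\<lambda>i. of_rat (l ! i)) x) < of_rat q \<longrightarrow> v \<in> U)"
proof -
  have uH: "u \<in> Hset" using U u by (auto simp: L2open_def)
  obtain e where e: "e > 0" "\<And>v. v \<in> Hset \<Longrightarrow> L2norm (\<lambda>x. v x - u x) < e \<Longrightarrow> v \<in> U"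
    using U u unfolding L2open_def by (auto simp: fun_diff_def)
  obtain N where N: "L2norm (\<lambda>x. psum N (\<lambda>n. coef n u) x - u x) < e / 4"
    using order_tendstoD(2)[OF psum_coef_tendsto[OF uH], of "e / 4"] e(1)
    by (auto simp: eventually_sequentially)
  \<comment> \<open>With this \<open>\<delta>\<close> the rational centre lies within e/4 + e/8 =
    3e/8 of \<open>u\<close>; a radius between 3e/8 and e/2 then catches \<open>u\<close> and keeps
    the ball within distance 7e/8 of it.\<close>
  define \<delta> where "\<delta> = e / (8 * (real N + 1))"
  have "\<delta> > 0" using e(1) by (simp add: \<delta>_def)
  then have "\<exists>b::rat. \<bar>coef n u - of_rat b\<bar> < \<delta>" for n
    using of_rat_dense[of "coef n u - \<delta>" "coef n u + \<delta>"] by (auto simp: abs_less_iff) (smt (verit))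
  then obtain b :: "nat \<Rightarrow> rat" where b: "\<And>n. \<bar>coef n u - of_rat (b n)\<bar> < \<delta>" by metis
  define l where "l = map b [0..<N]"
  have l: "psum (length l) (\<lambda>i. of_rat (l ! i)) = psum N (\<lambda>i. of_rat (b i))"
    by (auto simp: l_def psum_def)
  let ?d = "psum N (\<lambda>i. of_rat (b i))"
  have "(L2norm (\<lambda>x. psum N (\<lambda>n. coef n u) x - ?d x))\<^sup>2 \<le> (\<Sum>i<N. \<delta>\<^sup>2)"
    unfolding psum_diff L2norm_psum
    using b \<open>\<delta> > 0\<close> by (intro sum_mono) (simp add: abs_le_square_iff[symmetric] less_imp_le)
  also have "\<dots> \<le> ((real N + 1) * \<delta>)\<^sup>2"
  proof -
    have "real N \<le> (real N + 1)\<^sup>2" by (simp add: power2_eq_square algebra_simps)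
    then show ?thesis by (simp add: power_mult_distrib mult_right_mono)
  qed
  finally have "L2norm (\<lambda>x. psum N (\<lambda>n. coef n u) x - ?d x) \<le> (real N + 1) * \<delta>"
    by (rule power2_le_imp_le) (use \<open>\<delta> > 0\<close> in simp)
  also have "\<dots> = e / 8" by (simp add: \<delta>_def field_simps)
  finally have du: "L2norm (\<lambda>x. u x - ?d x) < 3 * e / 8"
    using N L2norm_triangle_diff[of u "psum N (\<lambda>n. coef n u)" ?d] uH
    by (simp add: Hset_L2 L2norm_minus_commute[of u])
  obtain q :: rat where q: "3 * e / 8 < of_rat q" "of_rat q < e / 2"
    using of_rat_dense[of "3 * e / 8" "e / 2"] e(1) by auto
  have "v \<in> U" if v: "v \<in> Hset" "L2norm (\<lambda>x. v x - ?d x) < of_rat q" for v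
  proof (rule e(2)[OF v(1)])
    show "L2norm (\<lambda>x. v x - u x) < e"
      using L2norm_triangle_diff[of v ?d u] v q du uH
      by (simp add: Hset_L2 L2norm_minus_commute[of ?d])
  qed
  then show ?thesis
    using du q by (intro exI[of _ l] exI[of _ q]) (auto simp: l)
qed

text \<open>By Parseval the distance to a fixed centre is a series in the coefficients, hence
  measurable, and an open set is a countable union of balls. Measurability of random fields thus
  becomes a statement about scalars.\<close>

lemma measurable_into_Hset:
  assumes M: "space M = Hset" "sets M = HBorel"
    and f: "\<And>w. w \<in> space N \<Longrightarrow> f w \<in> Hset" "\<And>n. (\<lambda>w. coef n (f w)) \<in> borel_measurable N"
  shows "f \<in> measurable N M"
proof (rule measurable_sigma_sets)
  show "sets M = sigma_sets Hset {U. L2open U}" using M by (simp add: HBorel_def)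
  show "{U. L2open U} \<subseteq> Pow Hset" by (auto simp: L2open_def)
  show "f \<in> space N \<rightarrow> Hset" using f by auto
  fix U assume "U \<in> {U. L2open U}"
  then have U: "L2open U" by simp
  define d :: "rat list \<Rightarrow> vf" where "d l = psum (length l) (\<lambda>i. of_rat (l ! i))" for l
  have dH: "d l \<in> Hset" for l by (simp add: d_def)
  define I where "I = {(l, q :: rat). \<forall>v\<in>Hset. L2norm (\<lambda>x. v x - d l x) < of_rat q \<longrightarrow> v \<in> U}"
  have meas: "(\<lambda>w. L2norm (\<lambda>x. f w x - d l x)) \<in> borel_measurable N" for l
  proof -
    have "L2norm (\<lambda>x. f w x - d l x) = sqrt (\<Sum>n. (coef n (f w) - coef n (d l))\<^sup>2)" if "w \<in> space N" for w
    proof -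
      have "(L2norm (\<lambda>x. f w x - d l x))\<^sup>2 = (\<Sum>n. (coef n (\<lambda>x. f w x - d l x))\<^sup>2)"
        by (rule sums_unique[OF Parseval_norm[OF Hset_diff[OF f(1)[OF that] dH]]])
      then have "(L2norm (\<lambda>x. f w x - d l x))\<^sup>2 = (\<Sum>n. (coef n (f w) - coef n (d l))\<^sup>2)"
        using f(1)[OF that] dH by (simp add: coef_diff Hset_L2)
      then show ?thesis by (intro real_sqrt_unique[symmetric]) simp_all
    qed
    moreover have "(\<lambda>w. sqrt (\<Sum>n. (coef n (f w) - coef n (d l))\<^sup>2)) \<in> borel_measurable N"
      using f(2) by measurable
    ultimately show ?thesis by (simp cong: measurable_cong)
  qed
  have "f -` U \<inter> space N = (\<Union>(l, q)\<in>I. {w \<in> space N. L2norm (\<lambda>x. f w x - d l x) < of_rat q})"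
    using L2open_rational_ball[OF U] f(1) by (fastforce simp: I_def d_def)
  also have "\<dots> \<in> sets N"
    using meas by (intro sets.countable_UN'') (auto intro: countableI_type)
  finally show "f -` U \<inter> space N \<in> sets N" .
qed

section \<open>The trilinear form\<close>

lemma integrable_continuous_cell:
  fixes f :: "real \<times> real \<Rightarrow> real"
  assumes "continuous_on UNIV f"
  shows "integrable cell f"
proof -
  have "compact (f ` ({0..1} \<times> {0..1}))"
    by (intro compact_continuous_image compact_Times continuous_on_subset[OF assms]) auto
  then obtain B where B: "\<And>x. x \<in> {0..1} \<times> {0..1} \<Longrightarrow> \<bar>f x\<bar> \<le> B"
    using compact_imp_bounded bounded_iff by (metis imageI real_norm_def)
  show ?thesis
    by (rule cell.integrable_const_bound[where B=B])
       (use B assms in \<open>auto simp: cellQ_def intro!: AE_I2 borel_measurable_cell borel_measurable_continuous_onI\<close>)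
qed

text \<open>Eigenvalue of the negative Laplacian on \<open>ee n\<close>; sums of
  \<open>lam k * (a k)\<^sup>2\<close> measure enstrophy.\<close>

definition lam :: "nat \<Rightarrow> real" where
  "lam n = 4 * pi\<^sup>2 * (norm (kk n))\<^sup>2"

text \<open>Pointwise bound for the gradient of \<open>ee n\<close>: the factor
  \<open>2 * pi * norm (kk n)\<close> times the bound 2 for |cas|.\<close>

definition kappa :: "nat \<Rightarrow> real" where
  "kappa n = 4 * pi * norm (kk n)"

lemma lam_nonneg [simp]: "0 \<le> lam n"
  by (simp add: lam_def)

lemma kappa_nonneg [simp]: "0 \<le> kappa n"
  by (simp add: kappa_def)

text \<open>\<open>bb n u\<close> is \<open>(\<nabla>e\<^sub>n, u \<otimes> u)\<close>.\<close>

definition bb :: "nat \<Rightarrow> vf \<Rightarrow> real" where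
  "bb n u = (\<integral>x. 2 * pi * cas (- (2 * pi * (kk n \<bullet> x))) * ((kk n \<bullet> u x) * (dd n \<bullet> u x)) \<partial>cell)"

lemma bb_integrand_le:
  "\<bar>2 * pi * cas t * ((kk n \<bullet> p) * (dd n \<bullet> q))\<bar> \<le> kappa n * (norm p * norm q)"
proof -
  have "\<bar>cas t\<bar> * (\<bar>kk n \<bullet> p\<bar> * \<bar>dd n \<bullet> q\<bar>) \<le> 2 * ((norm (kk n) * norm p) * (1 * norm q))"
    using Cauchy_Schwarz_ineq2[of "dd n" q]
    by (intro mult_mono abs_cas_le Cauchy_Schwarz_ineq2) auto
  then have "2 * pi * (\<bar>cas t\<bar> * (\<bar>kk n \<bullet> p\<bar> * \<bar>dd n \<bullet> q\<bar>)) \<le> 2 * pi * (2 * ((norm (kk n) * norm p) * (1 * norm q)))"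
    by (intro mult_left_mono) auto
  then show ?thesis by (simp add: abs_mult kappa_def algebra_simps)
qed

lemma borel_measurable_cas [measurable]: "cas \<in> borel_measurable borel"
  by (intro borel_measurable_continuous_onI continuous_intros)

lemma bb_bilinear_integrable:
  assumes "L2 u" "L2 v"
  shows "integrable cell (\<lambda>x. 2 * pi * cas (- (2 * pi * (kk n \<bullet> x))) * ((kk n \<bullet> u x) * (dd n \<bullet> v x)))"
proof (rule Bochner_Integration.integrable_bound)
  show "integrable cell (\<lambda>x. kappa n * (norm (u x) * norm (v x)))"
    using integrable_norm_mult[OF assms] by simp
  have [measurable]: "u \<in> borel_measurable borel" "v \<in> borel_measurable borel"
    using assms L2_measurable by auto
  show "(\<lambda>x. 2 * pi * cas (- (2 * pi * (kk n \<bullet> x))) * ((kk n \<bullet> u x) * (dd n \<bullet> v x))) \<in> borel_measurable cell"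
    by (intro borel_measurable_cell) measurable
  show "AE x in cell. norm (2 * pi * cas (- (2 * pi * (kk n \<bullet> x))) * ((kk n \<bullet> u x) * (dd n \<bullet> v x)))
      \<le> norm (kappa n * (norm (u x) * norm (v x)))"
    by (rule AE_I2, unfold real_norm_def, rule order_trans[OF bb_integrand_le]) simp
qed

lemma bb_bilinear_le:
  assumes "L2 u" "L2 v"
  shows "\<bar>\<integral>x. 2 * pi * cas (- (2 * pi * (kk n \<bullet> x))) * ((kk n \<bullet> u x) * (dd n \<bullet> v x)) \<partial>cell\<bar>
    \<le> kappa n * (L2norm u * L2norm v)"
proof -
  have "\<bar>\<integral>x. 2 * pi * cas (- (2 * pi * (kk n \<bullet> x))) * ((kk n \<bullet> u x) * (dd n \<bullet> v x)) \<partial>cell\<bar>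
      \<le> (\<integral>x. \<bar>2 * pi * cas (- (2 * pi * (kk n \<bullet> x))) * ((kk n \<bullet> u x) * (dd n \<bullet> v x))\<bar> \<partial>cell)"
    by (rule integral_abs_bound)
  also have "\<dots> \<le> (\<integral>x. kappa n * (norm (u x) * norm (v x)) \<partial>cell)"
    by (intro integral_mono integrable_abs integrable_mult_right bb_bilinear_integrable
        integrable_norm_mult assms bb_integrand_le)
  also have "\<dots> \<le> kappa n * (L2norm u * L2norm v)"
    using integral_norm_mult_le[OF assms] by (simp add: mult_left_mono)
  finally show ?thesis .
qed

lemma abs_bb_le: "L2 u \<Longrightarrow> \<bar>bb n u\<bar> \<le> kappa n * (L2norm u)\<^sup>2"
  unfolding bb_def power2_eq_square by (rule bb_bilinear_le)

text \<open>The underlying form is bilinear, so the difference splits into two terms, each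
  containing u - v once.\<close>

lemma bb_diff_le:
  assumes "L2 u" "L2 v"
  shows "\<bar>bb n u - bb n v\<bar> \<le> kappa n * (L2norm (\<lambda>x. u x - v x) * (L2norm u + L2norm v))"
proof -
  let ?c = "\<lambda>x. 2 * pi * cas (- (2 * pi * (kk n \<bullet> x)))"
  let ?w = "\<lambda>x. u x - v x"
  note int = bb_bilinear_integrable[OF assms(1) assms(1), of n] bb_bilinear_integrable[OF assms(2) assms(2), of n]
    bb_bilinear_integrable[OF L2_diff[OF assms] assms(1), of n] bb_bilinear_integrable[OF assms(2) L2_diff[OF assms], of n]
  have "bb n u - bb n v = (\<integral>x. ?c x * ((kk n \<bullet> u x) * (dd n \<bullet> u x)) - ?c x * ((kk n \<bullet> v x) * (dd n \<bullet> v x)) \<partial>cell)"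
    unfolding bb_def using int by simp
  also have "\<dots> = (\<integral>x. ?c x * ((kk n \<bullet> ?w x) * (dd n \<bullet> u x)) + ?c x * ((kk n \<bullet> v x) * (dd n \<bullet> ?w x)) \<partial>cell)"
    by (rule Bochner_Integration.integral_cong) (simp_all add: inner_diff_right algebra_simps)
  also have "\<dots> = (\<integral>x. ?c x * ((kk n \<bullet> ?w x) * (dd n \<bullet> u x)) \<partial>cell) + (\<integral>x. ?c x * ((kk n \<bullet> v x) * (dd n \<bullet> ?w x)) \<partial>cell)"
    using int by simp
  finally show ?thesis
    using bb_bilinear_le[OF L2_diff[OF assms] assms(1), of n] bb_bilinear_le[OF assms(2) L2_diff[OF assms], of n]
    by (simp add: algebra_simps)
qed

lemma L2cont_bb: "L2cont (bb n)"
  unfolding L2cont_def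
proof (intro allI impI)
  fix u and v :: "nat \<Rightarrow> vf"
  assume u: "u \<in> Hset" and v: "\<forall>n. v n \<in> Hset" and lim: "(\<lambda>n. L2norm (\<lambda>x. v n x - u x)) \<longlonglongrightarrow> 0"
  have nv: "(\<lambda>m. L2norm (v m)) \<longlonglongrightarrow> L2norm u"
    using L2norm_tendsto[OF _ _ lim] u v Hset_L2 by blast
  have "(\<lambda>m. bb n (v m) - bb n u) \<longlonglongrightarrow> 0"
  proof (rule Lim_null_comparison)
    show "\<forall>\<^sub>F m in sequentially. norm (bb n (v m) - bb n u)
        \<le> kappa n * (L2norm (\<lambda>x. v m x - u x) * (L2norm (v m) + L2norm u))"
      using bb_diff_le u v Hset_L2 by auto
    show "(\<lambda>m. kappa n * (L2norm (\<lambda>x. v m x - u x) * (L2norm (v m) + L2norm u))) \<longlonglongrightarrow> 0"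
      using tendsto_mult_right_zero[OF tendsto_mult_left_zero[OF lim]]
        tendsto_mult[OF lim tendsto_add[OF nv tendsto_const[of "L2norm u"]]]
      by (auto intro: tendsto_mult_right_zero)
  qed
  then show "(\<lambda>m. bb n (v m)) \<longlonglongrightarrow> bb n u" by (simp add: LIM_zero_iff)
qed

subsection \<open>Conservation of energy and enstrophy\<close>

definition scal :: "nat \<Rightarrow> (nat \<Rightarrow> real) \<Rightarrow> real \<times> real \<Rightarrow> real" where
  "scal N c x = (\<Sum>i<N. c i * cas (2 * pi * (kk i \<bullet> x)))"

definition grad :: "nat \<Rightarrow> (nat \<Rightarrow> real) \<Rightarrow> real \<times> real \<Rightarrow> real \<times> real" where
  "grad N c x = (\<Sum>i<N. (c i * (2 * pi * cas (- (2 * pi * (kk i \<bullet> x))))) *\<^sub>R kk i)"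

lemma C1per_scal: "C1per (scal N c) (grad N c)"
proof -
  have "C1per (\<lambda>x. \<Sum>i<N. c i * cas (2 * pi * (kk i \<bullet> x)))
      (\<lambda>x. \<Sum>i<N. c i *\<^sub>R ((2 * pi * cas (- (2 * pi * (kk i \<bullet> x)))) *\<^sub>R kk i))"
    by (intro C1per_sum C1per_cmult C1per_trig wave_Z2)
  then show ?thesis by (simp only: scal_def[abs_def] grad_def[abs_def] scaleR_scaleR)
qed

lemma psum_scal:
  "psum N a x = (scal N (\<lambda>i. a i * fst (dd i)) x, scal N (\<lambda>i. a i * snd (dd i)) x)"
  by (rule prod_eqI) (simp_all add: psum_def scal_def ee_def fst_sum snd_sum mult_ac)

lemma continuous_scal: "continuous_on UNIV (scal N c)"
  using C1per_scal C1per_continuous by blast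

lemma continuous_grad: "continuous_on UNIV (grad N c)"
  using C1per_scal by (auto simp: C1per_def)

lemma continuous_psum: "continuous_on UNIV (psum N a)"
  unfolding psum_def by (intro continuous_intros continuous_on_ee)

text \<open>If w is the field with coefficients \<open>b\<close>, this is the integral of u . (u .
  grad) w. The choices w = u and w = - Laplace u yield the two conservation laws.\<close>

lemma sum_bb:
  "(\<Sum>n<N. b n * bb n (psum N a)) = (\<integral>x.
     scal N (\<lambda>i. a i * fst (dd i)) x * (grad N (\<lambda>i. b i * fst (dd i)) x \<bullet> psum N a x) +
     scal N (\<lambda>i. a i * snd (dd i)) x * (grad N (\<lambda>i. b i * snd (dd i)) x \<bullet> psum N a x) \<partial>cell)"
proof -
  let ?u = "psum N a"
  have "(\<Sum>n<N. b n * bb n ?u)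
      = (\<integral>x. (\<Sum>n<N. b n * (2 * pi * cas (- (2 * pi * (kk n \<bullet> x))) * ((kk n \<bullet> ?u x) * (dd n \<bullet> ?u x)))) \<partial>cell)"
    unfolding bb_def integral_mult_right_zero[symmetric]
    by (rule Bochner_Integration.integral_sum[symmetric])
       (intro integrable_mult_right bb_bilinear_integrable psum_L2)
  also have "\<dots> = (\<integral>x.
     fst (?u x) * (grad N (\<lambda>i. b i * fst (dd i)) x \<bullet> ?u x) +
     snd (?u x) * (grad N (\<lambda>i. b i * snd (dd i)) x \<bullet> ?u x) \<partial>cell)"
    by (rule Bochner_Integration.integral_cong)
       (simp_all add: grad_def inner_sum_left sum_distrib_left sum.distrib[symmetric] inner_prod_def[of "dd _"] algebra_simps)
  finally show ?thesis by (simp add: psum_scal)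
qed

lemma div_free_test: "u \<in> Hset \<Longrightarrow> C1per \<phi> D \<Longrightarrow> (\<integral>x. u x \<bullet> D x \<partial>cell) = 0"
  by (auto simp: Hset_iff div_free_def set_integral_cell)

lemma C1per_half_square: "C1per f D \<Longrightarrow> C1per (\<lambda>x. (f x)\<^sup>2 / 2) (\<lambda>x. f x *\<^sub>R D x)"
  using C1per_cmult[OF C1per_mult[of f D f D], of "1/2"]
  by (simp add: power2_eq_square scaleR_add_left[symmetric] scaleR_add_right[symmetric] flip: scaleR_2)

text \<open>Here u . (u . grad) u = u . grad (|u|^2 / 2), a gradient tested against a
  divergence-free field.\<close>

lemma energy_conservation: "(\<Sum>n<N. a n * bb n (psum N a)) = 0"
proof -
  let ?s1 = "scal N (\<lambda>i. a i * fst (dd i))" and ?s2 = "scal N (\<lambda>i. a i * snd (dd i))"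
  let ?g1 = "grad N (\<lambda>i. a i * fst (dd i))" and ?g2 = "grad N (\<lambda>i. a i * snd (dd i))"
  have "(\<integral>x. psum N a x \<bullet> (?s1 x *\<^sub>R ?g1 x + ?s2 x *\<^sub>R ?g2 x) \<partial>cell) = 0"
    by (rule div_free_test[OF psum_Hset C1per_add[OF C1per_half_square C1per_half_square]])
       (rule C1per_scal)+
  then show ?thesis unfolding sum_bb by (simp add: inner_add_right inner_commute)
qed

text \<open>Modewise form of curl curl u = - Laplace u for divergence-free u: as \<open>dd i\<close>
  is orthogonal to \<open>kk i\<close>, their cross product times the rotated \<open>kk i\<close>
  restores |k|^2 \<open>dd i\<close>.\<close>

lemma lam_direction:
  "4 * pi\<^sup>2 * (fst (kk i) * snd (dd i) - snd (kk i) * fst (dd i)) * fst (kk i) = lam i * snd (dd i)"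
  "- (4 * pi\<^sup>2 * (fst (kk i) * snd (dd i) - snd (kk i) * fst (dd i)) * snd (kk i)) = lam i * fst (dd i)"
proof -
  obtain a b where k: "kk i = (a, b)" by fastforce
  obtain c d where d: "dd i = (c, d)" by fastforce
  have 0: "a * c + b * d = 0" using wave_direction[of "mode i"] by (simp add: k d inner_prod_def)
  have 1: "(a * d - b * c) * a = (a\<^sup>2 + b\<^sup>2) * d" "- ((a * d - b * c) * b) = (a\<^sup>2 + b\<^sup>2) * c"
    using 0 by algebra+
  show "4 * pi\<^sup>2 * (fst (kk i) * snd (dd i) - snd (kk i) * fst (dd i)) * fst (kk i) = lam i * snd (dd i)"
    "- (4 * pi\<^sup>2 * (fst (kk i) * snd (dd i) - snd (kk i) * fst (dd i)) * snd (kk i)) = lam i * fst (dd i)"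
    unfolding lam_def k d fst_conv snd_conv
    using arg_cong[OF 1(1), of "\<lambda>t. 4 * pi\<^sup>2 * t"] arg_cong[OF 1(2), of "\<lambda>t. 4 * pi\<^sup>2 * t"]
    by (simp_all add: norm_prod_def algebra_simps)
qed

text \<open>With \<open>v = -\<Delta>u\<close> and \<open>\<omega> = curl u\<close> one has \<open>\<nabla>\<omega> = (-v\<^sub>2, v\<^sub>1)\<close> and
  \<open>v \<cdot> (u \<cdot> \<nabla>)u = v \<cdot> \<nabla>(\<bar>u\<bar>\<^sup>2/2) - u \<cdot> \<nabla>(\<omega>\<^sup>2/2)\<close>, and every term integrates to zero.\<close>

lemma enstrophy_conservation: "(\<Sum>n<N. (lam n * a n) * bb n (psum N a)) = 0"
proof -
  let ?u = "psum N a" and ?v = "psum N (\<lambda>n. lam n * a n)"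
  let ?u1 = "scal N (\<lambda>i. a i * fst (dd i))" and ?u2 = "scal N (\<lambda>i. a i * snd (dd i))"
  let ?Du1 = "grad N (\<lambda>i. a i * fst (dd i))" and ?Du2 = "grad N (\<lambda>i. a i * snd (dd i))"
  let ?v1 = "scal N (\<lambda>i. lam i * a i * fst (dd i))" and ?v2 = "scal N (\<lambda>i. lam i * a i * snd (dd i))"
  let ?Dv1 = "grad N (\<lambda>i. lam i * a i * fst (dd i))" and ?Dv2 = "grad N (\<lambda>i. lam i * a i * snd (dd i))"
  define \<omega> where "\<omega> x = (\<Sum>i<N. (2 * pi * a i * (fst (kk i) * snd (dd i) - snd (kk i) * fst (dd i))) *
      cas (- (2 * pi * (kk i \<bullet> x))))" for x
  define D\<omega> where "D\<omega> x = (- ?v2 x, ?v1 x)" for x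
  have C\<omega>: "C1per \<omega> D\<omega>"
  proof -
    have "C1per \<omega> (\<lambda>x. \<Sum>i<N. (2 * pi * a i * (fst (kk i) * snd (dd i) - snd (kk i) * fst (dd i))) *\<^sub>R
        ((- 2 * pi * cas (2 * pi * (kk i \<bullet> x))) *\<^sub>R kk i))"
      unfolding \<omega>_def[abs_def] by (intro C1per_sum C1per_cmult C1per_trig wave_Z2)
    also have "(\<lambda>x. \<Sum>i<N. (2 * pi * a i * (fst (kk i) * snd (dd i) - snd (kk i) * fst (dd i))) *\<^sub>R
        ((- 2 * pi * cas (2 * pi * (kk i \<bullet> x))) *\<^sub>R kk i)) = D\<omega>"
    proof
      fix x
      have 1: "(2 * pi * a i * (fst (kk i) * snd (dd i) - snd (kk i) * fst (dd i))) *\<^sub>R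
          ((- 2 * pi * c) *\<^sub>R kk i) = (- (lam i * a i * snd (dd i) * c), lam i * a i * fst (dd i) * c)" for i c
      proof -
        have "- (a i * c * (4 * pi\<^sup>2 * (fst (kk i) * snd (dd i) - snd (kk i) * fst (dd i)) * fst (kk i))) = - (a i * c * (lam i * snd (dd i)))"
          "a i * c * (- (4 * pi\<^sup>2 * (fst (kk i) * snd (dd i) - snd (kk i) * fst (dd i)) * snd (kk i))) = a i * c * (lam i * fst (dd i))"
          using lam_direction[of i] by simp_all
        then show ?thesis
          by (intro prod_eqI) (simp_all add: power2_eq_square algebra_simps)
      qed
      show "(\<Sum>i<N. (2 * pi * a i * (fst (kk i) * snd (dd i) - snd (kk i) * fst (dd i))) *\<^sub>R
        ((- 2 * pi * cas (2 * pi * (kk i \<bullet> x))) *\<^sub>R kk i)) = D\<omega> x"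
        unfolding 1 D\<omega>_def scal_def by (rule prod_eqI) (simp_all add: fst_sum snd_sum sum_negf)
    qed
    finally show ?thesis .
  qed
  have \<omega>: "\<omega> x = fst (?Du2 x) - snd (?Du1 x)" for x
    unfolding \<omega>_def grad_def by (simp add: fst_sum snd_sum sum_subtractf[symmetric] algebra_simps)
  \<comment> \<open>Testing u against the gradient of u . v moves the derivative from v to u, which
    brings the sum into the form v . (u . grad) u up to sign.\<close>
  have 1: "(\<integral>x. ?u x \<bullet> ((?u1 x *\<^sub>R ?Dv1 x + ?v1 x *\<^sub>R ?Du1 x) + (?u2 x *\<^sub>R ?Dv2 x + ?v2 x *\<^sub>R ?Du2 x)) \<partial>cell) = 0"
    by (rule div_free_test[OF psum_Hset C1per_add[OF
          C1per_mult[OF C1per_scal C1per_scal] C1per_mult[OF C1per_scal C1per_scal]]])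
  have 2: "(\<integral>x. ?v x \<bullet> (?u1 x *\<^sub>R ?Du1 x + ?u2 x *\<^sub>R ?Du2 x) \<partial>cell) = 0"
    by (rule div_free_test[OF psum_Hset C1per_add[OF C1per_half_square C1per_half_square]])
       (rule C1per_scal)+
  have 3: "(\<integral>x. ?u x \<bullet> (\<omega> x *\<^sub>R D\<omega> x) \<partial>cell) = 0"
    by (rule div_free_test[OF psum_Hset C1per_half_square[OF C\<omega>]])
  have c\<omega>: "continuous_on UNIV \<omega>" "continuous_on UNIV D\<omega>"
    using C\<omega> C1per_continuous by (auto simp: C1per_def)
  note cont = continuous_intros continuous_scal continuous_grad continuous_psum c\<omega>
  have i1: "integrable cell (\<lambda>x. ?u x \<bullet> ((?u1 x *\<^sub>R ?Dv1 x + ?v1 x *\<^sub>R ?Du1 x) + (?u2 x *\<^sub>R ?Dv2 x + ?v2 x *\<^sub>R ?Du2 x)))"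
    and i2: "integrable cell (\<lambda>x. ?v x \<bullet> (?u1 x *\<^sub>R ?Du1 x + ?u2 x *\<^sub>R ?Du2 x))"
    and i3: "integrable cell (\<lambda>x. ?u x \<bullet> (\<omega> x *\<^sub>R D\<omega> x))"
    by (intro integrable_continuous_cell cont)+
  have "(\<Sum>n<N. (lam n * a n) * bb n ?u)
      = (\<integral>x. ?u1 x * (?Dv1 x \<bullet> ?u x) + ?u2 x * (?Dv2 x \<bullet> ?u x) \<partial>cell)"
    using sum_bb[of "\<lambda>n. lam n * a n" N a] by simp
  also have "\<dots> = (\<integral>x. ?u x \<bullet> ((?u1 x *\<^sub>R ?Dv1 x + ?v1 x *\<^sub>R ?Du1 x) + (?u2 x *\<^sub>R ?Dv2 x + ?v2 x *\<^sub>R ?Du2 x))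
      - ?v x \<bullet> (?u1 x *\<^sub>R ?Du1 x + ?u2 x *\<^sub>R ?Du2 x) + ?u x \<bullet> (\<omega> x *\<^sub>R D\<omega> x) \<partial>cell)"
    by (rule Bochner_Integration.integral_cong)
       (simp_all add: \<omega> D\<omega>_def psum_scal inner_prod_def algebra_simps)
  also have "\<dots> = 0" using i1 i2 i3 1 2 3 by simp
  finally show ?thesis .
qed

subsection \<open>Weak gradients and the nonlinearity\<close>

lemma weak_pdD:
  "weak_pd f j w \<Longrightarrow> C1per \<phi> D \<Longrightarrow> (\<integral>x. f x * (D x \<bullet> j) \<partial>cell) = - (\<integral>x. w x * \<phi> x \<partial>cell)"
  by (simp add: weak_pd_def set_integral_cell)

text \<open>Testing with every \<open>cas\<close> wave shows that the difference has vanishing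
  Fourier coefficients.\<close>

lemma weak_pd_unique:
  assumes "weak_pd f j w" "weak_pd f j w'"
  shows "AE x in cell. w x = w' x"
proof -
  have int: "integrable cell w" "integrable cell w'"
    using assms by (auto simp: weak_pd_def set_integrable_cell)
  have "AE x in cell. w x - w' x = 0"
  proof (rule fourier_uniqueness)
    show "integrable cell (\<lambda>x. w x - w' x)" using int by simp
    fix k assume k: "k \<in> Z2"
    let ?c = "\<lambda>x. cas (2 * pi * (k \<bullet> x))"
    have i: "integrable cell (\<lambda>x. w x * ?c x)" "integrable cell (\<lambda>x. w' x * ?c x)"
      by (rule integrable_mult_bounded_cell[OF _ _ abs_cas_le]; (rule int | measurable))+
    have "(\<integral>x. w x * ?c x \<partial>cell) = (\<integral>x. w' x * ?c x \<partial>cell)"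
      using weak_pdD[OF assms(1) C1per_trig(1)[OF k]] weak_pdD[OF assms(2) C1per_trig(1)[OF k]] by simp
    then show "(\<integral>x. (w x - w' x) * ?c x \<partial>cell) = 0"
      using i by (simp add: left_diff_distrib)
  qed
  then show ?thesis by simp
qed

text \<open>\<open>wgrad\<close> is an arbitrary choice of weak derivative; by uniqueness any
  explicit one may replace it under the integral.\<close>

lemma wgrad_AE:
  assumes "weak_pd (\<lambda>x. v x \<bullet> i) j w"
  shows "AE x in cell. wgrad v i j x = w x" "wgrad v i j \<in> borel_measurable borel"
proof -
  have "weak_pd (\<lambda>x. v x \<bullet> i) j (wgrad v i j)"
    unfolding wgrad_def by (rule someI[where P="weak_pd (\<lambda>x. v x \<bullet> i) j", OF assms])
  then show "AE x in cell. wgrad v i j x = w x" "wgrad v i j \<in> borel_measurable borel"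
    using weak_pd_unique[OF _ assms] by (auto simp: weak_pd_def)
qed

lemma sums_integral_cell:
  fixes h :: "nat \<Rightarrow> real \<times> real \<Rightarrow> real"
  assumes h: "\<And>n. h n \<in> borel_measurable borel" "\<And>n x. \<bar>h n x\<bar> \<le> M n * g x"
    and g: "integrable cell g" "\<And>x. 0 \<le> g x" and M: "summable M"
  shows "(\<lambda>n. \<integral>x. h n x \<partial>cell) sums (\<integral>x. (\<Sum>n. h n x) \<partial>cell)"
    and "integrable cell (\<lambda>x. \<Sum>n. h n x)"
proof -
  have i: "integrable cell (h n)" for n
  proof (rule Bochner_Integration.integrable_bound)
    show "integrable cell (\<lambda>x. M n * g x)" using g by simp
    show "AE x in cell. norm (h n x) \<le> norm (M n * g x)"
      using h(2)[of n] by (intro AE_I2) (simp, smt (verit))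
  qed (rule borel_measurable_cell[OF h(1)])
  have s: "AE x in cell. summable (\<lambda>n. norm (h n x))"
  proof (rule AE_I2)
    fix x
    show "summable (\<lambda>n. norm (h n x))"
      by (rule summable_comparison_test_ev[OF _ summable_mult2[OF M, of "g x"]]) (use h(2) in simp)
  qed
  have si: "summable (\<lambda>n. \<integral>x. norm (h n x) \<partial>cell)"
  proof (rule summable_comparison_test_ev[OF _ summable_mult2[OF M, of "\<integral>x. g x \<partial>cell"]])
    have "(\<integral>x. norm (h n x) \<partial>cell) \<le> (\<integral>x. M n * g x \<partial>cell)" for n
      using i[of n] g h(2) by (intro integral_mono) auto
    then show "\<forall>\<^sub>F n in sequentially. norm (\<integral>x. norm (h n x) \<partial>cell) \<le> M n * (\<integral>x. g x \<partial>cell)"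
      by (intro always_eventually) (simp add: Bochner_Integration.integral_nonneg)
  qed
  show "(\<lambda>n. \<integral>x. h n x \<partial>cell) sums (\<integral>x. (\<Sum>n. h n x) \<partial>cell)" "integrable cell (\<lambda>x. \<Sum>n. h n x)"
    using sums_integral[OF i s si] integrable_suminf[OF i s si] by auto
qed

text \<open>Absolute convergence of the differentiated mode expansion: the one consequence of
  membership in \<open>HL L\<close> on which the estimates for the nonlinearity rest.\<close>

definition nice :: "vf \<Rightarrow> bool" where
  "nice v \<longleftrightarrow> v \<in> Hset \<and> summable (\<lambda>n. \<bar>coef n v\<bar> * kappa n)"

definition gradient_series :: "vf \<Rightarrow> real \<times> real \<Rightarrow> real \<times> real \<Rightarrow> real \<times> real \<Rightarrow> real" where
  "gradient_series v i j x =
     (\<Sum>n. coef n v * (2 * pi * cas (- (2 * pi * (kk n \<bullet> x))) * ((kk n \<bullet> j) * (dd n \<bullet> i))))"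

lemma coef_bb_integrand_le:
  "\<bar>coef n v * (2 * pi * cas t * ((kk n \<bullet> p) * (dd n \<bullet> q)))\<bar> \<le> (\<bar>coef n v\<bar> * kappa n) * (norm p * norm q)"
  using mult_left_mono[OF bb_integrand_le[of t n p q], of "\<bar>coef n v\<bar>"]
  by (simp add: abs_mult mult.assoc)

lemma summable_gradient_series:
  assumes "nice v"
  shows "summable (\<lambda>n. coef n v * (2 * pi * cas (t n) * ((kk n \<bullet> p) * (dd n \<bullet> q))))"
proof (rule summable_comparison_test_ev)
  show "summable (\<lambda>n. (\<bar>coef n v\<bar> * kappa n) * (norm p * norm q))"
    using assms by (intro summable_mult2) (simp add: nice_def)
  show "\<forall>\<^sub>F n in sequentially. norm (coef n v * (2 * pi * cas (t n) * ((kk n \<bullet> p) * (dd n \<bullet> q))))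
      \<le> (\<bar>coef n v\<bar> * kappa n) * (norm p * norm q)"
    unfolding real_norm_def by (intro always_eventually allI coef_bb_integrand_le)
qed

text \<open>Parseval is applied to \<open>v\<close> and the test field \<open>?w\<close>, which need
  not be divergence free; hence the asymmetric hypotheses of \<open>Parseval\<close>. Each mode is
  then integrated by parts, and domination by \<open>kappa\<close> exchanges sum and
  integral.\<close>

lemma nice_weak_pd:
  assumes v: "nice v"
  shows "weak_pd (\<lambda>x. v x \<bullet> i) j (gradient_series v i j)"
proof -
  let ?h = "\<lambda>n x. coef n v * (2 * pi * cas (- (2 * pi * (kk n \<bullet> x))) * ((kk n \<bullet> j) * (dd n \<bullet> i)))"
  have M: "summable (\<lambda>n. \<bar>coef n v\<bar> * kappa n)" and vH: "v \<in> Hset" using v by (auto simp: nice_def)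
  have [measurable]: "?h n \<in> borel_measurable borel" for n by measurable
  have "gradient_series v i j \<in> borel_measurable borel"
    unfolding gradient_series_def[abs_def] by (rule borel_measurable_suminf) simp
  moreover have "integrable cell (gradient_series v i j)"
    unfolding gradient_series_def[abs_def]
    by (rule sums_integral_cell(2)[OF _ coef_bb_integrand_le _ _ M]) auto
  moreover have "(\<integral>x. (v x \<bullet> i) * (D x \<bullet> j) \<partial>cell) = - (\<integral>x. gradient_series v i j x * \<phi> x \<partial>cell)"
    if C: "C1per \<phi> D" for \<phi> D
  proof -
    let ?w = "\<lambda>x. (D x \<bullet> j) *\<^sub>R i"
    have cD: "continuous_on UNIV D" and c\<phi>: "continuous_on UNIV \<phi>"
      using C C1per_continuous by (auto simp: C1per_def)
    have [measurable]: "\<phi> \<in> borel_measurable borel" "D \<in> borel_measurable borel"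
      using cD c\<phi> by (auto intro: borel_measurable_continuous_onI)
    obtain B where B: "\<And>x. x \<in> {0..1} \<times> {0..1} \<Longrightarrow> norm (D x) \<le> B"
      using C1per_bounded_derivative[OF C] by blast
    have wL: "L2 ?w"
    proof (rule L2_bounded)
      show "?w \<in> borel_measurable borel" by measurable
      show "norm (?w x) \<le> (B * norm j) * norm i" if "x \<in> cellQ" for x
      proof -
        have "\<bar>D x \<bullet> j\<bar> \<le> B * norm j"
          using B[of x] that
          by (intro order_trans[OF Cauchy_Schwarz_ineq2] mult_right_mono) (auto simp: cellQ_def)
        then show ?thesis by (simp add: mult_right_mono)
      qed
    qed
    have coefw: "coef n ?w = - (\<integral>x. (2 * pi * cas (- (2 * pi * (kk n \<bullet> x))) * ((kk n \<bullet> j) * (dd n \<bullet> i))) * \<phi> x \<partial>cell)" for n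
    proof -
      let ?P = "\<lambda>x. \<phi> x *\<^sub>R ((2 * pi * cas (- (2 * pi * (kk n \<bullet> x)))) *\<^sub>R kk n) + cas (2 * pi * (kk n \<bullet> x)) *\<^sub>R D x"
      have 0: "(\<integral>x. ?P x \<bullet> j \<partial>cell) = 0"
        by (rule integral_C1per_derivative[OF C1per_mult[OF C C1per_trig(1)[OF wave_Z2]]])
      have i1: "integrable cell (\<lambda>x. ?P x \<bullet> j)"
        and i2: "integrable cell (\<lambda>x. (2 * pi * cas (- (2 * pi * (kk n \<bullet> x))) * ((kk n \<bullet> j) * (dd n \<bullet> i))) * \<phi> x)"
        by (intro integrable_continuous_cell continuous_intros c\<phi> cD)+
      have "coef n ?w = (\<integral>x. (?P x \<bullet> j) * (dd n \<bullet> i)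
          - (2 * pi * cas (- (2 * pi * (kk n \<bullet> x))) * ((kk n \<bullet> j) * (dd n \<bullet> i))) * \<phi> x \<partial>cell)"
        unfolding coef_def L2inner_cell
        by (rule Bochner_Integration.integral_cong)
           (simp_all add: ee_def inner_add_left inner_commute[of i] algebra_simps)
      also have "\<dots> = (\<integral>x. ?P x \<bullet> j \<partial>cell) * (dd n \<bullet> i)
          - (\<integral>x. (2 * pi * cas (- (2 * pi * (kk n \<bullet> x))) * ((kk n \<bullet> j) * (dd n \<bullet> i))) * \<phi> x \<partial>cell)"
        using i1 i2 by simp
      finally show ?thesis using 0 by simp
    qed
    have s1: "(\<lambda>n. coef n v * coef n ?w) sums (\<integral>x. (v x \<bullet> i) * (D x \<bullet> j) \<partial>cell)"
      using Parseval[OF vH wL] by (simp add: L2inner_cell mult.commute)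
    have "(\<lambda>n. \<integral>x. ?h n x * \<phi> x \<partial>cell) sums (\<integral>x. (\<Sum>n. ?h n x * \<phi> x) \<partial>cell)"
    proof (rule sums_integral_cell(1)[OF _ _ _ _ M])
      show "\<bar>?h n x * \<phi> x\<bar> \<le> (\<bar>coef n v\<bar> * kappa n) * (norm j * norm i * \<bar>\<phi> x\<bar>)" for n x
        using mult_right_mono[OF coef_bb_integrand_le[of n v "- (2 * pi * (kk n \<bullet> x))" j i], of "\<bar>\<phi> x\<bar>"]
        by (simp add: abs_mult mult.assoc)
      show "integrable cell (\<lambda>x. norm j * norm i * \<bar>\<phi> x\<bar>)"
        by (intro integrable_continuous_cell continuous_intros c\<phi>)
    qed auto
    moreover have "(\<Sum>n. ?h n x * \<phi> x) = gradient_series v i j x * \<phi> x" for x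
      unfolding gradient_series_def
      by (rule suminf_mult2[symmetric]) (rule summable_gradient_series[OF v])
    moreover have "(\<integral>x. ?h n x * \<phi> x \<partial>cell) = - (coef n v * coef n ?w)" for n
      unfolding coefw by (simp add: mult.assoc)
    ultimately have "(\<lambda>n. - (coef n v * coef n ?w)) sums (\<integral>x. gradient_series v i j x * \<phi> x \<partial>cell)"
      by simp
    from sums_unique2[OF sums_minus[OF this] ] s1 show ?thesis by simp
  qed
  ultimately show ?thesis
    unfolding weak_pd_def set_integral_cell set_integrable_cell by auto
qed

text \<open>The terms are dominated by \<open>kappa n\<close> times |u|^2, so gradient series and
  integral may be exchanged; \<open>nonlin\<close> becomes a combination of the same numbers
  \<open>bb n u\<close> that drive the scheme.\<close>

lemma nonlin_series:
  assumes v: "nice v" and u: "L2 u"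
  shows "(\<lambda>n. coef n v * bb n u) sums nonlin v u"
proof -
  have M: "summable (\<lambda>n. \<bar>coef n v\<bar> * kappa n)" using v by (auto simp: nice_def)
  have [measurable]: "u \<in> borel_measurable borel" using u by (rule L2_measurable)
  let ?h = "\<lambda>n x. coef n v * (2 * pi * cas (- (2 * pi * (kk n \<bullet> x))) * ((kk n \<bullet> u x) * (dd n \<bullet> u x)))"
  have *: "(\<lambda>n. \<integral>x. ?h n x \<partial>cell) sums (\<integral>x. (\<Sum>n. ?h n x) \<partial>cell)"
    "integrable cell (\<lambda>x. \<Sum>n. ?h n x)"
    by (rule sums_integral_cell[OF _ coef_bb_integrand_le integrable_norm_mult[OF u u] _ M]; simp)+
  have pt: "(\<Sum>i\<in>Basis. \<Sum>j\<in>Basis. gradient_series v i j x * (u x \<bullet> i) * (u x \<bullet> j)) = (\<Sum>n. ?h n x)" for x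
  proof -
    let ?g = "\<lambda>n i j. coef n v * (2 * pi * cas (- (2 * pi * (kk n \<bullet> x))) * ((kk n \<bullet> j) * (dd n \<bullet> i)))"
    have sg: "summable (\<lambda>n. ?g n i j * (u x \<bullet> i) * (u x \<bullet> j))" for i j
      by (intro summable_mult2 summable_gradient_series[OF v])
    have "(\<Sum>i\<in>Basis. \<Sum>j\<in>Basis. gradient_series v i j x * (u x \<bullet> i) * (u x \<bullet> j))
        = (\<Sum>i\<in>Basis. \<Sum>j\<in>Basis. \<Sum>n. ?g n i j * (u x \<bullet> i) * (u x \<bullet> j))"
      unfolding gradient_series_def
      by (intro sum.cong refl) (simp add: suminf_mult2[symmetric] summable_mult2 summable_gradient_series[OF v])
    also have "\<dots> = (\<Sum>n. \<Sum>i\<in>Basis. \<Sum>j\<in>Basis. ?g n i j * (u x \<bullet> i) * (u x \<bullet> j))"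
      using sg by (simp add: suminf_sum summable_sum)
    also have "\<dots> = (\<Sum>n. ?h n x)"
    proof (rule suminf_cong)
      fix n
      have "(kk n \<bullet> u x) * (dd n \<bullet> u x) = (\<Sum>i\<in>Basis. \<Sum>j\<in>Basis. (kk n \<bullet> j) * (dd n \<bullet> i) * (u x \<bullet> i) * (u x \<bullet> j))"
        unfolding euclidean_inner[of "kk n" "u x"] euclidean_inner[of "dd n" "u x"]
        by (subst mult.commute) (simp add: sum_product mult_ac)
      then show "(\<Sum>i\<in>Basis. \<Sum>j\<in>Basis. ?g n i j * (u x \<bullet> i) * (u x \<bullet> j)) = ?h n x"
        by (simp add: sum_distrib_left mult_ac)
    qed
    finally show ?thesis .
  qed
  have "nonlin v u = (\<integral>x. (\<Sum>i\<in>Basis. \<Sum>j\<in>Basis. wgrad v i j x * (u x \<bullet> i) * (u x \<bullet> j)) \<partial>cell)"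
    by (simp add: nonlin_def set_integral_cell)
  also have "\<dots> = (\<integral>x. (\<Sum>n. ?h n x) \<partial>cell)"
  proof (rule integral_cong_AE)
    have [measurable]: "wgrad v i j \<in> borel_measurable borel" for i j
      using wgrad_AE(2)[OF nice_weak_pd[OF v]] .
    show "(\<lambda>x. \<Sum>i\<in>Basis. \<Sum>j\<in>Basis. wgrad v i j x * (u x \<bullet> i) * (u x \<bullet> j)) \<in> borel_measurable cell"
      by (intro borel_measurable_cell) measurable
    show "(\<lambda>x. \<Sum>n. ?h n x) \<in> borel_measurable cell" using *(2) by simp
    have "AE x in cell. \<forall>i\<in>Basis. \<forall>j\<in>Basis. wgrad v i j x = gradient_series v i j x"
      using wgrad_AE(1)[OF nice_weak_pd[OF v]] by (simp add: AE_ball_countable countable_finite)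
    then show "AE x in cell. (\<Sum>i\<in>Basis. \<Sum>j\<in>Basis. wgrad v i j x * (u x \<bullet> i) * (u x \<bullet> j)) = (\<Sum>n. ?h n x)"
      by eventually_elim (simp add: pt[symmetric])
  qed
  finally show ?thesis using *(1) by (simp add: bb_def)
qed

lemma nice_sum:
  assumes "\<And>j. j \<in> J \<Longrightarrow> nice (g j)"
  shows "nice (\<lambda>x. \<Sum>j\<in>J. c j *\<^sub>R g j x)"
proof -
  have H: "(\<lambda>x. \<Sum>j\<in>J. c j *\<^sub>R g j x) \<in> Hset"
    using assms by (intro Hset_sum Hset_scale) (auto simp: nice_def)
  have co: "coef n (\<lambda>x. \<Sum>j\<in>J. c j *\<^sub>R g j x) = (\<Sum>j\<in>J. c j * coef n (g j))" for n
    using assms by (subst coef_sum) (auto simp: coef_scale nice_def Hset_L2 L2_scale)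
  have "summable (\<lambda>n. \<Sum>j\<in>J. \<bar>c j\<bar> * (\<bar>coef n (g j)\<bar> * kappa n))"
    using assms by (intro summable_sum summable_mult) (auto simp: nice_def)
  then have "summable (\<lambda>n. \<bar>\<Sum>j\<in>J. c j * coef n (g j)\<bar> * kappa n)"
  proof (rule summable_comparison_test_ev[rotated], intro always_eventually allI)
    fix n
    have "\<bar>\<Sum>j\<in>J. c j * coef n (g j)\<bar> * kappa n \<le> (\<Sum>j\<in>J. \<bar>c j * coef n (g j)\<bar>) * kappa n"
      by (intro mult_right_mono sum_abs) auto
    then show "norm (\<bar>\<Sum>j\<in>J. c j * coef n (g j)\<bar> * kappa n) \<le> (\<Sum>j\<in>J. \<bar>c j\<bar> * (\<bar>coef n (g j)\<bar> * kappa n))"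
      by (simp add: abs_mult sum_distrib_right mult.assoc)
  qed
  then show ?thesis using H by (simp add: nice_def co)
qed

lemma nonlin_sum:
  assumes "finite J" "\<And>j. j \<in> J \<Longrightarrow> nice (g j)" "L2 u"
  shows "nonlin (\<lambda>x. \<Sum>j\<in>J. c j *\<^sub>R g j x) u = (\<Sum>j\<in>J. c j * nonlin (g j) u)"
proof -
  have "coef n (\<lambda>x. \<Sum>j\<in>J. c j *\<^sub>R g j x) = (\<Sum>j\<in>J. c j * coef n (g j))" for n
    using assms by (subst coef_sum) (auto simp: coef_scale nice_def Hset_L2 L2_scale)
  then have "(\<lambda>n. (\<Sum>j\<in>J. c j * coef n (g j)) * bb n u) sums nonlin (\<lambda>x. \<Sum>j\<in>J. c j *\<^sub>R g j x) u"
    using nonlin_series[OF nice_sum assms(3), of J g c] assms(2) by simp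
  moreover have "(\<lambda>n. \<Sum>j\<in>J. c j * (coef n (g j) * bb n u)) sums (\<Sum>j\<in>J. c j * nonlin (g j) u)"
    using assms by (intro sums_sum sums_mult nonlin_series) auto
  ultimately show ?thesis
    by (simp add: sum_distrib_right mult.assoc sums_unique2)
qed

section \<open>Sobolev norms\<close>

fun wave_index :: "mode \<Rightarrow> int \<times> int" where
  "wave_index None = 0"
| "wave_index (Some k) = k"

lemma wave_eq_index: "wave m = (real_of_int (fst (wave_index m)), real_of_int (snd (wave_index m)))"
  by (cases m) (auto simp: zero_prod_def)

text \<open>Every wave vector carries one mode, except zero, which carries two; the second copy of
  its term is at most another \<open>C\<close>.\<close>

lemma sum_modes_le:
  fixes W :: "int \<times> int \<Rightarrow> 'b :: ordered_comm_monoid_add"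
  assumes W: "\<And>k. 0 \<le> W k" and B: "\<And>B. finite B \<Longrightarrow> sum W B \<le> C"
  shows "(\<Sum>n<N. W (wave_index (mode n))) \<le> C + C"
proof -
  define B where "B = wave_index ` mode ` {..<N}"
  have inj: "inj_on mode {..<N}" using bij_mode by (meson bij_def inj_on_subset subset_UNIV)
  have "(\<Sum>n<N. W (wave_index (mode n))) = (\<Sum>m\<in>mode ` {..<N}. W (wave_index m))"
    using inj by (simp add: sum.reindex)
  also have "\<dots> \<le> (\<Sum>m\<in>insert None (Some ` B). W (wave_index m))"
  proof (rule sum_mono2)
    show "mode ` {..<N} \<subseteq> insert None (Some ` B)"
    proof
      fix m assume "m \<in> mode ` {..<N}"
      then show "m \<in> insert None (Some ` B)"
        by (cases m) (force simp: B_def)+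
    qed
  qed (auto simp: B_def W)
  also have "\<dots> = W 0 + sum W B"
    by (subst sum.insert) (auto simp: B_def sum.reindex)
  also have "\<dots> \<le> C + C"
    using B[of "{0}"] B[of B] by (intro add_mono) (auto simp: B_def)
  finally show ?thesis .
qed

text \<open>Since \<open>cas t = Re (cis (- t)) - Im (cis (- t))\<close>, a Hartley coefficient is
  the real minus the imaginary part of the Fourier coefficient, and (Re z - Im z)^2 is at most 2
  |z|^2.\<close>

lemma coef_fcoef_le:
  assumes u: "L2 u"
  shows "(coef n u)\<^sup>2 \<le> 2 * ((cmod (fcoef (\<lambda>x. fst (u x)) (wave_index (mode n))))\<^sup>2
    + (cmod (fcoef (\<lambda>x. snd (u x)) (wave_index (mode n))))\<^sup>2)"
proof -
  define k where "k = wave_index (mode n)"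
  have kk: "kk n \<bullet> x = real_of_int (fst k) * fst x + real_of_int (snd k) * snd x" for x
    unfolding wave_eq_index k_def by (simp add: inner_prod_def)
  have 1: "integrable cell (\<lambda>x. fst (u x))" "integrable cell (\<lambda>x. snd (u x))"
    using integrable_inner[OF u L2_bounded[of "\<lambda>x. (1, 0)" 1]] integrable_inner[OF u L2_bounded[of "\<lambda>x. (0, 1)" 1]]
    by (simp_all add: inner_prod_def)
  have F: "(\<integral>x. f x * cas (2 * pi * (kk n \<bullet> x)) \<partial>cell) = Re (fcoef f k) - Im (fcoef f k)"
    "integrable cell (\<lambda>x. f x * cas (2 * pi * (kk n \<bullet> x)))"
    if f: "integrable cell f" for f
  proof -
    let ?E = "\<lambda>x. complex_of_real (f x) * cis (- 2 * pi * (real_of_int (fst k) * fst x + real_of_int (snd k) * snd x))"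
    have E: "integrable cell ?E"
    proof (rule Bochner_Integration.integrable_bound[OF f])
      have "(\<lambda>x. cis (- 2 * pi * (real_of_int (fst k) * fst x + real_of_int (snd k) * snd x))) \<in> borel_measurable borel"
        by (intro borel_measurable_continuous_onI continuous_intros)
      then show "?E \<in> borel_measurable cell"
        using f by (intro borel_measurable_times[OF _ borel_measurable_cell]) auto
    qed (simp add: norm_mult)
    have eq: "f x * cas (2 * pi * (kk n \<bullet> x)) = Re (?E x) - Im (?E x)" for x
    proof -
      have "?E x = complex_of_real (f x) * cis (- (2 * pi * (kk n \<bullet> x)))" by (simp add: kk)
      then show ?thesis by (simp only:) (simp add: cas_def distrib_left)
    qed
    show "integrable cell (\<lambda>x. f x * cas (2 * pi * (kk n \<bullet> x)))"
      unfolding eq using E by (intro Bochner_Integration.integrable_diff integrable_Re integrable_Im)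
    show "(\<integral>x. f x * cas (2 * pi * (kk n \<bullet> x)) \<partial>cell) = Re (fcoef f k) - Im (fcoef f k)"
      unfolding eq fcoef_def set_integral_cell
      using E by (simp only: Bochner_Integration.integral_diff integrable_Re integrable_Im integral_Re integral_Im)
  qed
  define P where "P = Re (fcoef (\<lambda>x. fst (u x)) k) - Im (fcoef (\<lambda>x. fst (u x)) k)"
  define Q where "Q = Re (fcoef (\<lambda>x. snd (u x)) k) - Im (fcoef (\<lambda>x. snd (u x)) k)"
  have "coef n u = (\<integral>x. fst (dd n) * (fst (u x) * cas (2 * pi * (kk n \<bullet> x)))
      + snd (dd n) * (snd (u x) * cas (2 * pi * (kk n \<bullet> x))) \<partial>cell)"
    unfolding coef_def L2inner_cell
    by (rule Bochner_Integration.integral_cong) (simp_all add: ee_def inner_prod_def algebra_simps)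
  also have "\<dots> = dd n \<bullet> (P, Q)"
    using F[OF 1(1)] F[OF 1(2)] by (simp add: P_def Q_def inner_prod_def)
  finally have "coef n u = dd n \<bullet> (P, Q)" .
  moreover have "\<bar>dd n \<bullet> (P, Q)\<bar> \<le> norm (P, Q)"
    using Cauchy_Schwarz_ineq2[of "dd n" "(P, Q)"] by simp
  ultimately have "\<bar>coef n u\<bar>\<^sup>2 \<le> (norm (P, Q))\<^sup>2"
    by (intro power_mono) auto
  then have "(coef n u)\<^sup>2 \<le> P\<^sup>2 + Q\<^sup>2" by (simp add: norm_prod_def)
  moreover have "(Re z - Im z)\<^sup>2 \<le> 2 * (cmod z)\<^sup>2" for z
    using zero_le_power2[of "Re z + Im z"] by (simp add: cmod_power2 power2_sum power2_diff)
  ultimately show ?thesis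
    unfolding P_def Q_def k_def by (smt (verit) distrib_left)
qed

text \<open>The constant 4 is a factor 2 for passing from exponentials to \<open>cas\<close> waves
  and a factor 2 for the doubled zero mode.\<close>

lemma Hs_sq_coef:
  assumes u: "L2 u"
  shows "(\<Sum>n<N. ennreal ((1 + lam n) powr s * (coef n u)\<^sup>2)) \<le> 4 * Hs_sq s u"
proof -
  define W where "W k = (1 + 4 * pi\<^sup>2 * (real_of_int (fst k) ^ 2 + real_of_int (snd k) ^ 2)) powr s *
        ((cmod (fcoef (\<lambda>x. fst (u x)) k)) ^ 2 + (cmod (fcoef (\<lambda>x. snd (u x)) k)) ^ 2)" for k
  have lam: "1 + lam n = 1 + 4 * pi\<^sup>2 * (real_of_int (fst (wave_index (mode n))) ^ 2 + real_of_int (snd (wave_index (mode n))) ^ 2)" for n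
    unfolding lam_def wave_eq_index by (simp add: norm_prod_def)
  have "(1 + lam n) powr s * (coef n u)\<^sup>2 \<le> 2 * W (wave_index (mode n))" for n
    using mult_left_mono[OF coef_fcoef_le[OF u, of n], of "(1 + lam n) powr s"]
    by (simp add: W_def lam algebra_simps)
  then have "(\<Sum>n<N. ennreal ((1 + lam n) powr s * (coef n u)\<^sup>2)) \<le> (\<Sum>n<N. ennreal (2 * W (wave_index (mode n))))"
    by (intro sum_mono ennreal_leI)
  also have "\<dots> = 2 * (\<Sum>n<N. ennreal (W (wave_index (mode n))))"
    by (simp add: ennreal_mult' sum_distrib_left)
  also have "\<dots> \<le> 2 * (Hs_sq s u + Hs_sq s u)"
  proof (intro mult_left_mono sum_modes_le)
    fix B :: "(int \<times> int) set" assume B: "finite B"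
    have "(\<Sum>k\<in>B. ennreal (W k)) = (\<integral>\<^sup>+k. ennreal (W k) \<partial>count_space B)"
      using B by (simp add: nn_integral_count_space_finite)
    also have "\<dots> = (\<integral>\<^sup>+k. ennreal (W k) * indicator B k \<partial>count_space UNIV)"
      by (rule nn_integral_count_space_indicator) simp
    also have "\<dots> \<le> Hs_sq s u"
      unfolding Hs_sq_def W_def by (intro nn_integral_mono) (auto simp: indicator_def)
    finally show "(\<Sum>k\<in>B. ennreal (W k)) \<le> Hs_sq s u" .
  qed simp_all
  also have "\<dots> = 4 * Hs_sq s u"
    by (simp add: mult_2[symmetric] mult.assoc[symmetric])
  finally show ?thesis .
qed

section \<open>Lattice sums and the exponent \<open>L > 2\<close>\<close>

lemma sum_int_le:
  fixes f :: "nat \<Rightarrow> real"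
  assumes f: "summable f" "\<And>n. 0 \<le> f n" and B: "finite B"
  shows "(\<Sum>m\<in>B. f (nat \<bar>m\<bar>)) \<le> 2 * suminf f"
proof -
  have part: "(\<Sum>m\<in>C. f (nat \<bar>m\<bar>)) \<le> suminf f"
    if "finite C" "inj_on (\<lambda>m. nat \<bar>m\<bar>) C" for C :: "int set"
  proof -
    have "(\<Sum>m\<in>C. f (nat \<bar>m\<bar>)) = sum f ((\<lambda>m. nat \<bar>m\<bar>) ` C)"
      using that by (simp add: sum.reindex)
    also have "\<dots> \<le> suminf f" using f that by (intro sum_le_suminf) auto
    finally show ?thesis .
  qed
  have "(\<Sum>m\<in>B. f (nat \<bar>m\<bar>)) = (\<Sum>m\<in>B \<inter> {0..}. f (nat \<bar>m\<bar>)) + (\<Sum>m\<in>B \<inter> - {0..}. f (nat \<bar>m\<bar>))"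
    by (rule sum.Int_Diff[OF B, unfolded Diff_eq])
  also have "\<dots> \<le> suminf f + suminf f"
    using B by (intro add_mono part) (auto simp: inj_on_def)
  finally show ?thesis by simp
qed

text \<open>The inequality (1 + X)(1 + Y) \<le> (1 + X + Y)^2 splits the lattice sum into a product
  of two one-dimensional series whose terms decay like n^(1 - L); they converge because L - 1 >
  1.\<close>

lemma summable_lam_powr:
  assumes "L > 2"
  shows "summable (\<lambda>n. (1 + lam n) powr (1 - L))"
proof -
  define b where "b = (L - 1) / 2"
  have b: "2 * b > 1" using assms by (simp add: b_def)
  define q where "q n = (1 + (real n)\<^sup>2) powr (- b)" for n
  have q0: "0 \<le> q n" for n by (simp add: q_def)
  have q: "summable q"
  proof (rule summable_comparison_test_ev)
    show "summable (\<lambda>n. real n powr (- 2 * b))" using b by (simp add: summable_real_powr_iff)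
    show "\<forall>\<^sub>F n in sequentially. norm (q n) \<le> real n powr (- 2 * b)"
      using eventually_gt_at_top[of 0]
    proof eventually_elim
      case (elim n)
      have "q n \<le> ((real n)\<^sup>2) powr (- b)"
        unfolding q_def using elim b by (intro powr_mono2') auto
      also have "\<dots> = (real n powr 2) powr (- b)" using elim by (simp add: powr_numeral)
      also have "\<dots> = real n powr (- 2 * b)" by (subst powr_powr) simp
      finally show ?case using q0 by simp
    qed
  qed
  define W where "W k = q (nat \<bar>fst k\<bar>) * q (nat \<bar>snd k\<bar>)" for k :: "int \<times> int"
  have le: "(1 + lam n) powr (1 - L) \<le> W (wave_index (mode n))" for n
  proof -
    obtain x y where xy: "wave_index (mode n) = (x, y)" by fastforce
    define X Y where "X = (real_of_int x)\<^sup>2" and "Y = (real_of_int y)\<^sup>2"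
    have XY: "0 \<le> X" "0 \<le> Y" by (auto simp: X_def Y_def)
    have "1 * (X + Y) \<le> 4 * pi\<^sup>2 * (X + Y)"
    proof (rule mult_right_mono)
      have "1 \<le> pi\<^sup>2" using pi_gt3 by (simp add: one_le_power)
      then show "1 \<le> 4 * pi\<^sup>2" by simp
    qed (use XY in simp)
    then have l: "1 + X + Y \<le> 1 + lam n"
      unfolding lam_def wave_eq_index xy by (simp add: norm_prod_def X_def Y_def)
    have "(1 + X) * (1 + Y) \<le> (1 + X + Y)\<^sup>2"
      using XY by (simp add: power2_eq_square algebra_simps)
    also have "\<dots> \<le> (1 + lam n)\<^sup>2" using l XY by (intro power_mono) auto
    finally have "((1 + lam n)\<^sup>2) powr (- b) \<le> ((1 + X) * (1 + Y)) powr (- b)"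
      using b XY by (intro powr_mono2') (auto intro: mult_pos_pos)
    moreover have "((1 + lam n)\<^sup>2) powr (- b) = (1 + lam n) powr (1 - L)"
    proof -
      have "((1 + lam n)\<^sup>2) powr (- b) = ((1 + lam n) powr 2) powr (- b)"
        using lam_nonneg[of n] by (simp add: powr_numeral)
      also have "\<dots> = (1 + lam n) powr (1 - L)" unfolding powr_powr by (rule arg_cong) (simp add: b_def field_simps)
      finally show ?thesis .
    qed
    moreover have "((1 + X) * (1 + Y)) powr (- b) = W (x, y)"
      using XY by (simp add: W_def q_def X_def Y_def powr_mult)
    ultimately show ?thesis by (simp add: xy)
  qed
  have fin: "sum W B \<le> (2 * suminf q) * (2 * suminf q)" if "finite B" for B
  proof -
    have "sum W B \<le> sum W (fst ` B \<times> snd ` B)"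
      using that by (intro sum_mono2) (force simp: W_def q0)+
    also have "\<dots> = (\<Sum>m\<in>fst ` B. q (nat \<bar>m\<bar>)) * (\<Sum>m\<in>snd ` B. q (nat \<bar>m\<bar>))"
      by (simp add: W_def sum_product sum.cartesian_product case_prod_unfold)
    also have "\<dots> \<le> (2 * suminf q) * (2 * suminf q)"
      using that q q0 by (intro mult_mono sum_int_le) (auto intro: sum_nonneg suminf_nonneg)
    finally show ?thesis .
  qed
  show ?thesis
  proof (rule summableI_nonneg_bounded)
    fix N
    have "(\<Sum>n<N. (1 + lam n) powr (1 - L)) \<le> (\<Sum>n<N. W (wave_index (mode n)))"
      by (intro sum_mono le)
    also have "\<dots> \<le> (2 * suminf q) * (2 * suminf q) + (2 * suminf q) * (2 * suminf q)"
      by (rule sum_modes_le[OF _ fin]) (simp_all add: W_def q0)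
    finally show "(\<Sum>n<N. (1 + lam n) powr (1 - L)) \<le> (2 * suminf q) * (2 * suminf q) + (2 * suminf q) * (2 * suminf q)" .
  qed simp
qed

text \<open>Weighted Young inequality: as the square of \<open>kappa n\<close> is at most
  \<open>4 * (1 + lam n)\<close>, the product of |coef n g| and \<open>kappa n\<close> is bounded by
  multiples of \<open>(1 + lam n) powr L * (coef n g)\<^sup>2\<close>, summable by the Sobolev norm,
  and of \<open>(1 + lam n) powr (1 - L)\<close>, the lattice sum.\<close>

lemma HL_nice:
  assumes L: "L > 2" and g: "g \<in> HL L"
  shows "nice g"
proof -
  have gH: "g \<in> Hset" and gs: "Hs_sq L g < \<infinity>" using g by (auto simp: HL_def)
  have s1: "summable (\<lambda>n. (1 + lam n) powr L * (coef n g)\<^sup>2)"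
  proof (rule summableI_nonneg_bounded)
    fix N
    have "ennreal (\<Sum>n<N. (1 + lam n) powr L * (coef n g)\<^sup>2) \<le> 4 * Hs_sq L g"
      using Hs_sq_coef[OF Hset_L2[OF gH], where N=N and s=L] by (simp add: sum_ennreal)
    also have "\<dots> = ennreal (enn2real (4 * Hs_sq L g))"
      using gs by (subst ennreal_enn2real) (auto simp: ennreal_mult_less_top)
    finally show "(\<Sum>n<N. (1 + lam n) powr L * (coef n g)\<^sup>2) \<le> enn2real (4 * Hs_sq L g)"
      by (simp add: enn2real_nonneg)
  qed simp
  have "summable (\<lambda>n. 2 * ((1 + lam n) powr L * (coef n g)\<^sup>2 + (1 + lam n) powr (1 - L)))"
    by (intro summable_mult summable_add s1 summable_lam_powr L)
  then have "summable (\<lambda>n. \<bar>coef n g\<bar> * kappa n)"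
  proof (rule summable_comparison_test_ev[rotated], intro always_eventually allI)
    fix n
    let ?l = "1 + lam n"
    have l: "?l \<ge> 1" and l0: "?l \<noteq> 0" using lam_nonneg[of n] by linarith+
    have k: "(kappa n)\<^sup>2 \<le> 4 * ?l" by (simp add: kappa_def lam_def power_mult_distrib)
    have "2 * (\<bar>coef n g\<bar> * kappa n) \<le> 4 * (?l powr L * (coef n g)\<^sup>2) + (kappa n)\<^sup>2 / (4 * ?l powr L)"
    proof -
      define p where "p = ?l powr L"
      have p: "p > 0" using l0 by (simp add: p_def)
      have "0 \<le> (2 * sqrt p * \<bar>coef n g\<bar> - kappa n / (2 * sqrt p))\<^sup>2" by simp
      also have "\<dots> = 4 * (p * (coef n g)\<^sup>2) - 2 * (\<bar>coef n g\<bar> * kappa n) + (kappa n)\<^sup>2 / (4 * p)"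
        using p by (simp add: power2_diff power_mult_distrib power_divide field_simps)
      finally show ?thesis by (simp add: p_def)
    qed
    also have "(kappa n)\<^sup>2 / (4 * ?l powr L) \<le> (4 * ?l) / (4 * ?l powr L)"
      using k l by (intro divide_right_mono) auto
    also have "(4 * ?l) / (4 * ?l powr L) = ?l powr (1 - L)"
    proof -
      have "(4 * ?l) / (4 * ?l powr L) = ?l / ?l powr L" by (rule mult_divide_mult_cancel_left) simp
      then show ?thesis using l0 by (simp add: powr_diff)
    qed
    finally have "2 * (\<bar>coef n g\<bar> * kappa n) \<le> 4 * (?l powr L * (coef n g)\<^sup>2) + ?l powr (1 - L)" by simp
    moreover have "0 \<le> ?l powr (1 - L)" by simp
    ultimately have "\<bar>coef n g\<bar> * kappa n \<le> 2 * (?l powr L * (coef n g)\<^sup>2) + 2 * ?l powr (1 - L)"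
      by linarith
    then show "norm (\<bar>coef n g\<bar> * kappa n) \<le> 2 * (?l powr L * (coef n g)\<^sup>2 + ?l powr (1 - L))"
      by simp
  qed
  then show ?thesis using gH by (simp add: nice_def)
qed

section \<open>The time discretised Galerkin scheme\<close>

text \<open>Worst case for the second-order error of an Euler step: \<open>bb k\<close> is at most
  \<open>kappa k\<close> times the energy, and the weights 1 and \<open>lam k\<close> of energy and
  enstrophy are both at most \<open>1 + lam k\<close>.\<close>

definition KK :: "nat \<Rightarrow> real" where
  "KK N = 1 + (\<Sum>k<N. (1 + lam k) * (kappa k)\<^sup>2)"

text \<open>The time step is chosen such that \<open>h\<^sup>2 KK N = h/(N + 1)\<close>.\<close>

definition hh :: "nat \<Rightarrow> real" where
  "hh N = 1 / (real (Suc N) * KK N)"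

lemma KK_ge_1: "1 \<le> KK N"
  unfolding KK_def by (simp add: sum_nonneg add_nonneg_nonneg)

lemma hh_pos: "0 < hh N"
  unfolding hh_def using KK_ge_1[of N] by simp

lemma hh_le: "hh N \<le> 1 / real (Suc N)"
proof -
  have "real (Suc N) * 1 \<le> real (Suc N) * KK N" by (intro mult_left_mono KK_ge_1) simp
  then show ?thesis unfolding hh_def by (intro divide_left_mono) (use KK_ge_1[of N] in auto)
qed

lemma hh_tendsto: "hh \<longlonglongrightarrow> 0"
proof (rule tendsto_sandwich[OF _ _ tendsto_const])
  show "(\<lambda>N. 1 / real (Suc N)) \<longlonglongrightarrow> 0"
    using LIMSEQ_inverse_real_of_nat by (simp add: inverse_eq_divide)
qed (auto simp: hh_le hh_pos less_imp_le simp del: of_nat_Suc)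

lemma hh_KK: "(hh N)\<^sup>2 * KK N = hh N / real (Suc N)"
  using KK_ge_1[of N] by (simp add: hh_def power2_eq_square)

primrec galerkin :: "nat \<Rightarrow> (nat \<Rightarrow> real) \<Rightarrow> nat \<Rightarrow> nat \<Rightarrow> real" where
  "galerkin N c 0 = (\<lambda>k. if k < N then c k else 0)"
| "galerkin N c (Suc n) = (\<lambda>k. if k < N
     then galerkin N c n k + hh N * bb k (psum N (galerkin N c n)) else 0)"

text \<open>Serves energy (weight 1) and enstrophy (weight \<open>lam\<close>) at once:
  \<open>cons\<close> removes the cross term of the expanded square, and \<open>hh_KK\<close>
  converts the remaining squared step into a step over N + 1.\<close>

lemma galerkin_step_le:
  assumes w: "\<And>k. 0 \<le> w k" "\<And>k. w k \<le> 1 + lam k"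
    and cons: "(\<Sum>k<N. w k * a k * bb k (psum N a)) = 0"
  shows "(\<Sum>k<N. w k * (a k + hh N * bb k (psum N a))\<^sup>2)
    \<le> (\<Sum>k<N. w k * (a k)\<^sup>2) + hh N * ((\<Sum>k<N. (a k)\<^sup>2)\<^sup>2 / real (Suc N))"
proof -
  let ?b = "\<lambda>k. bb k (psum N a)"
  let ?E = "\<Sum>k<N. (a k)\<^sup>2"
  have "(\<Sum>k<N. w k * (a k + hh N * ?b k)\<^sup>2)
      = (\<Sum>k<N. w k * (a k)\<^sup>2 + 2 * hh N * (w k * a k * ?b k) + (hh N)\<^sup>2 * (w k * (?b k)\<^sup>2))"
    by (intro sum.cong refl) (simp add: power2_eq_square algebra_simps)
  also have "\<dots> = (\<Sum>k<N. w k * (a k)\<^sup>2) + (hh N)\<^sup>2 * (\<Sum>k<N. w k * (?b k)\<^sup>2)"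
    using cons by (simp add: sum.distrib sum_distrib_left[symmetric])
  also have "(\<Sum>k<N. w k * (?b k)\<^sup>2) \<le> (\<Sum>k<N. (1 + lam k) * (kappa k * ?E)\<^sup>2)"
  proof (intro sum_mono mult_mono w)
    fix k
    have "\<bar>?b k\<bar> \<le> kappa k * ?E" using abs_bb_le[OF psum_L2, of k N a] by (simp add: L2norm_psum)
    then show "(?b k)\<^sup>2 \<le> (kappa k * ?E)\<^sup>2"
      by (metis abs_ge_zero power2_abs power_mono)
  qed (auto simp: add_nonneg_nonneg)
  also have "\<dots> = (\<Sum>k<N. (1 + lam k) * (kappa k)\<^sup>2) * ?E\<^sup>2"
    by (simp add: power_mult_distrib sum_distrib_right mult.assoc)
  also have "\<dots> \<le> KK N * ?E\<^sup>2"
    by (intro mult_right_mono) (simp_all add: KK_def)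
  also have "(hh N)\<^sup>2 * (KK N * ?E\<^sup>2) = hh N * (?E\<^sup>2 / real (Suc N))"
    unfolding mult.assoc[symmetric] hh_KK by simp
  finally show ?thesis by (simp add: mult_left_mono)
qed

text \<open>Each Euler step raises energy and enstrophy by at most \<open>h E\<^sup>2/(N+1)\<close>, since the
  first-order terms vanish by the conservation laws.\<close>

lemma galerkin_bound:
  assumes E: "(\<Sum>k<N. (c k)\<^sup>2) \<le> E" and T: "T * (E + 1)\<^sup>2 \<le> real (Suc N)" and n: "real n * hh N \<le> T"
  shows "(\<Sum>k<N. (galerkin N c n k)\<^sup>2) \<le> E + real n * hh N * ((E + 1)\<^sup>2 / real (Suc N)) \<and>
    (\<Sum>k<N. lam k * (galerkin N c n k)\<^sup>2)
      \<le> (\<Sum>k<N. lam k * (c k)\<^sup>2) + real n * hh N * ((E + 1)\<^sup>2 / real (Suc N))"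
  using n
proof (induction n)
  case 0
  then show ?case using E by simp
next
  case (Suc n)
  let ?a = "galerkin N c n"
  let ?E = "\<Sum>k<N. (?a k)\<^sup>2"
  define \<eta> where "\<eta> = (E + 1)\<^sup>2 / real (Suc N)"
  have "0 \<le> \<eta>" by (simp add: \<eta>_def)
  have E0: "0 \<le> ?E" by (simp add: sum_nonneg)
  have nT: "real n * hh N \<le> T" using Suc.prems hh_pos[of N] by (simp add: distrib_right)
  note IH = Suc.IH[OF nT, folded \<eta>_def]
  \<comment> \<open>The growth per step is quadratic in the energy, so the induction must keep the
    energy below \<open>E + 1\<close>; up to time \<open>T\<close> the accumulated growth is at most
    \<open>T * \<eta> \<le> 1\<close>.\<close>
  have "real n * hh N * \<eta> \<le> T * \<eta>" using nT \<open>0 \<le> \<eta>\<close> by (rule mult_right_mono)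
  also have "\<dots> \<le> 1" using T unfolding \<eta>_def by (simp add: divide_le_eq)
  finally have "?E \<le> E + 1" using IH by linarith
  then have "?E\<^sup>2 \<le> (E + 1)\<^sup>2" using E0 by (intro power_mono) auto
  then have E2: "hh N * (?E\<^sup>2 / real (Suc N)) \<le> hh N * \<eta>"
    unfolding \<eta>_def using hh_pos[of N] by (intro mult_left_mono divide_right_mono) auto
  have 1: "(\<Sum>k<N. 1 * (?a k + hh N * bb k (psum N ?a))\<^sup>2) \<le> (\<Sum>k<N. 1 * (?a k)\<^sup>2) + hh N * (?E\<^sup>2 / real (Suc N))"
    by (rule galerkin_step_le) (simp_all add: energy_conservation)
  have 2: "(\<Sum>k<N. lam k * (?a k + hh N * bb k (psum N ?a))\<^sup>2)
      \<le> (\<Sum>k<N. lam k * (?a k)\<^sup>2) + hh N * (?E\<^sup>2 / real (Suc N))"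
    by (rule galerkin_step_le) (simp_all add: enstrophy_conservation)
  have Suc_eq: "real (Suc n) * hh N * \<eta> = real n * hh N * \<eta> + hh N * \<eta>" by (simp add: algebra_simps)
  show ?case
    using IH 1 2 E2 unfolding \<eta>_def[symmetric] Suc_eq by simp
qed

text \<open>Piecewise constant rather than interpolated, so bounds and measurability of the scheme
  carry over to every time unchanged.\<close>

definition gpath :: "nat \<Rightarrow> (nat \<Rightarrow> real) \<Rightarrow> real \<Rightarrow> nat \<Rightarrow> real" where
  "gpath N c t = galerkin N c (nat \<lfloor>t / hh N\<rfloor>)"

lemma gpath_bound:
  assumes E: "\<And>N. (\<Sum>k<N. (c k)\<^sup>2) \<le> E" and Z: "\<And>N. (\<Sum>k<N. lam k * (c k)\<^sup>2) \<le> Z"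
    and T: "T * (E + 1)\<^sup>2 \<le> real (Suc N)" and t: "0 \<le> t" "t \<le> T"
  shows "(\<Sum>k<N. (gpath N c t k)\<^sup>2) \<le> E + T * (E + 1)\<^sup>2 / real (Suc N)"
    and "(\<Sum>k<N. lam k * (gpath N c t k)\<^sup>2) \<le> Z + T * (E + 1)\<^sup>2 / real (Suc N)"
proof -
  let ?n = "nat \<lfloor>t / hh N\<rfloor>"
  have "real ?n \<le> t / hh N" using t hh_pos[of N] by (simp add: of_nat_nat)
  then have n: "real ?n * hh N \<le> t" using hh_pos[of N] by (simp add: field_simps)
  then have "real ?n * hh N \<le> T" using t by linarith
  moreover from this have "real ?n * hh N * ((E + 1)\<^sup>2 / real (Suc N)) \<le> T * ((E + 1)\<^sup>2 / real (Suc N))"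
    by (intro mult_right_mono) auto
  ultimately show "(\<Sum>k<N. (gpath N c t k)\<^sup>2) \<le> E + T * (E + 1)\<^sup>2 / real (Suc N)"
    "(\<Sum>k<N. lam k * (gpath N c t k)\<^sup>2) \<le> Z + T * (E + 1)\<^sup>2 / real (Suc N)"
    using galerkin_bound[OF E[of N] T, of ?n] Z[of N] unfolding gpath_def by auto
qed

lemma gpath_beyond: "N \<le> k \<Longrightarrow> gpath N c t k = 0"
  unfolding gpath_def by (cases "nat \<lfloor>t / hh N\<rfloor>") auto

lemma gpath_0: "k < N \<Longrightarrow> gpath N c 0 k = c k"
  unfolding gpath_def by simp

text \<open>The increment is a sum over whole steps, each within \<open>hh N * e\<close> of
  \<open>hh N * \<beta>\<close>, and the time covered by these steps differs from
  \<open>s2 - s1\<close> by at most one step. The choice \<open>\<beta> = 0\<close> yields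
  equicontinuity; taking for \<open>\<beta>\<close> the nonlinearity at the limit yields the
  derivative.\<close>

lemma gpath_increment:
  assumes s: "0 \<le> s1" "s1 \<le> s2" and j: "j < N"
    and b: "\<And>s. s1 \<le> s \<Longrightarrow> s \<le> s2 \<Longrightarrow> \<bar>bb j (psum N (gpath N c s)) - \<beta>\<bar> \<le> e"
  shows "\<bar>gpath N c s2 j - gpath N c s1 j - (s2 - s1) * \<beta>\<bar> \<le> (s2 - s1 + hh N) * e + hh N * \<bar>\<beta>\<bar>"
proof -
  define h where "h = hh N"
  have h: "h > 0" using hh_pos h_def by simp
  define n1 n2 where "n1 = nat \<lfloor>s1 / h\<rfloor>" and "n2 = nat \<lfloor>s2 / h\<rfloor>"
  have n12: "n1 \<le> n2" unfolding n1_def n2_def using s h by (intro nat_mono floor_mono divide_right_mono) auto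
  have n1: "real n1 \<le> s1 / h" "s1 / h < real n1 + 1"
    using s h by (auto simp: n1_def of_nat_nat)
  have n2: "real n2 \<le> s2 / h" "s2 / h < real n2 + 1"
    using s h by (auto simp: n2_def of_nat_nat)
  have n1h: "real n1 * h \<le> s1" "s1 < real n1 * h + h" and n2h: "real n2 * h \<le> s2" "s2 < real n2 * h + h"
    using n1 n2 h by (simp_all add: field_simps)
  have e0: "0 \<le> e" using b[of s1] s by linarith
  have "galerkin N c (n1 + d) j - galerkin N c n1 j - real d * h * \<beta> \<le> real d * h * e \<and>
      - (real d * h * e) \<le> galerkin N c (n1 + d) j - galerkin N c n1 j - real d * h * \<beta>"
    if "n1 + d \<le> n2" for d
    using that
  proof (induction d)
    case (Suc d)
    \<comment> \<open>Step \<open>n1\<close> may begin before \<open>s1\<close>; the maximum selects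
      a time of the same step inside the interval, where \<open>b\<close> applies.\<close>
    define s where "s = max (real (n1 + d) * h) s1"
    have "s1 \<le> s" by (simp add: s_def)
    moreover have "s \<le> s2"
    proof -
      have "real (n1 + d) * h \<le> real n2 * h" using Suc.prems h by (intro mult_right_mono) auto
      also have "\<dots> \<le> s2" by (rule n2h)
      finally show ?thesis using s by (simp add: s_def)
    qed
    moreover have "nat \<lfloor>s / h\<rfloor> = n1 + d"
    proof -
      have "s / h = max (real (n1 + d)) (s1 / h)" using h by (simp add: s_def max_def field_simps)
      moreover have "\<lfloor>max (real (n1 + d)) (s1 / h)\<rfloor> = int (n1 + d)"
        using n1 by (simp add: floor_eq_iff)
      ultimately show ?thesis by simp
    qed
    ultimately have *: "\<bar>bb j (psum N (galerkin N c (n1 + d))) - \<beta>\<bar> \<le> e"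
      using b[of s] by (simp add: gpath_def h_def)
    define X where "X = bb j (psum N (galerkin N c (n1 + d)))"
    have "h * X \<le> h * (\<beta> + e)" "h * (\<beta> - e) \<le> h * X"
      using * h unfolding X_def by (auto intro!: mult_left_mono)
    moreover have "galerkin N c (n1 + Suc d) j = galerkin N c (n1 + d) j + h * X"
      using j by (simp add: X_def h_def)
    ultimately show ?case
      using Suc.IH Suc.prems by (simp add: algebra_simps)
  qed simp
  from this[of "n2 - n1"] n12 have
    1: "\<bar>gpath N c s2 j - gpath N c s1 j - real (n2 - n1) * h * \<beta>\<bar> \<le> real (n2 - n1) * h * e"
    by (simp add: gpath_def n1_def n2_def h_def abs_le_iff)
  have 2: "\<bar>real (n2 - n1) * h - (s2 - s1)\<bar> \<le> h"
    using n1h n2h n12 by (simp add: of_nat_diff algebra_simps abs_le_iff)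
  have "real (n2 - n1) * h * e \<le> (s2 - s1 + h) * e"
    using 2 e0 by (intro mult_right_mono) auto
  moreover have "\<bar>real (n2 - n1) * h * \<beta> - (s2 - s1) * \<beta>\<bar> \<le> h * \<bar>\<beta>\<bar>"
    using mult_right_mono[OF 2, of "\<bar>\<beta>\<bar>"] by (simp add: abs_mult[symmetric] left_diff_distrib)
  ultimately show ?thesis using 1 unfolding h_def[symmetric] by linarith
qed

text \<open>Displays the nonlinearity as a quadratic polynomial in the coefficients, from which
  measurability of the scheme is immediate.\<close>

lemma bb_psum:
  "bb k (psum N a) = (\<Sum>i<N. \<Sum>j<N. a i * a j *
     (\<integral>x. 2 * pi * cas (- (2 * pi * (kk k \<bullet> x))) * ((kk k \<bullet> ee i x) * (dd k \<bullet> ee j x)) \<partial>cell))"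
proof -
  have "bb k (psum N a) = (\<integral>x. (\<Sum>i<N. \<Sum>j<N. a i * a j *
     (2 * pi * cas (- (2 * pi * (kk k \<bullet> x))) * ((kk k \<bullet> ee i x) * (dd k \<bullet> ee j x)))) \<partial>cell)"
    unfolding bb_def
    by (rule Bochner_Integration.integral_cong)
       (simp_all add: psum_def inner_sum_right sum_product sum_distrib_left mult_ac)
  also have "\<dots> = (\<Sum>i<N. \<Sum>j<N. \<integral>x. a i * a j *
     (2 * pi * cas (- (2 * pi * (kk k \<bullet> x))) * ((kk k \<bullet> ee i x) * (dd k \<bullet> ee j x))) \<partial>cell)"
    by (simp only: Bochner_Integration.integral_sum Bochner_Integration.integrable_sum
        integrable_mult_right bb_bilinear_integrable ee_L2)
  finally show ?thesis by simp
qed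

lemma measurable_galerkin:
  assumes c: "\<And>k. (\<lambda>w. c w k) \<in> borel_measurable M"
  shows "(\<lambda>w. galerkin N (c w) n k) \<in> borel_measurable M"
proof (induction n arbitrary: k)
  case 0
  then show ?case using c by (cases "k < N") auto
next
  case (Suc n)
  note [measurable] = Suc.IH
  show ?case unfolding galerkin.simps bb_psum by (cases "k < N") simp_all
qed

section \<open>Measurable selection of cluster points\<close>

text \<open>Coordinate \<open>p\<close> of the selected cluster point is the largest cluster value of the \<open>X N p\<close>
  along those \<open>N\<close> for which the earlier coordinates approach their selected values.\<close>

primrec cluster_aux :: "(nat \<Rightarrow> nat \<Rightarrow> 'a \<Rightarrow> real) \<Rightarrow> nat \<Rightarrow> nat \<Rightarrow> 'a \<Rightarrow> real" where
  "cluster_aux X 0 = (\<lambda>i w. 0)"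
| "cluster_aux X (Suc p) = (cluster_aux X p)(p := (\<lambda>w. real_of_ereal (INF j. limsup (\<lambda>N.
     if \<forall>i<p. \<bar>X N i w - cluster_aux X p i w\<bar> < 1 / real (Suc j) then ereal (X N p w) else - \<infinity>))))"

definition cluster :: "(nat \<Rightarrow> nat \<Rightarrow> 'a \<Rightarrow> real) \<Rightarrow> nat \<Rightarrow> 'a \<Rightarrow> real" where
  "cluster X p = cluster_aux X (Suc p) p"

lemma cluster_aux_eq: "i < p \<Longrightarrow> cluster_aux X p i = cluster X i"
  by (induction p) (auto simp: cluster_def less_Suc_eq)

lemma cluster_eq:
  "cluster X p w = real_of_ereal (INF j. limsup (\<lambda>N.
     if \<forall>i<p. \<bar>X N i w - cluster X i w\<bar> < 1 / real (Suc j) then ereal (X N p w) else - \<infinity>))"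
  by (simp add: cluster_def[of X p] cluster_aux_eq cong: conj_cong imp_cong del: of_nat_Suc)

lemma measurable_cluster:
  assumes [measurable]: "\<And>N p. X N p \<in> borel_measurable M"
  shows "cluster X p \<in> borel_measurable M"
proof (induction p rule: less_induct)
  case (less p)
  have near: "{w \<in> space M. \<forall>i<p. \<bar>X N i w - cluster X i w\<bar> < 1 / real (Suc j)} \<in> sets M" for N j
  proof (rule sets.sets_Collect_countable_All)
    fix i
    show "{w \<in> space M. i < p \<longrightarrow> \<bar>X N i w - cluster X i w\<bar> < 1 / real (Suc j)} \<in> sets M"
    proof (cases "i < p")
      case True
      note [measurable] = less[OF True]
      have "{w \<in> space M. \<bar>X N i w - cluster X i w\<bar> < 1 / real (Suc j)} \<in> sets M"
        by measurable
      then show ?thesis using True by simp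
    qed simp
  qed
  have "(\<lambda>w. limsup (\<lambda>N. if \<forall>i<p. \<bar>X N i w - cluster X i w\<bar> < 1 / real (Suc j)
      then ereal (X N p w) else - \<infinity>)) \<in> borel_measurable M" for j
    by (rule borel_measurable_limsup, rule measurable_If[OF _ _ near])
       (simp_all add: borel_measurable_ereal)
  then have "(\<lambda>w. INF j. limsup (\<lambda>N. if \<forall>i<p. \<bar>X N i w - cluster X i w\<bar> < 1 / real (Suc j)
      then ereal (X N p w) else - \<infinity>)) \<in> borel_measurable M"
    by (rule borel_measurable_INF[OF countableI_type])
  then have "(\<lambda>w. real_of_ereal (INF j. limsup (\<lambda>N. if \<forall>i<p. \<bar>X N i w - cluster X i w\<bar> < 1 / real (Suc j)
      then ereal (X N p w) else - \<infinity>))) \<in> borel_measurable M"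
    by (rule borel_measurable_real_of_ereal)
  moreover have "cluster X p = (\<lambda>w. real_of_ereal (INF j. limsup (\<lambda>N. if \<forall>i<p. \<bar>X N i w - cluster X i w\<bar> < 1 / real (Suc j)
      then ereal (X N p w) else - \<infinity>)))"
    by (rule ext) (rule cluster_eq)
  ultimately show ?case by (simp only:)
qed

text \<open>By induction infinitely many indices have all earlier coordinates near their targets, so
  the limit superior over them is finite; its definition gives infinitely many among these whose
  next coordinate is close too.\<close>

lemma cluster_frequently:
  assumes bdd: "\<And>p. bounded (range (\<lambda>N. X N p w))"
  shows "\<exists>\<^sub>F N in sequentially. \<forall>i<p. \<bar>X N i w - cluster X i w\<bar> < 1 / real (Suc j)"
proof (induction p arbitrary: j)
  case 0
  then show ?case by simp
next
  case (Suc p)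
  let ?near = "\<lambda>j N. \<forall>i<p. \<bar>X N i w - cluster X i w\<bar> < 1 / real (Suc j)"
  let ?v = "\<lambda>j N. if ?near j N then ereal (X N p w) else - \<infinity>"
  let ?L = "\<lambda>j. limsup (?v j)"
  obtain B where B: "\<And>N. \<bar>X N p w\<bar> \<le> B"
    using bdd[of p] unfolding bounded_iff by auto
  \<comment> \<open>Otherwise admissible indices would eventually cease to occur, against the
    induction hypothesis; this excludes the default value \<open>- \<infinity>\<close>.\<close>
  have ge: "ereal (- B) \<le> ?L j" for j
  proof (rule ccontr)
    assume "\<not> ?thesis"
    then have "\<forall>\<^sub>F N in sequentially. ?v j N < ereal (- B)"
      by (intro Limsup_lessD) simp
    then have "\<forall>\<^sub>F N in sequentially. \<not> ?near j N"
    proof eventually_elim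
      case (elim N)
      show ?case
      proof
        assume "?near j N"
        then have "X N p w < - B" using elim by simp
        then show False using B[of N] by linarith
      qed
    qed
    then show False using Suc.IH[of j] by (simp add: frequently_def)
  qed
  have le: "?L j \<le> ereal B" for j
  proof (rule Limsup_bounded)
    show "\<forall>\<^sub>F N in sequentially. ?v j N \<le> ereal B"
      using B by (intro always_eventually) (auto simp: abs_le_iff)
  qed
  define y where "y = (INF j. ?L j)"
  have "ereal (- B) \<le> y" "y \<le> ereal B"
    using ge le unfolding y_def by (auto intro: INF_greatest INF_lower2)
  then have y: "y = ereal (cluster X p w)"
    unfolding cluster_eq[of X p w] y_def[symmetric] by (cases y) auto
  define e where "e = 1 / real (Suc j)"
  have e: "e > 0" by (simp add: e_def)
  have "y < ereal (cluster X p w + e)" using e y by simp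
  then obtain j1 where j1: "?L j1 < ereal (cluster X p w + e)"
    unfolding y_def by (auto simp: INF_less_iff)
  \<comment> \<open>Large enough both for the tolerance asked for and for the limit superior to fall
    below the infimum plus \<open>e\<close>.\<close>
  define j' where "j' = max j j1"
  have mono: "?near j' N \<Longrightarrow> ?near i N" if "i \<le> j'" for i N
  proof -
    have "1 / real (Suc j') \<le> 1 / real (Suc i)" using that by (intro divide_left_mono) auto
    then show "?near j' N \<Longrightarrow> ?near i N" by (meson less_le_trans)
  qed
  have "?L j' \<le> ?L j1"
    using mono[of j1] by (intro Limsup_mono always_eventually) (auto simp: j'_def)
  then have "?L j' < ereal (cluster X p w + e)" using j1 by simp
  then have up: "\<forall>\<^sub>F N in sequentially. ?v j' N < ereal (cluster X p w + e)"
    by (rule Limsup_lessD)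
  have low: "\<exists>\<^sub>F N in sequentially. ereal (cluster X p w - e) < ?v j' N"
  proof (rule ccontr)
    assume "\<not> ?thesis"
    then have "\<forall>\<^sub>F N in sequentially. ?v j' N \<le> ereal (cluster X p w - e)"
      by (simp add: frequently_def not_less)
    then have 1: "?L j' \<le> ereal (cluster X p w - e)" by (rule Limsup_bounded)
    have 2: "y \<le> ?L j'" unfolding y_def by (rule INF_lower) simp
    have "ereal (cluster X p w) \<le> ereal (cluster X p w - e)" using order_trans[OF 2 1] by (simp only: y)
    then show False using e by simp
  qed
  have "\<exists>\<^sub>F N in sequentially. ereal (cluster X p w - e) < ?v j' N \<and> ?v j' N < ereal (cluster X p w + e)"
    using frequently_eventually_frequently[OF low up] .
  then show ?case
  proof (rule frequently_elim1)
    fix N assume N: "ereal (cluster X p w - e) < ?v j' N \<and> ?v j' N < ereal (cluster X p w + e)"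
    have nr: "?near j' N"
    proof (rule ccontr)
      assume "\<not> ?near j' N"
      then show False using N by (simp split: if_splits)
    qed
    then have "cluster X p w - e < X N p w" "X N p w < cluster X p w + e" using N by auto
    then have "\<bar>X N p w - cluster X p w\<bar> < e" by linarith
    then show "\<forall>i<Suc p. \<bar>X N i w - cluster X i w\<bar> < 1 / real (Suc j)"
      using mono[of j N] nr unfolding e_def less_Suc_eq by (auto simp: j'_def)
  qed
qed

text \<open>A diagonal choice: the n-th index brings the first n coordinates within 1/(n + 1). The
  subsequence varies with \<open>w\<close>, whereas its limits are given by the fixed functions
  \<open>cluster X p\<close>.\<close>

theorem cluster_subsequence:
  assumes bdd: "\<And>p. bounded (range (\<lambda>N. X N p w))"
  obtains r :: "nat \<Rightarrow> nat" where "strict_mono r" "\<And>p. (\<lambda>n. X (r n) p w) \<longlonglongrightarrow> cluster X p w"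
proof -
  have ex: "\<exists>N>m. \<forall>i<n. \<bar>X N i w - cluster X i w\<bar> < 1 / real (Suc n)" for m n
  proof -
    have "\<exists>\<^sub>F N in sequentially. \<forall>i<n. \<bar>X N i w - cluster X i w\<bar> < 1 / real (Suc n)"
      by (rule cluster_frequently) (rule bdd)
    then obtain N where "N \<ge> Suc m" "\<forall>i<n. \<bar>X N i w - cluster X i w\<bar> < 1 / real (Suc n)"
      unfolding frequently_sequentially by blast
    then show ?thesis by (intro exI[of _ N]) simp
  qed
  have "\<exists>r. \<forall>n. (\<forall>i<n. \<bar>X (r n) i w - cluster X i w\<bar> < 1 / real (Suc n)) \<and> r n < r (Suc n)"
  proof (rule dependent_nat_choice)
    show "\<exists>x. \<forall>i<0. \<bar>X x i w - cluster X i w\<bar> < 1 / real (Suc 0)" by simp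
    show "\<exists>y. (\<forall>i<Suc n. \<bar>X y i w - cluster X i w\<bar> < 1 / real (Suc (Suc n))) \<and> x < y" for x n
      using ex[of x "Suc n"] by auto
  qed
  then obtain r where r: "\<And>n i. i < n \<Longrightarrow> \<bar>X (r n) i w - cluster X i w\<bar> < 1 / real (Suc n)" "\<And>n. r n < r (Suc n)"
    by blast
  have "strict_mono r" using r(2) by (simp add: strict_mono_Suc_iff)
  moreover have "(\<lambda>n. X (r n) p w) \<longlonglongrightarrow> cluster X p w" for p
  proof -
    have "(\<lambda>n. X (r n) p w - cluster X p w) \<longlonglongrightarrow> 0"
    proof (rule Lim_null_comparison)
      show "\<forall>\<^sub>F n in sequentially. norm (X (r n) p w - cluster X p w) \<le> 1 / real (Suc n)"
        using eventually_gt_at_top[of p] by eventually_elim (simp add: r(1) less_imp_le del: of_nat_Suc)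
      show "(\<lambda>n. 1 / real (Suc n)) \<longlonglongrightarrow> 0"
        using LIMSEQ_inverse_real_of_nat by (simp add: inverse_eq_divide)
    qed
    then show ?thesis by (simp add: LIM_zero_iff)
  qed
  ultimately show ?thesis using that by blast
qed

section \<open>Passage to the limit\<close>

text \<open>The enumeration of modes is arbitrary, not ordered by frequency; but only finitely many
  lattice points lie below a given level.\<close>

lemma lam_large: "\<exists>M. \<forall>k\<ge>M. \<Lambda> \<le> lam k"
proof -
  define R where "R = \<lceil>\<Lambda>\<rceil>"
  have "{n. lam n < \<Lambda>} \<subseteq> mode -` (insert None (Some ` ({-R..R} \<times> {-R..R})))"
  proof
    fix n assume "n \<in> {n. lam n < \<Lambda>}"
    then have n: "lam n < \<Lambda>" by simp
    show "n \<in> mode -` (insert None (Some ` ({-R..R} \<times> {-R..R})))"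
    proof (cases "mode n")
      case (Some k)
      obtain a b where k: "k = (a, b)" by fastforce
      have sq: "\<bar>m\<bar> \<le> m\<^sup>2" for m :: int
      proof (cases "m = 0")
        case False
        then have "\<bar>m\<bar> * 1 \<le> \<bar>m\<bar> * \<bar>m\<bar>" by (intro mult_left_mono) auto
        then show ?thesis by (simp add: power2_eq_square)
      qed simp
      have l: "lam n = 4 * pi\<^sup>2 * ((real_of_int a)\<^sup>2 + (real_of_int b)\<^sup>2)"
        by (simp add: lam_def Some k norm_prod_def)
      have "1 * ((real_of_int a)\<^sup>2 + (real_of_int b)\<^sup>2) \<le> lam n"
        unfolding l
      proof (rule mult_right_mono)
        have "1 \<le> pi\<^sup>2" using pi_gt3 by (simp add: one_le_power)
        then show "1 \<le> 4 * pi\<^sup>2" by simp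
      qed simp
      then have "real_of_int (a\<^sup>2 + b\<^sup>2) < \<Lambda>" using n by simp
      then have "a\<^sup>2 + b\<^sup>2 \<le> R" unfolding R_def by linarith
      moreover have "0 \<le> a\<^sup>2" "0 \<le> b\<^sup>2" by simp_all
      ultimately have "\<bar>a\<bar> \<le> R" "\<bar>b\<bar> \<le> R" using sq[of a] sq[of b] by linarith+
      then have "(a, b) \<in> {-R..R} \<times> {-R..R}" by (auto simp: abs_le_iff)
      then show ?thesis by (simp add: Some k)
    qed simp
  qed
  then have "finite {n. lam n < \<Lambda>}"
    by (rule finite_subset) (use bij_mode in \<open>auto intro!: finite_vimageI simp: bij_def\<close>)
  then obtain M where "\<And>n. n \<in> {n. lam n < \<Lambda>} \<Longrightarrow> n < M"
    using finite_nat_set_iff_bounded by auto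
  then show ?thesis by (intro exI[of _ M]) (metis linorder_not_less mem_Collect_eq)
qed

text \<open>Finitely many coordinates converge one by one, and the enstrophy bound makes the
  remaining tail at most \<open>4 * Z / \<Lambda>\<close> uniformly in n.\<close>

lemma Rellich_strong_convergence:
  assumes v: "\<And>n. v n \<in> Hset" "\<And>n M. (\<Sum>k<M. lam k * (coef k (v n))\<^sup>2) \<le> Z"
    and u: "u \<in> Hset" "\<And>M. (\<Sum>k<M. lam k * (coef k u)\<^sup>2) \<le> Z"
    and lim: "\<And>k. (\<lambda>n. coef k (v n)) \<longlonglongrightarrow> coef k u"
  shows "(\<lambda>n. L2norm (\<lambda>x. v n x - u x)) \<longlonglongrightarrow> 0"
proof -
  define d where "d n k = coef k (v n) - coef k u" for n k
  have Z: "0 \<le> Z" using u(2)[of 0] by simp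
  have tail: "(L2norm (\<lambda>x. v n x - u x))\<^sup>2 \<le> (\<Sum>k<M. (d n k)\<^sup>2) + 4 * Z / \<Lambda>"
    if \<Lambda>: "\<Lambda> > 0" "\<And>k. k \<ge> M \<Longrightarrow> \<Lambda> \<le> lam k" for n M \<Lambda>
  proof -
    have s: "(\<lambda>k. (d n k)\<^sup>2) sums (L2norm (\<lambda>x. v n x - u x))\<^sup>2"
      using Parseval_norm[OF Hset_diff[OF v(1) u(1)], of n] v(1) u(1)
      by (simp add: coef_diff Hset_L2 d_def)
    have bound: "(\<Sum>k<M'. (d n k)\<^sup>2) \<le> (\<Sum>k<M. (d n k)\<^sup>2) + 4 * Z / \<Lambda>" for M'
    proof -
      have "(\<Sum>k<M'. (d n k)\<^sup>2) \<le> (\<Sum>k<M'. (if k < M then (d n k)\<^sup>2 else 0) + lam k * (d n k)\<^sup>2 / \<Lambda>)"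
      proof (rule sum_mono)
        fix k
        show "(d n k)\<^sup>2 \<le> (if k < M then (d n k)\<^sup>2 else 0) + lam k * (d n k)\<^sup>2 / \<Lambda>"
          using \<Lambda>(1) mult_right_mono[OF \<Lambda>(2)[of k], of "(d n k)\<^sup>2"] by (auto simp: field_simps)
      qed
      also have "\<dots> = (\<Sum>k<M'. if k < M then (d n k)\<^sup>2 else 0) + (\<Sum>k<M'. lam k * (d n k)\<^sup>2) / \<Lambda>"
        by (simp add: sum.distrib sum_divide_distrib)
      also have "(\<Sum>k<M'. if k < M then (d n k)\<^sup>2 else 0) \<le> (\<Sum>k<M. (d n k)\<^sup>2)"
      proof -
        have "(\<Sum>k<M'. if k < M then (d n k)\<^sup>2 else 0) = (\<Sum>k\<in>{..<M'} \<inter> {..<M}. (d n k)\<^sup>2)"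
          by (subst sum.inter_restrict) auto
        also have "\<dots> \<le> (\<Sum>k<M. (d n k)\<^sup>2)" by (rule sum_mono2) auto
        finally show ?thesis .
      qed
      also have "(\<Sum>k<M'. lam k * (d n k)\<^sup>2) \<le> 4 * Z"
      proof -
        have "(\<Sum>k<M'. lam k * (d n k)\<^sup>2) \<le> (\<Sum>k<M'. 2 * (lam k * (coef k (v n))\<^sup>2) + 2 * (lam k * (coef k u)\<^sup>2))"
        proof (rule sum_mono)
          fix k
          have "(d n k)\<^sup>2 \<le> 2 * (coef k (v n))\<^sup>2 + 2 * (coef k u)\<^sup>2"
            using zero_le_power2[of "coef k (v n) + coef k u"] by (simp add: d_def power2_sum power2_diff)
          from mult_left_mono[OF this lam_nonneg[of k]]
          show "lam k * (d n k)\<^sup>2 \<le> 2 * (lam k * (coef k (v n))\<^sup>2) + 2 * (lam k * (coef k u)\<^sup>2)"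
            by (simp add: algebra_simps)
        qed
        also have "\<dots> = 2 * (\<Sum>k<M'. lam k * (coef k (v n))\<^sup>2) + 2 * (\<Sum>k<M'. lam k * (coef k u)\<^sup>2)"
          by (simp add: sum.distrib sum_distrib_left)
        also have "\<dots> \<le> 4 * Z" using v(2)[of n M'] u(2)[of M'] by linarith
        finally show ?thesis .
      qed
      finally show ?thesis using \<Lambda>(1) by (simp add: divide_right_mono)
    qed
    show ?thesis
      using s bound unfolding sums_def by (intro LIMSEQ_le_const2) auto
  qed
  have "(\<lambda>n. (L2norm (\<lambda>x. v n x - u x))\<^sup>2) \<longlonglongrightarrow> 0"
  proof (rule LIMSEQ_I)
    fix e :: real assume e: "e > 0"
    \<comment> \<open>Chosen for \<open>4 * Z / \<Lambda> < e / 2\<close>; adding 1 to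
      \<open>Z\<close> keeps it positive.\<close>
    define \<Lambda> where "\<Lambda> = 8 * (Z + 1) / e"
    have \<Lambda>: "\<Lambda> > 0" using e Z by (simp add: \<Lambda>_def)
    obtain M where M: "\<And>k. k \<ge> M \<Longrightarrow> \<Lambda> \<le> lam k" using lam_large by blast
    have z: "4 * Z / \<Lambda> < e / 2" using e Z \<Lambda> by (simp add: \<Lambda>_def field_simps)
    have "(\<lambda>n. \<Sum>k<M. (d n k)\<^sup>2) \<longlonglongrightarrow> (\<Sum>k<M. (coef k u - coef k u)\<^sup>2)"
      unfolding d_def by (intro tendsto_intros lim)
    then have "(\<lambda>n. \<Sum>k<M. (d n k)\<^sup>2) \<longlonglongrightarrow> 0" by simp
    from order_tendstoD(2)[OF this, of "e / 2"] e
    obtain N where N: "\<And>n. n \<ge> N \<Longrightarrow> (\<Sum>k<M. (d n k)\<^sup>2) < e / 2"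
      by (auto simp: eventually_sequentially)
    show "\<exists>no. \<forall>n\<ge>no. norm ((L2norm (\<lambda>x. v n x - u x))\<^sup>2 - 0) < e"
    proof (intro exI allI impI)
      fix n assume "n \<ge> N"
      then show "norm ((L2norm (\<lambda>x. v n x - u x))\<^sup>2 - 0) < e"
        using tail[where M=M and n=n, OF \<Lambda> M] N[of n] z by simp
    qed
  qed
  then have "(\<lambda>n. sqrt ((L2norm (\<lambda>x. v n x - u x))\<^sup>2)) \<longlonglongrightarrow> sqrt 0"
    by (intro tendsto_real_sqrt)
  then show ?thesis by simp
qed

text \<open>Tested with the mode \<open>ee j\<close>, the weak Euler equations say that the
  coefficient has derivative \<open>bb j\<close>; the pressure drops out against divergence-free
  fields. The derivative is taken within \<open>{0..T}\<close>, hence one-sided at the ends.\<close>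

definition euler_path :: "real \<Rightarrow> (real \<Rightarrow> nat \<Rightarrow> real) \<Rightarrow> (nat \<Rightarrow> real) \<Rightarrow> bool" where
  "euler_path T a c \<longleftrightarrow> (\<forall>j. a 0 j = c j) \<and>
     (\<forall>t\<in>{0..T}. \<forall>M. (\<Sum>k<M. (a t k)\<^sup>2) \<le> (\<Sum>k. (c k)\<^sup>2) \<and>
        (\<Sum>k<M. lam k * (a t k)\<^sup>2) \<le> (\<Sum>k. lam k * (c k)\<^sup>2)) \<and>
     (\<forall>t\<in>{0..T}. \<forall>j. ((\<lambda>s. a s j) has_real_derivative bb j (synth (a t))) (at t within {0..T}))"

lemma has_real_derivative_withinI:
  assumes "\<And>e. e > 0 \<Longrightarrow> \<exists>\<delta>>0. \<forall>s\<in>S. \<bar>s - t\<bar> \<le> \<delta> \<longrightarrow> \<bar>f s - f t - (s - t) * D\<bar> \<le> e * \<bar>s - t\<bar>"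
  shows "(f has_real_derivative D) (at t within S)"
  unfolding has_field_derivative_def has_derivative_within_alt
proof (intro conjI allI impI)
  show "bounded_linear ((*) D)" by (rule bounded_linear_mult_right)
  fix e :: real assume "e > 0"
  then obtain \<delta> where "\<delta> > 0" "\<And>s. s \<in> S \<Longrightarrow> \<bar>s - t\<bar> \<le> \<delta> \<Longrightarrow> \<bar>f s - f t - (s - t) * D\<bar> \<le> e * \<bar>s - t\<bar>"
    using assms by blast
  then show "\<exists>d>0. \<forall>y\<in>S. norm (y - t) < d \<longrightarrow> norm (f y - f t - D * (y - t)) \<le> e * norm (y - t)"
    by (intro exI[of _ \<delta>]) (simp add: mult.commute)
qed

section \<open>Convergence of the scheme for one fixed datum\<close>

context
  fixes T E Z :: real and c :: "nat \<Rightarrow> real" and r :: "nat \<Rightarrow> nat"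
  assumes T: "T > 0" and E: "\<And>N. (\<Sum>k<N. (c k)\<^sup>2) \<le> E" and Z: "\<And>N. (\<Sum>k<N. lam k * (c k)\<^sup>2) \<le> Z"
    and r: "strict_mono r"
begin

lemma eventually_r: "\<forall>\<^sub>F n in sequentially. T * (E + 1)\<^sup>2 \<le> real (Suc (r n)) \<and> j < r n"
proof -
  obtain N where N: "T * (E + 1)\<^sup>2 \<le> real N" using real_arch_simple by blast
  show ?thesis
    using eventually_ge_at_top[of "max N (Suc j)"]
  proof eventually_elim
    case (elim n)
    then have "N \<le> r n" "j < r n" using seq_suble[OF r, of n] by linarith+
    moreover from this have "real N \<le> real (Suc (r n))" by simp
    ultimately show ?case using N by linarith
  qed
qed

lemma gpath_energy:
  assumes n: "T * (E + 1)\<^sup>2 \<le> real (Suc n)" and t: "t \<in> {0..T}"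
  shows "(\<Sum>k<M. (gpath n c t k)\<^sup>2) \<le> E + T * (E + 1)\<^sup>2 / real (Suc n)"
    and "(\<Sum>k<M. lam k * (gpath n c t k)\<^sup>2) \<le> Z + T * (E + 1)\<^sup>2 / real (Suc n)"
proof -
  have *: "(\<Sum>k<M. w k * (gpath n c t k)\<^sup>2) \<le> (\<Sum>k<n. w k * (gpath n c t k)\<^sup>2)" if "\<And>k. 0 \<le> w k" for w
  proof -
    have "(\<Sum>k<M. w k * (gpath n c t k)\<^sup>2) = (\<Sum>k\<in>{..<M} \<inter> {..<n}. w k * (gpath n c t k)\<^sup>2)"
      by (rule sum.mono_neutral_right) (auto simp: gpath_beyond not_less[symmetric])
    also have "\<dots> \<le> (\<Sum>k<n. w k * (gpath n c t k)\<^sup>2)"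
      using that by (intro sum_mono2) auto
    finally show ?thesis .
  qed
  show "(\<Sum>k<M. (gpath n c t k)\<^sup>2) \<le> E + T * (E + 1)\<^sup>2 / real (Suc n)"
    using *[of "\<lambda>_. 1"] gpath_bound(1)[OF E Z n, of t] t by simp
  show "(\<Sum>k<M. lam k * (gpath n c t k)\<^sup>2) \<le> Z + T * (E + 1)\<^sup>2 / real (Suc n)"
    using *[of lam] gpath_bound(2)[OF E Z n, of t] t by simp
qed

lemma gpath_L2norm:
  assumes n: "T * (E + 1)\<^sup>2 \<le> real (Suc n)" and t: "t \<in> {0..T}"
  shows "(L2norm (psum n (gpath n c t)))\<^sup>2 \<le> E + 1"
proof -
  have "T * (E + 1)\<^sup>2 / real (Suc n) \<le> 1" using n by (simp add: divide_le_eq)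
  then show ?thesis using gpath_energy(1)[OF n t, of n] unfolding L2norm_psum by linarith
qed

text \<open>The energy bound controls the rate of change. The paths are step functions, so the
  estimate carries an extra \<open>hh n\<close>, which disappears in the limit.\<close>

lemma gpath_Lipschitz:
  assumes n: "T * (E + 1)\<^sup>2 \<le> real (Suc n)" "j < n" and s: "s1 \<in> {0..T}" "s2 \<in> {0..T}"
  shows "\<bar>gpath n c s2 j - gpath n c s1 j\<bar> \<le> (\<bar>s2 - s1\<bar> + hh n) * (kappa j * (E + 1))"
proof -
  have b: "\<bar>bb j (psum n (gpath n c s)) - 0\<bar> \<le> kappa j * (E + 1)" if "s \<in> {0..T}" for s
    using order_trans[OF abs_bb_le[OF psum_L2] mult_left_mono[OF gpath_L2norm[OF n(1) that] kappa_nonneg]]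
    by simp
  have le: "\<bar>gpath n c s2 j - gpath n c s1 j\<bar> \<le> (\<bar>s2 - s1\<bar> + hh n) * (kappa j * (E + 1))"
    if s: "s1 \<in> {0..T}" "s2 \<in> {0..T}" "s1 \<le> s2" for s1 s2
    using gpath_increment[OF _ s(3) n(2) b] s by simp
  show ?thesis
  proof (cases "s1 \<le> s2")
    case True
    then show ?thesis using le s by blast
  next
    case False
    then show ?thesis using le[OF s(2) s(1)] by (simp add: abs_minus_commute)
  qed
qed

lemma hh_r_tendsto: "(\<lambda>n. hh (r n)) \<longlonglongrightarrow> 0"
  using LIMSEQ_subseq_LIMSEQ[OF hh_tendsto r] by (simp add: o_def)

text \<open>Arzela-Ascoli by hand: convergence at grid times and equicontinuity make the values at
  \<open>t\<close> a Cauchy sequence. Writing the limit as a limit of grid values \<open>y\<close>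
  makes it measurable in the datum once the grid values are.\<close>

lemma gpath_converges:
  assumes grid: "\<And>i m. (\<lambda>n. gpath (r n) c (min (real m / real (Suc i)) T) j) \<longlonglongrightarrow> y i m"
    and t: "t \<in> {0..T}"
  shows "(\<lambda>n. gpath (r n) c t j) \<longlonglongrightarrow> lim (\<lambda>i. y i (nat \<lfloor>t * real (Suc i)\<rfloor>))"
proof -
  define K where "K = kappa j * (E + 1)"
  have E0: "0 \<le> E" using E[of 0] by simp
  then have K0: "0 \<le> K" by (simp add: K_def)
  define q where "q i = min (real (nat \<lfloor>t * real (Suc i)\<rfloor>) / real (Suc i)) T" for i
  have q: "q i \<in> {0..T}" "\<bar>t - q i\<bar> \<le> 1 / real (Suc i)" for i
  proof -
    let ?m = "real (nat \<lfloor>t * real (Suc i)\<rfloor>)"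
    have "0 \<le> t * real (Suc i)" using t by simp
    then have m: "?m \<le> t * real (Suc i)" "t * real (Suc i) < ?m + 1"
      by (simp_all add: of_nat_nat del: of_nat_Suc)
    then have "?m / real (Suc i) \<le> t" "t < ?m / real (Suc i) + 1 / real (Suc i)"
      by (simp_all add: divide_le_eq less_divide_eq add_divide_distrib[symmetric] del: of_nat_Suc)
    moreover from this have "?m / real (Suc i) \<le> T" using t by simp
    ultimately show "q i \<in> {0..T}" "\<bar>t - q i\<bar> \<le> 1 / real (Suc i)"
      using T by (auto simp: q_def min_def simp del: of_nat_Suc)
  qed
  define z where "z i = y i (nat \<lfloor>t * real (Suc i)\<rfloor>)" for i
  have z: "(\<lambda>n. gpath (r n) c (q i) j) \<longlonglongrightarrow> z i" for i
    using grid unfolding q_def z_def by blast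
  have ev: "\<forall>\<^sub>F n in sequentially. \<bar>gpath (r n) c t j - gpath (r n) c (q i) j\<bar> \<le> (1 / real (Suc i) + hh (r n)) * K" for i
    using eventually_r[of j]
  proof eventually_elim
    case (elim n)
    have "\<bar>gpath (r n) c t j - gpath (r n) c (q i) j\<bar> \<le> (\<bar>t - q i\<bar> + hh (r n)) * K"
      unfolding K_def by (rule gpath_Lipschitz) (use elim q t in auto)
    also have "\<dots> \<le> (1 / real (Suc i) + hh (r n)) * K"
      using q K0 by (intro mult_right_mono add_right_mono) auto
    finally show ?case .
  qed
  have lim_i: "(\<lambda>i. 1 / real (Suc i)) \<longlonglongrightarrow> 0"
    using LIMSEQ_inverse_real_of_nat by (simp add: inverse_eq_divide)
  have "Cauchy (\<lambda>n. gpath (r n) c t j)"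
  proof (rule metric_CauchyI)
    fix e :: real assume e: "e > 0"
    have "\<forall>\<^sub>F i in sequentially. 1 / real (Suc i) * (K + 1) < e / 8"
    proof (rule order_tendstoD(2))
      show "(\<lambda>i. 1 / real (Suc i) * (K + 1)) \<longlonglongrightarrow> 0"
        using tendsto_mult_left_zero[OF lim_i] .
    qed (use e in simp)
    then obtain i where i: "1 / real (Suc i) * (K + 1) < e / 8"
      unfolding eventually_sequentially by blast
    have "1 / real (Suc i) * K \<le> 1 / real (Suc i) * (K + 1)" by (intro mult_left_mono) auto
    then have i': "1 / real (Suc i) * K < e / 8" using i by linarith
    have h: "\<forall>\<^sub>F n in sequentially. hh (r n) * K < e / 8"
      by (rule order_tendstoD(2)[OF tendsto_mult_left_zero[OF hh_r_tendsto]]) (use e in simp)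
    have "\<forall>\<^sub>F n in sequentially. \<bar>gpath (r n) c (q i) j - z i\<bar> < e / 8"
      using tendstoD[OF z, of "e / 8" i] e by (simp add: dist_real_def)
    with ev[of i] h have "\<forall>\<^sub>F n in sequentially. \<bar>gpath (r n) c t j - z i\<bar> < e / 2"
    proof eventually_elim
      case (elim n)
      have "(1 / real (Suc i) + hh (r n)) * K < e / 4"
        using i' elim(2) unfolding distrib_right by linarith
      then show ?case using elim e by linarith
    qed
    then obtain N where N: "\<And>n. n \<ge> N \<Longrightarrow> \<bar>gpath (r n) c t j - z i\<bar> < e / 2"
      by (auto simp: eventually_sequentially)
    have "dist (gpath (r m) c t j) (gpath (r n) c t j) < e" if "m \<ge> N" "n \<ge> N" for m n
      using N[OF that(1)] N[OF that(2)] unfolding dist_real_def by linarith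
    then show "\<exists>M. \<forall>m\<ge>M. \<forall>n\<ge>M. dist (gpath (r m) c t j) (gpath (r n) c t j) < e" by blast
  qed
  then obtain a where a: "(\<lambda>n. gpath (r n) c t j) \<longlonglongrightarrow> a"
    using Cauchy_convergent convergent_def by blast
  have "z \<longlonglongrightarrow> a"
  proof -
    have "\<bar>a - z i\<bar> \<le> 1 / real (Suc i) * K" for i
    proof (rule tendsto_le[OF _ _ _ ev])
      show "(\<lambda>n. (1 / real (Suc i) + hh (r n)) * K) \<longlonglongrightarrow> 1 / real (Suc i) * K"
        using tendsto_mult_right[OF tendsto_add[OF tendsto_const hh_r_tendsto], of "1 / real (Suc i)" K] by simp
      show "(\<lambda>n. \<bar>gpath (r n) c t j - gpath (r n) c (q i) j\<bar>) \<longlonglongrightarrow> \<bar>a - z i\<bar>"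
        by (intro tendsto_intros a z)
    qed simp
    then have "(\<lambda>i. z i - a) \<longlonglongrightarrow> 0"
      by (intro Lim_null_comparison[OF _ tendsto_mult_left_zero[OF lim_i, of K]])
         (auto simp: abs_minus_commute simp del: of_nat_Suc)
    then show ?thesis by (simp add: LIM_zero_iff)
  qed
  then have "lim z = a" by (rule limI)
  then show ?thesis using a by (simp add: z_def[abs_def] del: of_nat_Suc)
qed

context
  fixes a :: "real \<Rightarrow> nat \<Rightarrow> real"
  assumes a: "\<And>t j. t \<in> {0..T} \<Longrightarrow> (\<lambda>n. gpath (r n) c t j) \<longlonglongrightarrow> a t j"
begin

text \<open>The growth permitted to the scheme tends to zero along the subsequence, so the limit
  keeps the bounds of the datum without loss.\<close>

lemma limit_bounds:
  assumes t: "t \<in> {0..T}"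
  shows "(\<Sum>k<M. (a t k)\<^sup>2) \<le> E" "(\<Sum>k<M. lam k * (a t k)\<^sup>2) \<le> Z"
proof -
  have h: "(\<lambda>n. T * (E + 1)\<^sup>2 / real (Suc (r n))) \<longlonglongrightarrow> 0"
    using tendsto_mult_right_zero[OF LIMSEQ_subseq_LIMSEQ[OF LIMSEQ_inverse_real_of_nat r], of "T * (E + 1)\<^sup>2"]
    by (simp add: o_def divide_inverse del: of_nat_Suc)
  show "(\<Sum>k<M. (a t k)\<^sup>2) \<le> E"
  proof (rule tendsto_le)
    show "(\<lambda>n. E + T * (E + 1)\<^sup>2 / real (Suc (r n))) \<longlonglongrightarrow> E"
      using tendsto_add[OF tendsto_const h] by simp
    show "(\<lambda>n. \<Sum>k<M. (gpath (r n) c t k)\<^sup>2) \<longlonglongrightarrow> (\<Sum>k<M. (a t k)\<^sup>2)"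
      by (intro tendsto_intros a t)
    show "\<forall>\<^sub>F n in sequentially. (\<Sum>k<M. (gpath (r n) c t k)\<^sup>2) \<le> E + T * (E + 1)\<^sup>2 / real (Suc (r n))"
      using eventually_r by eventually_elim (rule gpath_energy, use t in auto)
  qed simp
  show "(\<Sum>k<M. lam k * (a t k)\<^sup>2) \<le> Z"
  proof (rule tendsto_le)
    show "(\<lambda>n. Z + T * (E + 1)\<^sup>2 / real (Suc (r n))) \<longlonglongrightarrow> Z"
      using tendsto_add[OF tendsto_const h] by simp
    show "(\<lambda>n. \<Sum>k<M. lam k * (gpath (r n) c t k)\<^sup>2) \<longlonglongrightarrow> (\<Sum>k<M. lam k * (a t k)\<^sup>2)"
      by (intro tendsto_intros a t)
    show "\<forall>\<^sub>F n in sequentially. (\<Sum>k<M. lam k * (gpath (r n) c t k)\<^sup>2) \<le> Z + T * (E + 1)\<^sup>2 / real (Suc (r n))"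
      using eventually_r by eventually_elim (rule gpath_energy, use t in auto)
  qed simp
qed

lemma limit_synth:
  assumes t: "t \<in> {0..T}"
  shows "synth (a t) \<in> Hset" "coef k (synth (a t)) = a t k"
proof -
  have "summable (\<lambda>k. (a t k)\<^sup>2)"
    by (rule summableI_nonneg_bounded[where x=E]) (use limit_bounds[OF t] in auto)
  then show "synth (a t) \<in> Hset" "coef k (synth (a t)) = a t k" by (rule synth)+
qed

lemma limit_initial: "a 0 j = c j"
proof -
  have "(\<lambda>n. gpath (r n) c 0 j) \<longlonglongrightarrow> c j"
    by (rule tendsto_eventually) (use eventually_r[of j] in \<open>auto elim!: eventually_mono simp: gpath_0\<close>)
  then show ?thesis using a[of 0 j] T LIMSEQ_unique by fastforce
qed

lemma coef_gpath: "coef k (psum n (gpath n c s)) = gpath n c s k"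
  by (simp add: coef_psum gpath_beyond)

text \<open>Compactness: if the nonlinearity along the scheme stayed \<open>e\<close> away from its
  value at the limit for times approaching \<open>t\<close>, equicontinuity and Rellich would give
  strong convergence to \<open>synth (a t)\<close> and contradict the continuity of
  \<open>bb\<close>. So it is nearly constant near \<open>t\<close>, uniformly in late indices, and
  \<open>gpath_increment\<close> controls the difference quotient.\<close>

lemma limit_derivative:
  assumes t: "t \<in> {0..T}"
  shows "((\<lambda>s. a s j) has_real_derivative bb j (synth (a t))) (at t within {0..T})"
proof (rule has_real_derivative_withinI)
  fix e :: real assume e: "e > 0"
  define \<beta> where "\<beta> = bb j (synth (a t))"
  define bad where "bad \<delta> n \<longleftrightarrow> (\<exists>s\<in>{0..T}. \<bar>s - t\<bar> \<le> \<delta> \<and> \<bar>bb j (psum (r n) (gpath (r n) c s)) - \<beta>\<bar> > e)" for \<delta> n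
  have "\<exists>m. \<forall>\<^sub>F n in sequentially. \<not> bad (1 / real (Suc m)) n"
  proof (rule ccontr)
    assume "\<nexists>m. \<forall>\<^sub>F n in sequentially. \<not> bad (1 / real (Suc m)) n"
    then have fr: "\<exists>\<^sub>F n in sequentially. bad (1 / real (Suc m)) n" for m
      by (simp add: frequently_def)
    \<comment> \<open>Shifting by \<open>N0\<close> makes the energy bounds hold for every
      \<open>\<nu> m\<close>, as the Rellich lemma demands, and not merely eventually.\<close>
    obtain N0 where N0: "\<And>n. n \<ge> N0 \<Longrightarrow> T * (E + 1)\<^sup>2 \<le> real (Suc (r n))"
      using eventually_r unfolding eventually_sequentially by blast
    have "\<exists>n\<ge>m + N0. bad (1 / real (Suc m)) n" for m
      using fr[of m] unfolding frequently_sequentially by blast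
    then obtain \<nu> where \<nu>: "\<And>m. \<nu> m \<ge> m + N0" "\<And>m. bad (1 / real (Suc m)) (\<nu> m)" by metis
    then obtain s where s: "\<And>m. s m \<in> {0..T}" "\<And>m. \<bar>s m - t\<bar> \<le> 1 / real (Suc m)"
      "\<And>m. \<bar>bb j (psum (r (\<nu> m)) (gpath (r (\<nu> m)) c (s m))) - \<beta>\<bar> > e"
      unfolding bad_def by metis
    define v where "v m = psum (r (\<nu> m)) (gpath (r (\<nu> m)) c (s m))" for m
    have \<nu>N: "T * (E + 1)\<^sup>2 \<le> real (Suc (r (\<nu> m)))" for m
      using N0[of "\<nu> m"] \<nu>(1)[of m] by linarith
    have \<nu>_top: "filterlim \<nu> at_top sequentially"
    proof (rule filterlim_at_top_mono[OF filterlim_ident], intro always_eventually allI)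
      show "m \<le> \<nu> m" for m using \<nu>(1)[of m] by linarith
    qed
    have "(\<lambda>m. L2norm (\<lambda>x. v m x - synth (a t) x)) \<longlonglongrightarrow> 0"
    proof (rule Rellich_strong_convergence)
      show "v m \<in> Hset" for m by (simp add: v_def)
      show "synth (a t) \<in> Hset" by (rule limit_synth[OF t])
      show "(\<Sum>k<M. lam k * (coef k (synth (a t)))\<^sup>2) \<le> Z + 1" for M
        using limit_bounds(2)[OF t, of M] by (simp add: limit_synth[OF t])
      show "(\<Sum>k<M. lam k * (coef k (v m))\<^sup>2) \<le> Z + 1" for m M
      proof -
        have "T * (E + 1)\<^sup>2 / real (Suc (r (\<nu> m))) \<le> 1" using \<nu>N[of m] by (simp add: divide_le_eq)
        then show ?thesis
          using gpath_energy(2)[OF \<nu>N[of m] s(1)[of m], of M] unfolding v_def coef_gpath by linarith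
      qed
      show "(\<lambda>m. coef k (v m)) \<longlonglongrightarrow> coef k (synth (a t))" for k
      proof -
        have 1: "(\<lambda>m. gpath (r (\<nu> m)) c t k) \<longlonglongrightarrow> a t k"
          using filterlim_compose[OF a[OF t] \<nu>_top] .
        have "(\<lambda>m. gpath (r (\<nu> m)) c (s m) k - gpath (r (\<nu> m)) c t k) \<longlonglongrightarrow> 0"
        proof (rule Lim_null_comparison)
          show "(\<lambda>m. (1 / real (Suc m) + hh (r (\<nu> m))) * (kappa k * (E + 1))) \<longlonglongrightarrow> 0"
          proof (rule tendsto_mult_left_zero)
            have "(\<lambda>m. 1 / real (Suc m)) \<longlonglongrightarrow> 0"
              using LIMSEQ_inverse_real_of_nat by (simp add: inverse_eq_divide)
            from tendsto_add[OF this filterlim_compose[OF hh_r_tendsto \<nu>_top]]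
            show "(\<lambda>m. 1 / real (Suc m) + hh (r (\<nu> m))) \<longlonglongrightarrow> 0" by simp
          qed
          have "\<forall>\<^sub>F m in sequentially. k < r (\<nu> m)"
            using filterlim_compose[OF filterlim_subseq[OF r] \<nu>_top] eventually_gt_at_top[of k]
            unfolding filterlim_iff by blast
          then show "\<forall>\<^sub>F m in sequentially. norm (gpath (r (\<nu> m)) c (s m) k - gpath (r (\<nu> m)) c t k)
              \<le> (1 / real (Suc m) + hh (r (\<nu> m))) * (kappa k * (E + 1))"
          proof eventually_elim
            case (elim m)
            have E0: "0 \<le> E" using E[of 0] by simp
            have "\<bar>gpath (r (\<nu> m)) c (s m) k - gpath (r (\<nu> m)) c t k\<bar> \<le> (\<bar>s m - t\<bar> + hh (r (\<nu> m))) * (kappa k * (E + 1))"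
              by (rule gpath_Lipschitz[OF \<nu>N elim t s(1)])
            also have "\<dots> \<le> (1 / real (Suc m) + hh (r (\<nu> m))) * (kappa k * (E + 1))"
              using s(2)[of m] E0 by (intro mult_right_mono add_right_mono) auto
            finally show ?case by simp
          qed
        qed
        from tendsto_add[OF this 1] show ?thesis
          unfolding v_def coef_gpath limit_synth(2)[OF t] by simp
      qed
    qed
    then have "(\<lambda>m. bb j (v m)) \<longlonglongrightarrow> \<beta>"
      using L2cont_bb[of j] limit_synth(1)[OF t] unfolding L2cont_def \<beta>_def v_def by simp
    then have "\<forall>\<^sub>F m in sequentially. dist (bb j (v m)) \<beta> < e" using e by (rule tendstoD)
    then obtain m where "\<bar>bb j (v m) - \<beta>\<bar> < e"
      unfolding eventually_sequentially dist_real_def by blast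
    then show False using s(3)[of m] by (simp add: v_def)
  qed
  then obtain m where good: "\<forall>\<^sub>F n in sequentially. \<not> bad (1 / real (Suc m)) n" by blast
  define \<delta> where "\<delta> = 1 / real (Suc m)"
  have inc: "\<bar>a s2 j - a s1 j - (s2 - s1) * \<beta>\<bar> \<le> (s2 - s1) * e"
    if s: "s1 \<in> {0..T}" "s2 \<in> {0..T}" "s1 \<le> s2" "\<bar>s1 - t\<bar> \<le> \<delta>" "\<bar>s2 - t\<bar> \<le> \<delta>" for s1 s2
  proof (rule tendsto_le)
    show "(\<lambda>n. \<bar>gpath (r n) c s2 j - gpath (r n) c s1 j - (s2 - s1) * \<beta>\<bar>) \<longlonglongrightarrow> \<bar>a s2 j - a s1 j - (s2 - s1) * \<beta>\<bar>"
      by (intro tendsto_intros a s)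
    have "(\<lambda>n. (s2 - s1 + hh (r n)) * e + hh (r n) * \<bar>\<beta>\<bar>) \<longlonglongrightarrow> (s2 - s1 + 0) * e + 0 * \<bar>\<beta>\<bar>"
      by (intro tendsto_intros hh_r_tendsto)
    then show "(\<lambda>n. (s2 - s1 + hh (r n)) * e + hh (r n) * \<bar>\<beta>\<bar>) \<longlonglongrightarrow> (s2 - s1) * e" by simp
    show "\<forall>\<^sub>F n in sequentially. \<bar>gpath (r n) c s2 j - gpath (r n) c s1 j - (s2 - s1) * \<beta>\<bar>
        \<le> (s2 - s1 + hh (r n)) * e + hh (r n) * \<bar>\<beta>\<bar>"
      using good eventually_r[of j]
    proof eventually_elim
      case (elim n)
      show ?case
      proof (rule gpath_increment)
        fix \<sigma> assume "s1 \<le> \<sigma>" "\<sigma> \<le> s2"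
        then have "\<sigma> \<in> {0..T}" "\<bar>\<sigma> - t\<bar> \<le> 1 / real (Suc m)"
          using s unfolding \<delta>_def by (auto simp: abs_le_iff simp del: of_nat_Suc)
        then show "\<bar>bb j (psum (r n) (gpath (r n) c \<sigma>)) - \<beta>\<bar> \<le> e"
          using elim(1) unfolding bad_def by (meson linorder_not_less)
      qed (use s elim in auto)
    qed
  qed simp
  show "\<exists>\<delta>>0. \<forall>s\<in>{0..T}. \<bar>s - t\<bar> \<le> \<delta> \<longrightarrow> \<bar>a s j - a t j - (s - t) * bb j (synth (a t))\<bar> \<le> e * \<bar>s - t\<bar>"
  proof (intro exI[of _ \<delta>] conjI ballI impI)
    show "\<delta> > 0" by (simp add: \<delta>_def)
    fix s assume s: "s \<in> {0..T}" "\<bar>s - t\<bar> \<le> \<delta>"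
    have d0: "\<bar>t - t\<bar> \<le> \<delta>" by (simp add: \<delta>_def)
    show "\<bar>a s j - a t j - (s - t) * bb j (synth (a t))\<bar> \<le> e * \<bar>s - t\<bar>"
    proof (cases "t \<le> s")
      case True
      then show ?thesis
        using inc[OF t s(1) True d0 s(2)] by (simp add: \<beta>_def mult.commute)
    next
      case False
      have "a s j - a t j - (s - t) * \<beta> = - (a t j - a s j - (t - s) * \<beta>)" by (simp add: algebra_simps)
      then have "\<bar>a s j - a t j - (s - t) * \<beta>\<bar> = \<bar>a t j - a s j - (t - s) * \<beta>\<bar>" by (simp only: abs_minus_cancel)
      then show ?thesis
        using inc[OF s(1) t _ s(2) d0] False by (simp add: \<beta>_def mult.commute abs_if)
    qed
  qed
qed

end

end

text \<open>The construction runs for every \<open>w\<close> alike, which makes it measurable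
  everywhere; for summable data the coordinates are bounded and the outcome is a solution. A
  coefficient index and the two parameters of a grid time are packed into one index \<open>p\<close>
  for the selection.\<close>

theorem measurable_euler_paths:
  assumes T: "T > 0" and c: "\<And>k. (\<lambda>w. c w k) \<in> borel_measurable M"
  obtains a :: "'a \<Rightarrow> real \<Rightarrow> nat \<Rightarrow> real"
  where "\<And>t k. (\<lambda>w. a w t k) \<in> borel_measurable M"
    and "\<And>w. summable (\<lambda>k. (c w k)\<^sup>2) \<Longrightarrow> summable (\<lambda>k. lam k * (c w k)\<^sup>2) \<Longrightarrow> euler_path T (a w) (c w)"
proof -
  define \<tau> where "\<tau> i m = min (real m / real (Suc i)) T" for i m :: nat
  define X where "X N p w = gpath N (c w) (\<tau> (fst (prod_decode (snd (prod_decode p)))) (snd (prod_decode (snd (prod_decode p)))))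
      (fst (prod_decode p))" for N p w
  have Xm: "X N p \<in> borel_measurable M" for N p
    unfolding X_def[abs_def] gpath_def by (rule measurable_galerkin[OF c])
  define y where "y w j i m = cluster X (prod_encode (j, prod_encode (i, m))) w" for w j i m
  define a where "a w t j = lim (\<lambda>i. y w j i (nat \<lfloor>t * real (Suc i)\<rfloor>))" for w t j
  show ?thesis
  proof (rule that)
    show "(\<lambda>w. a w t k) \<in> borel_measurable M" for t k
      unfolding a_def y_def by (intro borel_measurable_lim_metric measurable_cluster Xm)
    fix w assume s: "summable (\<lambda>k. (c w k)\<^sup>2)" "summable (\<lambda>k. lam k * (c w k)\<^sup>2)"
    define E Z where "E = (\<Sum>k. (c w k)\<^sup>2)" and "Z = (\<Sum>k. lam k * (c w k)\<^sup>2)"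
    have EZ: "(\<Sum>k<N. (c w k)\<^sup>2) \<le> E" "(\<Sum>k<N. lam k * (c w k)\<^sup>2) \<le> Z" for N
      unfolding E_def Z_def by (intro sum_le_suminf s; simp)+
    have bdd: "bounded (range (\<lambda>N. X N p w))" for p
    proof -
      let ?j = "fst (prod_decode p)"
      let ?t = "\<tau> (fst (prod_decode (snd (prod_decode p)))) (snd (prod_decode (snd (prod_decode p))))"
      have t: "?t \<in> {0..T}" using T by (simp add: \<tau>_def)
      have "\<forall>\<^sub>F N in sequentially. norm (X N p w) \<le> E + 1"
        using eventually_r[OF T EZ strict_mono_id, of ?j]
      proof eventually_elim
        case (elim N)
        then have n: "T * (E + 1)\<^sup>2 \<le> real (Suc N)" by simp
        have E0: "0 \<le> E" using EZ(1)[of 0] by simp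
        have "(X N p w)\<^sup>2 \<le> (\<Sum>k<Suc ?j. (gpath N (c w) ?t k)\<^sup>2)"
          unfolding X_def by (rule member_le_sum) auto
        also have "\<dots> \<le> E + T * (E + 1)\<^sup>2 / real (Suc N)"
          by (rule gpath_energy(1)[OF T EZ strict_mono_id n t])
        also have "\<dots> \<le> E + 1" using n by (simp add: divide_le_eq)
        also have "\<dots> \<le> (E + 1)\<^sup>2" using E0 by (simp add: power2_eq_square)
        finally show ?case using E0 by (simp add: abs_le_square_iff[symmetric])
      qed
      then have "Bseq (\<lambda>N. X N p w)" by (rule BfunI)
      then show ?thesis by (simp add: Bseq_eq_bounded)
    qed
    obtain r where r: "strict_mono r" "\<And>p. (\<lambda>n. X (r n) p w) \<longlonglongrightarrow> cluster X p w"
      using cluster_subsequence[where X=X and w=w, OF bdd] by blast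
    have grid: "(\<lambda>n. gpath (r n) (c w) (min (real m / real (Suc i)) T) j) \<longlonglongrightarrow> y w j i m" for i m j
      using r(2)[of "prod_encode (j, prod_encode (i, m))"] by (simp add: X_def y_def \<tau>_def del: of_nat_Suc)
    have lim: "(\<lambda>n. gpath (r n) (c w) t j) \<longlonglongrightarrow> a w t j" if "t \<in> {0..T}" for t j
      unfolding a_def by (rule gpath_converges[OF T EZ r(1) grid that])
    show "euler_path T (a w) (c w)"
      unfolding euler_path_def E_def[symmetric] Z_def[symmetric]
      using limit_initial[OF T EZ r(1) lim] limit_bounds[OF T EZ r(1) lim] limit_derivative[OF T EZ r(1) lim]
      by blast
  qed
qed

section \<open>Cylindrical test functions\<close>

lemma tendsto_fun:
  fixes f :: "'b \<Rightarrow> 'i \<Rightarrow> 'a::topological_space"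
  assumes "\<And>i. ((\<lambda>n. f n i) \<longlongrightarrow> l i) F"
  shows "(f \<longlongrightarrow> l) F"
proof -
  have "limitin (product_topology (\<lambda>i. euclidean) UNIV) f l F"
    using assms by (simp add: limitin_componentwise)
  then show ?thesis by (simp add: euclidean_product_topology)
qed

text \<open>Test functions live on all sequences but see only the first \<open>k\<close> entries.
  The others, inner products with arbitrary \<open>gs j\<close> for \<open>j \<ge> k\<close>, need
  not converge, so they are set to zero before continuity in the product topology is used.\<close>

definition trunc :: "nat \<Rightarrow> (nat \<Rightarrow> real) \<Rightarrow> nat \<Rightarrow> real" where
  "trunc k y = (\<lambda>i. if i < k then y i else 0)"

lemma C1c_trunc: "C1c k \<phi> d\<phi> \<Longrightarrow> \<phi> (trunc k y) = \<phi> y"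
  unfolding C1c_def trunc_def by metis

lemma C1c_deriv: "C1c k \<phi> d\<phi> \<Longrightarrow> j < k \<Longrightarrow> ((\<lambda>s. \<phi> (y(j := s))) has_real_derivative d\<phi> j y) (at (y j))"
  unfolding C1c_def by blast

lemma C1c_deriv_trunc:
  assumes C: "C1c k \<phi> d\<phi>" and j: "j < k"
  shows "d\<phi> j (trunc k y) = d\<phi> j y"
proof -
  have "(trunc k y)(j := s) = trunc k (y(j := s))" for s
    using j by (auto simp: trunc_def)
  then have "(\<lambda>s. \<phi> ((trunc k y)(j := s))) = (\<lambda>s. \<phi> (y(j := s)))"
    by (simp add: C1c_trunc[OF C])
  moreover have "trunc k y j = y j" using j by (simp add: trunc_def)
  ultimately show ?thesis
    using C1c_deriv[OF C j, of "trunc k y"] C1c_deriv[OF C j, of y] by (metis DERIV_unique)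
qed

text \<open>The coordinates are exchanged one at a time, each by the mean value theorem; hence every
  partial derivative has its own intermediate point \<open>w i\<close>. This takes the place of
  total differentiability.\<close>

lemma C1c_mean_value:
  assumes C: "C1c k \<phi> d\<phi>"
  shows "\<exists>w. \<phi> y - \<phi> z = (\<Sum>i<k. (y i - z i) * d\<phi> i (w i)) \<and> (\<forall>i m. \<bar>w i m - trunc k z m\<bar> \<le> \<bar>y m - z m\<bar>)"
proof -
  define p where "p i = (\<lambda>m. if m < i then y m else trunc k z m)" for i
  have "\<exists>\<xi>. \<bar>\<xi> - z i\<bar> \<le> \<bar>y i - z i\<bar> \<and> \<phi> (p (Suc i)) - \<phi> (p i) = (y i - z i) * d\<phi> i ((p i)(i := \<xi>))"
    if i: "i < k" for i
  proof -
    define F where "F s = \<phi> ((p i)(i := s))" for s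
    have F: "(F has_real_derivative d\<phi> i ((p i)(i := s))) (at s)" for s
      using C1c_deriv[OF C i, of "(p i)(i := s)"] by (simp add: F_def[abs_def])
    have p1: "p (Suc i) = (p i)(i := y i)" and p0: "p i = (p i)(i := z i)"
      using i by (auto simp: p_def trunc_def)
    have Fy: "\<phi> (p (Suc i)) = F (y i)" and Fz: "\<phi> (p i) = F (z i)"
      unfolding F_def using p1 p0 by simp_all
    consider "z i < y i" | "y i < z i" | "y i = z i" by linarith
    then show ?thesis
    proof cases
      case 1
      obtain \<xi> where "z i < \<xi>" "\<xi> < y i" "F (y i) - F (z i) = (y i - z i) * d\<phi> i ((p i)(i := \<xi>))"
        using MVT2[OF 1, of F "\<lambda>s. d\<phi> i ((p i)(i := s))"] F by blast
      then show ?thesis by (intro exI[of _ \<xi>]) (simp add: Fy Fz)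
    next
      case 2
      obtain \<xi> where "y i < \<xi>" "\<xi> < z i" "F (z i) - F (y i) = (z i - y i) * d\<phi> i ((p i)(i := \<xi>))"
        using MVT2[OF 2, of F "\<lambda>s. d\<phi> i ((p i)(i := s))"] F by blast
      then show ?thesis by (intro exI[of _ \<xi>]) (simp add: Fy Fz algebra_simps)
    next
      case 3
      then show ?thesis by (intro exI[of _ "z i"]) (simp add: Fy Fz)
    qed
  qed
  then obtain \<xi> where \<xi>: "\<And>i. i < k \<Longrightarrow> \<bar>\<xi> i - z i\<bar> \<le> \<bar>y i - z i\<bar>"
    "\<And>i. i < k \<Longrightarrow> \<phi> (p (Suc i)) - \<phi> (p i) = (y i - z i) * d\<phi> i ((p i)(i := \<xi> i))"
    by metis
  define w where "w i = (if i < k then (p i)(i := \<xi> i) else trunc k z)" for i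
  have "\<phi> y - \<phi> z = \<phi> (p k) - \<phi> (p 0)"
  proof -
    have "p k = trunc k y" "p 0 = trunc k z" by (auto simp: p_def trunc_def)
    then show ?thesis by (simp add: C1c_trunc[OF C])
  qed
  also have "\<dots> = (\<Sum>i<k. \<phi> (p (Suc i)) - \<phi> (p i))"
    by (rule sum_lessThan_telescope[symmetric])
  also have "\<dots> = (\<Sum>i<k. (y i - z i) * d\<phi> i (w i))"
    by (intro sum.cong refl) (simp add: \<xi> w_def)
  finally have "\<phi> y - \<phi> z = (\<Sum>i<k. (y i - z i) * d\<phi> i (w i))" .
  moreover have "\<bar>w i m - trunc k z m\<bar> \<le> \<bar>y m - z m\<bar>" for i m
    using \<xi>(1)[of i] by (auto simp: w_def p_def trunc_def)
  ultimately show ?thesis by blast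
qed

lemma C1c_deriv_tendsto:
  assumes C: "C1c k \<phi> d\<phi>" and j: "j < k" and w: "\<And>m. ((\<lambda>n. w n m) \<longlongrightarrow> trunc k y m) F"
  shows "((\<lambda>n. d\<phi> j (w n)) \<longlongrightarrow> d\<phi> j y) F"
proof -
  have "continuous_on UNIV (d\<phi> j)" using C j by (auto simp: C1c_def)
  then have "isCont (d\<phi> j) (trunc k y)" by (simp add: continuous_on_eq_continuous_at)
  then have "((\<lambda>n. d\<phi> j (w n)) \<longlongrightarrow> d\<phi> j (trunc k y)) F"
    by (rule isCont_tendsto_compose) (rule tendsto_fun[OF w])
  then show ?thesis by (simp add: C1c_deriv_trunc[OF C j])
qed

text \<open>Where some coordinate exceeds \<open>R\<close>, the function vanishes along an open
  piece of the coordinate line, so the derivative is zero; elsewhere truncation lands in a product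
  of compact intervals, compact by Tychonoff.\<close>

lemma C1c_deriv_bounded:
  assumes C: "C1c k \<phi> d\<phi>"
  obtains B where "\<And>j y. j < k \<Longrightarrow> \<bar>d\<phi> j y\<bar> \<le> B"
proof -
  obtain R where R: "\<And>y. \<exists>j<k. \<bar>y j\<bar> > R \<Longrightarrow> \<phi> y = 0"
    using C unfolding C1c_def by blast
  define K where "K = (PiE UNIV (\<lambda>i. if i < k then {-R..R} else {0}) :: (nat \<Rightarrow> real) set)"
  have "compactin (product_topology (\<lambda>i. euclidean) UNIV) K"
    unfolding K_def compactin_PiE by auto
  then have K: "compact K" by (simp add: euclidean_product_topology)
  have "\<exists>B. \<forall>y. \<bar>d\<phi> j y\<bar> \<le> B" if j: "j < k" for j
  proof -
    have "continuous_on UNIV (d\<phi> j)" using C j by (auto simp: C1c_def)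
    then have "compact (d\<phi> j ` K)"
      by (intro compact_continuous_image K) (auto intro: continuous_on_subset)
    then obtain B where B: "\<And>y. y \<in> K \<Longrightarrow> \<bar>d\<phi> j y\<bar> \<le> B"
      using compact_imp_bounded bounded_iff by (metis imageI real_norm_def)
    have "\<bar>d\<phi> j y\<bar> \<le> max B 0" for y
    proof (cases "\<exists>i<k. \<bar>y i\<bar> > R")
      case True
      then obtain i where i: "i < k" "\<bar>y i\<bar> > R" by blast
      have "((\<lambda>s. \<phi> (y(j := s))) has_real_derivative 0) (at (y j))"
      proof (rule has_field_derivative_transform_within_open[of "\<lambda>s. 0"])
        show "open {s. R < \<bar>(y(j := s)) i\<bar>}"
        proof (cases "i = j")
          case True
          then show ?thesis
            by (simp add: open_Collect_less continuous_intros)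
        qed simp
        show "y j \<in> {s. R < \<bar>(y(j := s)) i\<bar>}" using i by auto
        show "0 = \<phi> (y(j := s))" if "s \<in> {s. R < \<bar>(y(j := s)) i\<bar>}" for s
          using R[of "y(j := s)"] i(1) that by (metis mem_Collect_eq)
      qed simp
      then have "d\<phi> j y = 0" using C1c_deriv[OF C j, of y] DERIV_unique by blast
      then show ?thesis by simp
    next
      case False
      then have "\<bar>y i\<bar> \<le> R" if "i < k" for i using that by (meson not_less)
      then have "trunc k y i \<in> (if i < k then {-R..R} else {0})" for i
        by (auto simp: trunc_def abs_le_iff minus_le_iff)
      then have "trunc k y \<in> K" unfolding K_def by (intro PiE_I) auto
      then show ?thesis using B C1c_deriv_trunc[OF C j, of y] by fastforce
    qed
    then show ?thesis by blast
  qed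
  then obtain B where B: "\<And>j y. j < k \<Longrightarrow> \<bar>d\<phi> j y\<bar> \<le> B j" by metis
  have "\<bar>d\<phi> j y\<bar> \<le> (\<Sum>i<k. \<bar>B i\<bar>)" if "j < k" for j y
    using order_trans[OF B[OF that, of y] abs_ge_self] member_le_sum[of j "{..<k}" "\<lambda>i. \<bar>B i\<bar>"] that
    by (auto intro: order_trans)
  then show ?thesis using that by blast
qed

lemma C1c_Lipschitz:
  assumes C: "C1c k \<phi> d\<phi>" and B: "\<And>j y. j < k \<Longrightarrow> \<bar>d\<phi> j y\<bar> \<le> B"
  shows "\<bar>\<phi> y - \<phi> z\<bar> \<le> (\<Sum>i<k. B * \<bar>y i - z i\<bar>)"
proof -
  obtain w where "\<phi> y - \<phi> z = (\<Sum>i<k. (y i - z i) * d\<phi> i (w i))"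
    using C1c_mean_value[OF C, of y z] by blast
  then have "\<bar>\<phi> y - \<phi> z\<bar> \<le> (\<Sum>i<k. \<bar>(y i - z i) * d\<phi> i (w i)\<bar>)" by (simp add: sum_abs)
  also have "\<dots> \<le> (\<Sum>i<k. B * \<bar>y i - z i\<bar>)"
  proof (rule sum_mono)
    fix i assume "i \<in> {..<k}"
    then show "\<bar>(y i - z i) * d\<phi> i (w i)\<bar> \<le> B * \<bar>y i - z i\<bar>"
      using mult_left_mono[OF B[of i "w i"], of "\<bar>y i - z i\<bar>"] by (simp add: abs_mult mult.commute)
  qed
  finally show ?thesis .
qed

text \<open>Moving the first coordinate out of the support costs at most the Lipschitz bound. For
  \<open>k = 0\<close> no coordinate can be moved, but then \<open>\<phi>\<close> is
  constant.\<close>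

lemma C1c_bounded:
  assumes C: "C1c k \<phi> d\<phi>"
  obtains B where "\<And>y. \<bar>\<phi> y\<bar> \<le> B"
proof (cases "k = 0")
  case True
  then have "\<phi> y = \<phi> (\<lambda>_. 0)" for y using C1c_trunc[OF C, of y] by (simp add: trunc_def)
  then have "\<bar>\<phi> y\<bar> \<le> \<bar>\<phi> (\<lambda>_. 0)\<bar>" for y by (metis order_refl)
  then show ?thesis using that by blast
next
  case False
  obtain R0 where R0: "\<And>y. \<exists>j<k. \<bar>y j\<bar> > R0 \<Longrightarrow> \<phi> y = 0"
    using C unfolding C1c_def by blast
  \<comment> \<open>Positive and larger than \<open>R0\<close>, whatever the sign of
    \<open>R0\<close>.\<close>
  define R where "R = \<bar>R0\<bar> + 1"
  obtain D where D: "\<And>j y. j < k \<Longrightarrow> \<bar>d\<phi> j y\<bar> \<le> D" using C1c_deriv_bounded[OF C] by blast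
  have D0: "0 \<le> D" using D[of 0 undefined] False by linarith
  have "\<bar>\<phi> y\<bar> \<le> (\<Sum>i<k. D * (2 * R))" for y
  proof (cases "\<exists>j<k. \<bar>y j\<bar> > R0")
    case True
    then show ?thesis using R0[OF True] D0 by (simp add: R_def sum_nonneg)
  next
    case small: False
    have "\<phi> (y(0 := R)) = 0" using False by (intro R0) (auto intro!: exI[of _ 0] simp: R_def)
    then have "\<bar>\<phi> y\<bar> \<le> (\<Sum>i<k. D * \<bar>y i - (y(0 := R)) i\<bar>)"
      using C1c_Lipschitz[OF C D, of y "y(0 := R)"] by simp
    also have "\<dots> \<le> (\<Sum>i<k. D * (2 * R))"
    proof (intro sum_mono mult_left_mono D0)
      fix i assume "i \<in> {..<k}"
      then have "\<bar>y i\<bar> \<le> R0" using small by (meson lessThan_iff not_less)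
      then show "\<bar>y i - (y(0 := R)) i\<bar> \<le> 2 * R" by (auto simp: R_def)
    qed
    finally show ?thesis .
  qed
  then show ?thesis using that by blast
qed

text \<open>Divide the mean value expansion by the time increment: the intermediate points tend to
  \<open>y t\<close>, up to truncation, and the partial derivatives are continuous.\<close>

lemma C1c_chain:
  assumes C: "C1c k \<phi> d\<phi>" and t: "t \<in> S"
    and y: "\<And>j. j < k \<Longrightarrow> ((\<lambda>s. y s j) has_real_derivative y' j) (at t within S)"
  shows "((\<lambda>s. \<phi> (y s)) has_real_derivative (\<Sum>j<k. d\<phi> j (y t) * y' j)) (at t within S)"
proof -
  have "\<exists>w. \<phi> (y s) - \<phi> (y t) = (\<Sum>i<k. (y s i - y t i) * d\<phi> i (w i)) \<and>
      (\<forall>i m. \<bar>w i m - trunc k (y t) m\<bar> \<le> \<bar>trunc k (y s) m - trunc k (y t) m\<bar>)" for s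
  proof -
    obtain w where w: "\<phi> (trunc k (y s)) - \<phi> (trunc k (y t)) = (\<Sum>i<k. (trunc k (y s) i - trunc k (y t) i) * d\<phi> i (w i))"
      "\<And>i m. \<bar>w i m - trunc k (trunc k (y t)) m\<bar> \<le> \<bar>trunc k (y s) m - trunc k (y t) m\<bar>"
      using C1c_mean_value[OF C, of "trunc k (y s)" "trunc k (y t)"] by blast
    have "trunc k (trunc k (y t)) = trunc k (y t)" by (auto simp: trunc_def)
    moreover have "(\<Sum>i<k. (trunc k (y s) i - trunc k (y t) i) * d\<phi> i (w i)) = (\<Sum>i<k. (y s i - y t i) * d\<phi> i (w i))"
      by (intro sum.cong refl) (simp add: trunc_def)
    ultimately show ?thesis using w by (intro exI[of _ w]) (simp add: C1c_trunc[OF C])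
  qed
  then obtain w where w: "\<And>s. \<phi> (y s) - \<phi> (y t) = (\<Sum>i<k. (y s i - y t i) * d\<phi> i (w s i))"
    "\<And>s i m. \<bar>w s i m - trunc k (y t) m\<bar> \<le> \<bar>trunc k (y s) m - trunc k (y t) m\<bar>"
    by metis
  have "((\<lambda>s. trunc k (y s) m) \<longlongrightarrow> trunc k (y t) m) (at t within S)" for m
    using has_field_derivative_imp_has_derivative[OF y[of m], THEN has_derivative_continuous]
    by (cases "m < k") (auto simp: trunc_def continuous_within)
  then have ty: "((\<lambda>s. trunc k (y s) m - trunc k (y t) m) \<longlongrightarrow> 0) (at t within S)" for m
    by (simp add: LIM_zero_iff)
  have tw: "((\<lambda>s. w s i m) \<longlongrightarrow> trunc k (y t) m) (at t within S)" for i m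
  proof -
    have "((\<lambda>s. w s i m - trunc k (y t) m) \<longlongrightarrow> 0) (at t within S)"
      by (rule Lim_null_comparison[OF _ tendsto_rabs_zero[OF ty[of m]]]) (simp add: w(2))
    then show ?thesis by (simp add: LIM_zero_iff)
  qed
  have "((\<lambda>s. \<Sum>i<k. (y s i - y t i) / (s - t) * d\<phi> i (w s i)) \<longlongrightarrow> (\<Sum>i<k. y' i * d\<phi> i (y t))) (at t within S)"
  proof (intro tendsto_sum tendsto_mult)
    fix i assume i: "i \<in> {..<k}"
    show "((\<lambda>s. (y s i - y t i) / (s - t)) \<longlongrightarrow> y' i) (at t within S)"
      using y[of i] i unfolding has_field_derivative_iff by simp
    show "((\<lambda>s. d\<phi> i (w s i)) \<longlongrightarrow> d\<phi> i (y t)) (at t within S)"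
      by (rule C1c_deriv_tendsto[OF C _ tw]) (use i in simp)
  qed
  then show ?thesis
    unfolding has_field_derivative_iff w(1)
    by (simp add: sum_divide_distrib mult.commute)
qed

section \<open>Continuity of the functionals\<close>

lemma nonlin_bounds:
  assumes g: "nice g" and u: "L2 u"
  shows "\<bar>nonlin g u\<bar> \<le> (\<Sum>n. \<bar>coef n g\<bar> * kappa n) * (L2norm u)\<^sup>2"
proof -
  have s: "summable (\<lambda>n. \<bar>coef n g\<bar> * kappa n)" using g by (simp add: nice_def)
  have le: "\<bar>coef n g * bb n u\<bar> \<le> (\<bar>coef n g\<bar> * kappa n) * (L2norm u)\<^sup>2" for n
    using mult_left_mono[OF abs_bb_le[OF u, of n], of "\<bar>coef n g\<bar>"] by (simp add: abs_mult mult.assoc)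
  have "summable (\<lambda>n. \<bar>coef n g * bb n u\<bar>)"
    by (rule summable_comparison_test_ev[OF _ summable_mult2[OF s, of "(L2norm u)\<^sup>2"]]) (use le in auto)
  then have "\<bar>\<Sum>n. coef n g * bb n u\<bar> \<le> (\<Sum>n. \<bar>coef n g * bb n u\<bar>)" by (rule summable_rabs)
  also have "\<dots> \<le> (\<Sum>n. (\<bar>coef n g\<bar> * kappa n) * (L2norm u)\<^sup>2)"
    by (intro suminf_le le summable_mult2 s) fact
  also have "\<dots> = (\<Sum>n. \<bar>coef n g\<bar> * kappa n) * (L2norm u)\<^sup>2"
    by (rule suminf_mult2[symmetric, OF s])
  finally show ?thesis using sums_unique[OF nonlin_series[OF g u]] by simp
qed

lemma nonlin_diff_le:
  assumes g: "nice g" and u: "L2 u" and v: "L2 v"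
  shows "\<bar>nonlin g u - nonlin g v\<bar> \<le> (\<Sum>n. \<bar>coef n g\<bar> * kappa n) * (L2norm (\<lambda>x. u x - v x) * (L2norm u + L2norm v))"
proof -
  let ?C = "L2norm (\<lambda>x. u x - v x) * (L2norm u + L2norm v)"
  have s: "summable (\<lambda>n. \<bar>coef n g\<bar> * kappa n)" using g by (simp add: nice_def)
  have le: "\<bar>coef n g * bb n u - coef n g * bb n v\<bar> \<le> (\<bar>coef n g\<bar> * kappa n) * ?C" for n
    using mult_left_mono[OF bb_diff_le[OF u v, of n], of "\<bar>coef n g\<bar>"]
    by (simp add: abs_mult mult.assoc right_diff_distrib[symmetric])
  have sm: "summable (\<lambda>n. \<bar>coef n g * bb n u - coef n g * bb n v\<bar>)"
    by (rule summable_comparison_test_ev[OF _ summable_mult2[OF s, of ?C]]) (use le in auto)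
  have "nonlin g u - nonlin g v = (\<Sum>n. coef n g * bb n u - coef n g * bb n v)"
    by (rule sums_unique[OF sums_diff[OF nonlin_series[OF g u] nonlin_series[OF g v]]])
  also have "\<bar>\<dots>\<bar> \<le> (\<Sum>n. \<bar>coef n g * bb n u - coef n g * bb n v\<bar>)" by (rule summable_rabs[OF sm])
  also have "\<dots> \<le> (\<Sum>n. (\<bar>coef n g\<bar> * kappa n) * ?C)"
    by (intro suminf_le le summable_mult2 s sm)
  also have "\<dots> = (\<Sum>n. \<bar>coef n g\<bar> * kappa n) * ?C"
    by (rule suminf_mult2[symmetric, OF s])
  finally show ?thesis .
qed

lemma L2cont_nonlin:
  assumes g: "nice g"
  shows "L2cont (nonlin g)"
  unfolding L2cont_def
proof (intro allI impI)
  fix u and v :: "nat \<Rightarrow> vf"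
  assume u: "u \<in> Hset" and v: "\<forall>n. v n \<in> Hset" and lim: "(\<lambda>n. L2norm (\<lambda>x. v n x - u x)) \<longlonglongrightarrow> 0"
  let ?K = "\<Sum>n. \<bar>coef n g\<bar> * kappa n"
  have nv: "(\<lambda>m. L2norm (v m)) \<longlonglongrightarrow> L2norm u"
    using L2norm_tendsto[OF _ _ lim] u v Hset_L2 by blast
  have "(\<lambda>m. nonlin g (v m) - nonlin g u) \<longlonglongrightarrow> 0"
  proof (rule Lim_null_comparison)
    show "\<forall>\<^sub>F m in sequentially. norm (nonlin g (v m) - nonlin g u)
        \<le> ?K * (L2norm (\<lambda>x. v m x - u x) * (L2norm (v m) + L2norm u))"
      using nonlin_diff_le[OF g] u v Hset_L2 by auto
    have "(\<lambda>m. ?K * (L2norm (\<lambda>x. v m x - u x) * (L2norm (v m) + L2norm u))) \<longlonglongrightarrow> ?K * (0 * (L2norm u + L2norm u))"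
      by (intro tendsto_intros lim nv)
    then show "(\<lambda>m. ?K * (L2norm (\<lambda>x. v m x - u x) * (L2norm (v m) + L2norm u))) \<longlonglongrightarrow> 0" by simp
  qed
  then show "(\<lambda>m. nonlin g (v m)) \<longlonglongrightarrow> nonlin g u" by (simp add: LIM_zero_iff)
qed

text \<open>Norm convergence implies convergence of the finitely many inner products that define a
  weak neighbourhood.\<close>

lemma L2cont_Cb_weak:
  assumes "Cb_weak \<psi>"
  shows "L2cont \<psi>"
  unfolding L2cont_def
proof (intro allI impI tendstoI)
  fix u and v :: "nat \<Rightarrow> vf" and e :: real
  assume u: "u \<in> Hset" and v: "\<forall>n. v n \<in> Hset" and lim: "(\<lambda>n. L2norm (\<lambda>x. v n x - u x)) \<longlonglongrightarrow> 0" and e: "0 < e"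
  obtain G \<delta> where G: "finite G" "G \<subseteq> Hset" "\<delta> > 0"
    "\<And>w. w \<in> Hset \<Longrightarrow> (\<forall>g\<in>G. \<bar>L2inner (w - u) g\<bar> < \<delta>) \<Longrightarrow> \<bar>\<psi> w - \<psi> u\<bar> < e"
  proof -
    have "\<forall>u\<in>Hset. \<forall>e>0. \<exists>G \<delta>. finite G \<and> G \<subseteq> Hset \<and> \<delta> > 0 \<and>
        (\<forall>v\<in>Hset. (\<forall>g\<in>G. \<bar>L2inner (v - u) g\<bar> < \<delta>) \<longrightarrow> \<bar>\<psi> v - \<psi> u\<bar> < e)"
      using assms unfolding Cb_weak_def by (rule conjunct2)
    from this[rule_format, OF u e] show ?thesis using that by blast
  qed
  have "\<forall>\<^sub>F n in sequentially. \<bar>L2inner (v n - u) g\<bar> < \<delta>" if "g \<in> G" for g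
  proof -
    have g: "L2 g" using that G(2) Hset_L2 by blast
    have "(\<lambda>n. L2inner (v n) g) \<longlonglongrightarrow> L2inner u g"
      using L2cont_L2inner[OF g] u v lim unfolding L2cont_def by blast
    then have "\<forall>\<^sub>F n in sequentially. dist (L2inner (v n) g) (L2inner u g) < \<delta>"
      using G(3) by (rule tendstoD)
    moreover have "L2inner (v n - u) g = L2inner (v n) g - L2inner u g" for n
      unfolding fun_diff_def using v u g by (simp add: L2inner_diff_left Hset_L2)
    ultimately show ?thesis by (simp add: dist_real_def)
  qed
  then have "\<forall>\<^sub>F n in sequentially. \<forall>g\<in>G. \<bar>L2inner (v n - u) g\<bar> < \<delta>"
    using G(1) by (simp add: eventually_ball_finite_distrib)
  then show "\<forall>\<^sub>F n in sequentially. dist (\<psi> (v n)) (\<psi> u) < e"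
    by eventually_elim (use G(4) v in \<open>auto simp: dist_real_def\<close>)
qed

section \<open>Functionals of a fixed cylindrical test function\<close>

context
  fixes k \<phi> d\<phi> and gs :: "nat \<Rightarrow> vf"
  assumes C: "C1c k \<phi> d\<phi>" and gs: "\<And>j. j < k \<Longrightarrow> nice (gs j)"
begin

lemma gs_L2: "j < k \<Longrightarrow> L2 (gs j)"
  using gs Hset_L2 by (auto simp: nice_def)

lemma nonlin_cylDPhi:
  assumes u: "L2 u"
  shows "nonlin (cylDPhi k d\<phi> gs u) u = (\<Sum>j<k. d\<phi> j (\<lambda>m. L2inner u (gs m)) * nonlin (gs j) u)"
  unfolding cylDPhi_def by (rule nonlin_sum) (use gs u in auto)

text \<open>Growth no faster than the squared norm lets the second moment of the initial law
  dominate the nonlinear term at all times.\<close>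

lemma nonlin_cylDPhi_bound:
  "\<exists>B\<ge>0. \<forall>u. L2 u \<longrightarrow> \<bar>nonlin (cylDPhi k d\<phi> gs u) u\<bar> \<le> B * (L2norm u)\<^sup>2"
proof -
  obtain D where D: "\<And>j y. j < k \<Longrightarrow> \<bar>d\<phi> j y\<bar> \<le> D" using C1c_deriv_bounded[OF C] by blast
  define K where "K j = (\<Sum>n. \<bar>coef n (gs j)\<bar> * kappa n)" for j
  have "\<bar>nonlin (cylDPhi k d\<phi> gs u) u\<bar> \<le> (\<Sum>j<k. \<bar>D\<bar> * \<bar>K j\<bar>) * (L2norm u)\<^sup>2" if u: "L2 u" for u
  proof -
    have "\<bar>nonlin (cylDPhi k d\<phi> gs u) u\<bar> \<le> (\<Sum>j<k. \<bar>d\<phi> j (\<lambda>m. L2inner u (gs m)) * nonlin (gs j) u\<bar>)"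
      unfolding nonlin_cylDPhi[OF u] by (rule sum_abs)
    also have "\<dots> \<le> (\<Sum>j<k. \<bar>D\<bar> * (\<bar>K j\<bar> * (L2norm u)\<^sup>2))"
    proof (rule sum_mono)
      fix j assume "j \<in> {..<k}"
      then have j: "j < k" by simp
      have "\<bar>nonlin (gs j) u\<bar> \<le> K j * (L2norm u)\<^sup>2" unfolding K_def by (rule nonlin_bounds[OF gs[OF j] u])
      also have "\<dots> \<le> \<bar>K j\<bar> * (L2norm u)\<^sup>2" by (intro mult_right_mono) auto
      finally have "\<bar>nonlin (gs j) u\<bar> \<le> \<bar>K j\<bar> * (L2norm u)\<^sup>2" .
      moreover have "\<bar>d\<phi> j (\<lambda>m. L2inner u (gs m))\<bar> \<le> \<bar>D\<bar>" using D[OF j] by (meson abs_ge_self order_trans)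
      ultimately show "\<bar>d\<phi> j (\<lambda>m. L2inner u (gs m)) * nonlin (gs j) u\<bar> \<le> \<bar>D\<bar> * (\<bar>K j\<bar> * (L2norm u)\<^sup>2)"
        unfolding abs_mult by (intro mult_mono) auto
    qed
    also have "\<dots> = (\<Sum>j<k. \<bar>D\<bar> * \<bar>K j\<bar>) * (L2norm u)\<^sup>2"
      by (simp add: sum_distrib_right mult.assoc)
    finally show ?thesis .
  qed
  then show ?thesis by (intro exI[of _ "\<Sum>j<k. \<bar>D\<bar> * \<bar>K j\<bar>"]) (simp add: sum_nonneg)
qed

lemma trunc_inner_tendsto:
  assumes u: "u \<in> Hset" and v: "\<And>n::nat. v n \<in> Hset" and lim: "(\<lambda>n. L2norm (\<lambda>x. v n x - u x)) \<longlonglongrightarrow> 0"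
  shows "(\<lambda>n. trunc k (\<lambda>m. L2inner (v n) (gs m)) m) \<longlonglongrightarrow> trunc k (\<lambda>m. L2inner u (gs m)) m"
  using L2cont_L2inner[OF gs_L2, of m] u v lim
  by (cases "m < k") (auto simp: trunc_def L2cont_def)

lemma L2cont_nonlin_cylDPhi: "L2cont (\<lambda>u. nonlin (cylDPhi k d\<phi> gs u) u)"
  unfolding L2cont_def
proof (intro allI impI)
  fix u and v :: "nat \<Rightarrow> vf"
  assume u: "u \<in> Hset" and v: "\<forall>n. v n \<in> Hset" and lim: "(\<lambda>n. L2norm (\<lambda>x. v n x - u x)) \<longlonglongrightarrow> 0"
  have vH: "v n \<in> Hset" for n using v by blast
  have "(\<lambda>n. \<Sum>j<k. d\<phi> j (trunc k (\<lambda>m. L2inner (v n) (gs m))) * nonlin (gs j) (v n))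
      \<longlonglongrightarrow> (\<Sum>j<k. d\<phi> j (\<lambda>m. L2inner u (gs m)) * nonlin (gs j) u)"
  proof (intro tendsto_sum tendsto_mult)
    fix j assume "j \<in> {..<k}"
    then have j: "j < k" by simp
    show "(\<lambda>n. d\<phi> j (trunc k (\<lambda>m. L2inner (v n) (gs m)))) \<longlonglongrightarrow> d\<phi> j (\<lambda>m. L2inner u (gs m))"
      by (rule C1c_deriv_tendsto[OF C j trunc_inner_tendsto[OF u vH lim]])
    show "(\<lambda>n. nonlin (gs j) (v n)) \<longlonglongrightarrow> nonlin (gs j) u"
      using L2cont_nonlin[OF gs[OF j]] u v lim unfolding L2cont_def by blast
  qed
  then show "(\<lambda>n. nonlin (cylDPhi k d\<phi> gs (v n)) (v n)) \<longlonglongrightarrow> nonlin (cylDPhi k d\<phi> gs u) u"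
    by (simp add: nonlin_cylDPhi Hset_L2 u vH C1c_deriv_trunc[OF C])
qed

lemma L2cont_cylPhi: "L2cont (cylPhi \<phi> gs)"
  unfolding L2cont_def
proof (intro allI impI)
  fix u and v :: "nat \<Rightarrow> vf"
  assume u: "u \<in> Hset" and v: "\<forall>n. v n \<in> Hset" and lim: "(\<lambda>n. L2norm (\<lambda>x. v n x - u x)) \<longlonglongrightarrow> 0"
  have vH: "v n \<in> Hset" for n using v by blast
  obtain D where D: "\<And>j y. j < k \<Longrightarrow> \<bar>d\<phi> j y\<bar> \<le> D" using C1c_deriv_bounded[OF C] by blast
  let ?y = "\<lambda>u. trunc k (\<lambda>m. L2inner u (gs m))"
  have "(\<lambda>n. \<phi> (?y (v n)) - \<phi> (?y u)) \<longlonglongrightarrow> 0"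
  proof (rule Lim_null_comparison)
    show "\<forall>\<^sub>F n in sequentially. norm (\<phi> (?y (v n)) - \<phi> (?y u)) \<le> (\<Sum>i<k. D * \<bar>?y (v n) i - ?y u i\<bar>)"
      using C1c_Lipschitz[OF C D] by simp
    have "(\<lambda>n. \<Sum>i<k. D * \<bar>?y (v n) i - ?y u i\<bar>) \<longlonglongrightarrow> (\<Sum>i<k. D * \<bar>?y u i - ?y u i\<bar>)"
      by (intro tendsto_intros trunc_inner_tendsto[OF u vH lim])
    then show "(\<lambda>n. \<Sum>i<k. D * \<bar>?y (v n) i - ?y u i\<bar>) \<longlonglongrightarrow> 0" by simp
  qed
  then show "(\<lambda>n. cylPhi \<phi> gs (v n)) \<longlonglongrightarrow> cylPhi \<phi> gs u"
    by (simp add: cylPhi_def C1c_trunc[OF C] LIM_zero_iff)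
qed

end

section \<open>Properties of the trajectories\<close>

context
  fixes T :: real and a :: "real \<Rightarrow> nat \<Rightarrow> real" and u0 :: vf
  assumes T: "T > 0" and u0: "u0 \<in> Hset" and ep: "euler_path T a (\<lambda>k. coef k u0)"
begin

lemma path_energy: "t \<in> {0..T} \<Longrightarrow> (\<Sum>k<M. (a t k)\<^sup>2) \<le> (L2norm u0)\<^sup>2"
  using ep sums_unique[OF Parseval_norm[OF u0]] by (simp add: euler_path_def)

lemma path_synth:
  assumes "t \<in> {0..T}"
  shows "synth (a t) \<in> Hset" "coef k (synth (a t)) = a t k"
proof -
  have "summable (\<lambda>k. (a t k)\<^sup>2)"
    by (rule summableI_nonneg_bounded[where x="(L2norm u0)\<^sup>2"]) (use path_energy[OF assms] in auto)
  then show "synth (a t) \<in> Hset" "coef k (synth (a t)) = a t k" by (rule synth)+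
qed

lemma path_norm:
  assumes t: "t \<in> {0..T}"
  shows "L2norm (synth (a t)) \<le> L2norm u0"
proof (rule power2_le_imp_le)
  show "(L2norm (synth (a t)))\<^sup>2 \<le> (L2norm u0)\<^sup>2"
    using Parseval_norm[OF path_synth(1)[OF t]] path_energy[OF t] unfolding sums_def path_synth(2)[OF t]
    by (intro LIMSEQ_le_const2) auto
qed simp

text \<open>Coefficients are differentiable, hence continuous, in time; the uniform enstrophy bound
  upgrades this to the norm.\<close>

lemma path_continuous:
  assumes X: "\<And>n::nat. X n \<in> {0..T}" and t: "t \<in> {0..T}" and lim: "X \<longlonglongrightarrow> t"
  shows "(\<lambda>n. L2norm (\<lambda>x. synth (a (X n)) x - synth (a t) x)) \<longlonglongrightarrow> 0"
proof (rule Rellich_strong_convergence)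
  let ?Z = "\<Sum>k. lam k * (coef k u0)\<^sup>2"
  show "(\<Sum>k<M. lam k * (coef k (synth (a (X n))))\<^sup>2) \<le> ?Z" for n M
    using ep X[of n] by (simp add: path_synth(2)[OF X] euler_path_def)
  show "(\<Sum>k<M. lam k * (coef k (synth (a t)))\<^sup>2) \<le> ?Z" for M
    using ep t by (simp add: path_synth(2)[OF t] euler_path_def)
  show "(\<lambda>n. coef k (synth (a (X n)))) \<longlonglongrightarrow> coef k (synth (a t))" for k
  proof -
    have "((\<lambda>s. a s k) has_real_derivative bb k (synth (a t))) (at t within {0..T})"
      using ep t by (simp add: euler_path_def)
    then have "continuous (at t within {0..T}) (\<lambda>s. a s k)"
      using has_field_derivative_imp_has_derivative has_derivative_continuous by blast
    then have "(\<lambda>n. a (X n) k) \<longlonglongrightarrow> a t k"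
      using X lim unfolding continuous_within_sequentially by (auto simp: o_def)
    then show ?thesis by (simp add: path_synth(2)[OF X] path_synth(2)[OF t])
  qed
qed (use path_synth X t in auto)

text \<open>Termwise differentiation of the Parseval series: the derivatives have the summable
  majorant \<open>\<bar>coef n g\<bar> * kappa n * (L2norm u0)\<^sup>2\<close>, independent of time,
  so their series converges uniformly.\<close>

lemma path_derivative:
  assumes g: "nice g" and t: "t \<in> {0..T}"
  shows "((\<lambda>s. L2inner (synth (a s)) g) has_real_derivative nonlin g (synth (a t))) (at t within {0..T})"
proof -
  have s: "summable (\<lambda>n. \<bar>coef n g\<bar> * kappa n)" and gL: "L2 g" using g Hset_L2 by (auto simp: nice_def)
  have uni: "uniform_limit {0..T} (\<lambda>N t. \<Sum>i<N. coef i g * bb i (synth (a t))) (\<lambda>t. \<Sum>i. coef i g * bb i (synth (a t))) sequentially"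
  proof (rule Weierstrass_m_test[OF _ summable_mult2[OF s, of "(L2norm u0)\<^sup>2"]])
    fix n t assume t: "t \<in> {0..T}"
    have "\<bar>bb n (synth (a t))\<bar> \<le> kappa n * (L2norm u0)\<^sup>2"
      using order_trans[OF abs_bb_le[OF Hset_L2[OF path_synth(1)[OF t]]]
          mult_left_mono[OF power_mono[OF path_norm[OF t] L2norm_nonneg] kappa_nonneg]] by simp
    from mult_left_mono[OF this, of "\<bar>coef n g\<bar>"]
    show "norm (coef n g * bb n (synth (a t))) \<le> \<bar>coef n g\<bar> * kappa n * (L2norm u0)\<^sup>2"
      by (simp add: abs_mult mult.assoc)
  qed
  have par: "(\<lambda>n. coef n g * a t n) sums L2inner (synth (a t)) g" if "t \<in> {0..T}" for t
    using Parseval[OF path_synth(1)[OF that] gL] by (simp add: path_synth(2)[OF that] mult.commute)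
  have "\<exists>h. \<forall>t\<in>{0..T}. (\<lambda>n. coef n g * a t n) sums h t \<and>
      (h has_field_derivative (\<Sum>i. coef i g * bb i (synth (a t)))) (at t within {0..T})"
  proof (rule has_field_derivative_series[OF _ _ uni])
    show "((\<lambda>t. coef n g * a t n) has_real_derivative coef n g * bb n (synth (a t))) (at t within {0..T})"
      if "t \<in> {0..T}" for n t
      using ep that by (intro DERIV_cmult) (simp add: euler_path_def)
    show "0 \<in> {0..T}" using T by simp
    then show "summable (\<lambda>n. coef n g * a 0 n)" using par sums_summable by blast
  qed simp
  then obtain h where h: "\<And>t. t \<in> {0..T} \<Longrightarrow> (\<lambda>n. coef n g * a t n) sums h t"
    "\<And>t. t \<in> {0..T} \<Longrightarrow> (h has_field_derivative (\<Sum>i. coef i g * bb i (synth (a t)))) (at t within {0..T})"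
    by blast
  have "(\<Sum>i. coef i g * bb i (synth (a t))) = nonlin g (synth (a t))"
    by (rule sums_unique[OF nonlin_series[OF g Hset_L2[OF path_synth(1)[OF t]]], symmetric])
  then have "(h has_real_derivative nonlin g (synth (a t))) (at t within {0..T})"
    using h(2)[OF t] by simp
  then show ?thesis
    by (rule has_field_derivative_transform_within[where d=1])
       (use t in \<open>auto intro: sums_unique2[OF h(1) par]\<close>)
qed

end

section \<open>Expectations along a random flow\<close>

text \<open>Open sets of a pseudometric contain with a point all points at distance zero, and
  complements and countable unions keep this property. It yields \<open>law 0 = M\<close> although
  \<open>U 0 u\<close> agrees with \<open>u\<close> only up to a null set.\<close>

lemma HBorel_saturated:
  assumes "A \<in> HBorel" "u \<in> Hset" "v \<in> Hset" "L2norm (\<lambda>x. u x - v x) = 0"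
  shows "u \<in> A \<longleftrightarrow> v \<in> A"
  using assms(1) unfolding HBorel_def
proof induction
  case (Basic U)
  then have U: "L2open U" by simp
  have "q \<in> U" if "p \<in> U" "q \<in> Hset" "L2norm (\<lambda>x. q x - p x) = 0" for p q
    using U that unfolding L2open_def fun_diff_def by metis
  then show ?case using assms(2-4) L2norm_minus_commute[of u v] by auto
next
  case Empty
  then show ?case by simp
next
  case (Compl A)
  then show ?case using assms(2,3) by blast
next
  case (Union A)
  then show ?case by blast
qed

text \<open>Isolates what the passage to laws uses. The quantifiers over times and test fields stand
  inside the almost sure statements, so one null set serves them all; the initial condition is
  imposed at every datum, since \<open>law_0\<close> compares preimages with sets.\<close>

locale euler_flow = prob_space M for M :: "vf measure" +
  fixes T :: real and U :: "real \<Rightarrow> vf \<Rightarrow> vf"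
  assumes T: "T > 0" and M: "space M = Hset" "sets M = HBorel"
    and moment: "integrable M (\<lambda>u. (L2norm u)\<^sup>2)"
    and U_meas: "\<And>t. t \<in> {0..T} \<Longrightarrow> U t \<in> measurable M M"
    and U_0: "\<And>u. u \<in> Hset \<Longrightarrow> L2norm (\<lambda>x. U 0 u x - u x) = 0"
    and U_norm: "AE u in M. \<forall>t\<in>{0..T}. L2norm (U t u) \<le> L2norm u"
    and U_cont: "AE u in M. \<forall>X t. (\<forall>n::nat. X n \<in> {0..T}) \<longrightarrow> t \<in> {0..T} \<longrightarrow> X \<longlonglongrightarrow> t \<longrightarrow>
        (\<lambda>n. L2norm (\<lambda>x. U (X n) u x - U t u x)) \<longlonglongrightarrow> 0"
    and U_deriv: "AE u in M. \<forall>g t. nice g \<longrightarrow> t \<in> {0..T} \<longrightarrow>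
        ((\<lambda>s. L2inner (U s u) g) has_real_derivative nonlin g (U t u)) (at t within {0..T})"
begin

lemma U_Hset: "t \<in> {0..T} \<Longrightarrow> u \<in> Hset \<Longrightarrow> U t u \<in> Hset"
  using measurable_space[OF U_meas] M by auto

lemma F_measurable: "L2cont F \<Longrightarrow> F \<in> borel_measurable M"
  by (rule L2cont_measurable[OF _ M])

lemma F_U_measurable: "L2cont F \<Longrightarrow> t \<in> {0..T} \<Longrightarrow> (\<lambda>u. F (U t u)) \<in> borel_measurable M"
  using measurable_compose[OF U_meas F_measurable] .

definition law :: "real \<Rightarrow> vf measure" where
  "law t = distr M M (U t)"

lemma integral_law: "L2cont F \<Longrightarrow> t \<in> {0..T} \<Longrightarrow> (\<integral>u. F u \<partial>law t) = (\<integral>u. F (U t u) \<partial>M)"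
  for F :: "vf \<Rightarrow> real"
  unfolding law_def by (rule integral_distr[OF U_meas F_measurable])

lemma law_Borel_prob: "t \<in> {0..T} \<Longrightarrow> Borel_prob_H (law t)"
  unfolding Borel_prob_H_def law_def using prob_space_distr[OF U_meas] M by auto

lemma law_0: "law 0 = M"
proof (rule measure_eqI)
  fix A assume "A \<in> sets (law 0)"
  then have A: "A \<in> sets M" by (simp add: law_def)
  have 0: "0 \<in> {0..T}" using T by simp
  have "U 0 u \<in> A \<longleftrightarrow> u \<in> A" if "u \<in> Hset" for u
    by (rule HBorel_saturated[OF _ U_Hset[OF 0 that] that U_0[OF that]]) (use A M in simp)
  then have "U 0 -` A \<inter> space M = A"
    using sets.sets_into_space[OF A] M(1) by auto
  then show "emeasure (law 0) A = emeasure M A"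
    unfolding law_def using emeasure_distr[OF U_meas[OF 0] A] by simp
qed (simp add: law_def)

lemma law_energy:
  assumes t: "t \<in> {0..T}"
  shows "(\<integral>\<^sup>+u. ennreal ((L2norm u)\<^sup>2) \<partial>law t) \<le> (\<integral>\<^sup>+u. ennreal ((L2norm u)\<^sup>2) \<partial>M)"
proof -
  have "(\<integral>\<^sup>+u. ennreal ((L2norm u)\<^sup>2) \<partial>law t) = (\<integral>\<^sup>+u. ennreal ((L2norm (U t u))\<^sup>2) \<partial>M)"
    unfolding law_def using F_measurable[OF L2cont_L2norm] by (intro nn_integral_distr U_meas t) simp
  also have "\<dots> \<le> (\<integral>\<^sup>+u. ennreal ((L2norm u)\<^sup>2) \<partial>M)"
    by (rule nn_integral_mono_AE) (use U_norm t in \<open>auto elim!: eventually_mono intro!: ennreal_leI power_mono\<close>)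
  finally show ?thesis .
qed

lemma F_U_dominated:
  assumes F: "\<And>u. u \<in> Hset \<Longrightarrow> \<bar>F u\<bar> \<le> B + C * (L2norm u)\<^sup>2" and C: "0 \<le> C"
  shows "AE u in M. \<forall>t\<in>{0..T}. \<bar>F (U t u)\<bar> \<le> B + C * (L2norm u)\<^sup>2"
  using U_norm AE_space
proof eventually_elim
  case (elim u)
  show ?case
  proof
    fix t assume t: "t \<in> {0..T}"
    have "\<bar>F (U t u)\<bar> \<le> B + C * (L2norm (U t u))\<^sup>2" using F U_Hset[OF t] elim M by simp
    also have "\<dots> \<le> B + C * (L2norm u)\<^sup>2"
      using elim t C by (intro add_left_mono mult_left_mono power_mono) auto
    finally show "\<bar>F (U t u)\<bar> \<le> B + C * (L2norm u)\<^sup>2" .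
  qed
qed

lemma F_U_integrable:
  assumes "L2cont F" "\<And>u. u \<in> Hset \<Longrightarrow> \<bar>F u\<bar> \<le> B + C * (L2norm u)\<^sup>2" "0 \<le> C" "t \<in> {0..T}"
  shows "integrable M (\<lambda>u. F (U t u))"
proof (rule Bochner_Integration.integrable_bound)
  show "integrable M (\<lambda>u. B + C * (L2norm u)\<^sup>2)" using moment by simp
  have "AE u in M. \<forall>t\<in>{0..T}. \<bar>F (U t u)\<bar> \<le> B + C * (L2norm u)\<^sup>2"
    by (rule F_U_dominated[OF assms(2,3)])
  then show "AE u in M. norm (F (U t u)) \<le> norm (B + C * (L2norm u)\<^sup>2)"
    by eventually_elim (use assms(4) in fastforce)
qed (rule F_U_measurable[OF assms(1,4)])

lemma expectation_continuous:
  assumes F: "L2cont F" "\<And>u. u \<in> Hset \<Longrightarrow> \<bar>F u\<bar> \<le> B + C * (L2norm u)\<^sup>2" "0 \<le> C"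
  shows "continuous_on {0..T} (\<lambda>t. \<integral>u. F (U t u) \<partial>M)"
proof (unfold continuous_on_sequentially, intro allI ballI impI, elim conjE)
  fix X t assume t: "t \<in> {0..T}" and X: "\<forall>n. X n \<in> {0..T}" "X \<longlonglongrightarrow> t"
  have "(\<lambda>n. \<integral>u. F (U (X n) u) \<partial>M) \<longlonglongrightarrow> (\<integral>u. F (U t u) \<partial>M)"
  proof (rule integral_dominated_convergence)
    show "integrable M (\<lambda>u. B + C * (L2norm u)\<^sup>2)" using moment by simp
    have "AE u in M. \<forall>t\<in>{0..T}. \<bar>F (U t u)\<bar> \<le> B + C * (L2norm u)\<^sup>2"
      by (rule F_U_dominated[OF F(2,3)])
    then show "AE u in M. norm (F (U (X n) u)) \<le> B + C * (L2norm u)\<^sup>2" for n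
      by eventually_elim (use X in simp)
    show "AE u in M. (\<lambda>n. F (U (X n) u)) \<longlonglongrightarrow> F (U t u)"
      using U_cont AE_space
    proof eventually_elim
      case (elim u)
      then have "(\<lambda>n. L2norm (\<lambda>x. U (X n) u x - U t u x)) \<longlonglongrightarrow> 0" using X t by blast
      then show ?case
        using F(1) U_Hset elim X t M unfolding L2cont_def by simp
    qed
  qed (use F_U_measurable[OF F(1)] t X in auto)
  then show "((\<lambda>t. \<integral>u. F (U t u) \<partial>M) \<circ> X) \<longlonglongrightarrow> (\<integral>u. F (U t u) \<partial>M)" by (simp add: o_def)
qed

section \<open>Evolution of expectations of cylindrical functionals\<close>

context
  fixes k \<phi> d\<phi> and gs :: "nat \<Rightarrow> vf"
  assumes C: "C1c k \<phi> d\<phi>" and gs: "\<And>j. j < k \<Longrightarrow> nice (gs j)"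
begin

abbreviation \<Phi> :: "vf \<Rightarrow> real" where "\<Phi> \<equiv> cylPhi \<phi> gs"

abbreviation \<Psi> :: "vf \<Rightarrow> real" where "\<Psi> \<equiv> \<lambda>u. nonlin (cylDPhi k d\<phi> gs u) u"

lemma \<Phi>_cont: "L2cont \<Phi>"
  by (rule L2cont_cylPhi[OF C gs])

lemma \<Psi>_cont: "L2cont \<Psi>"
  by (rule L2cont_nonlin_cylDPhi[OF C gs])

lemma \<Psi>_bound: obtains B where "0 \<le> B" "\<And>u. u \<in> Hset \<Longrightarrow> \<bar>\<Psi> u\<bar> \<le> 0 + B * (L2norm u)\<^sup>2"
proof -
  have "\<exists>B\<ge>0. \<forall>u. L2 u \<longrightarrow> \<bar>\<Psi> u\<bar> \<le> B * (L2norm u)\<^sup>2"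
    by (rule nonlin_cylDPhi_bound[OF C gs])
  then obtain B where "0 \<le> B" "\<And>u. L2 u \<Longrightarrow> \<bar>\<Psi> u\<bar> \<le> B * (L2norm u)\<^sup>2" by blast
  then show ?thesis using that[of B] Hset_L2 by simp
qed

text \<open>Differentiation under the expectation: along almost every path the chain rule gives the
  derivative, and its bound by \<open>B * (L2norm u)\<^sup>2\<close> dominates all difference
  quotients.\<close>

lemma expectation_derivative:
  assumes t: "t \<in> {0..T}"
  shows "((\<lambda>s. \<integral>u. \<Phi> (U s u) \<partial>M) has_real_derivative (\<integral>u. \<Psi> (U t u) \<partial>M)) (at t within {0..T})"
proof -
  obtain B where B: "0 \<le> B" "\<And>u. u \<in> Hset \<Longrightarrow> \<bar>\<Psi> u\<bar> \<le> 0 + B * (L2norm u)\<^sup>2" using \<Psi>_bound by blast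
  obtain A where A: "\<And>y. \<bar>\<phi> y\<bar> \<le> A" using C1c_bounded[OF C] by blast
  have int: "integrable M (\<lambda>u. \<Phi> (U s u))" if "s \<in> {0..T}" for s
    by (rule F_U_integrable[OF \<Phi>_cont, where B=A and C=0]) (use A that in \<open>auto simp: cylPhi_def\<close>)
  have der: "AE u in M. \<forall>t\<in>{0..T}. ((\<lambda>s. \<Phi> (U s u)) has_real_derivative \<Psi> (U t u)) (at t within {0..T})"
    using U_deriv AE_space
  proof eventually_elim
    case (elim u)
    show ?case
    proof
      fix t assume t: "t \<in> {0..T}"
      have "((\<lambda>s. \<phi> (\<lambda>j. L2inner (U s u) (gs j))) has_real_derivative
          (\<Sum>j<k. d\<phi> j (\<lambda>m. L2inner (U t u) (gs m)) * nonlin (gs j) (U t u))) (at t within {0..T})"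
        by (rule C1c_chain[OF C t]) (use elim gs t in blast)
      moreover have "L2 (U t u)" using U_Hset[OF t] elim M Hset_L2 by simp
      ultimately show "((\<lambda>s. \<Phi> (U s u)) has_real_derivative \<Psi> (U t u)) (at t within {0..T})"
        using nonlin_cylDPhi[OF C gs] by (simp add: cylPhi_def)
    qed
  qed
  have dom: "AE u in M. \<forall>t\<in>{0..T}. \<bar>\<Psi> (U t u)\<bar> \<le> 0 + B * (L2norm u)\<^sup>2"
    by (rule F_U_dominated[OF B(2,1)])
  have lip: "AE u in M. \<forall>s\<in>{0..T}. \<forall>t\<in>{0..T}. \<bar>\<Phi> (U s u) - \<Phi> (U t u)\<bar> \<le> B * (L2norm u)\<^sup>2 * \<bar>s - t\<bar>"
    using der dom
  proof eventually_elim
    case (elim u)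
    show ?case
    proof (intro ballI)
      fix s t assume "s \<in> {0..T}" "t \<in> {0..T}"
      then show "\<bar>\<Phi> (U s u) - \<Phi> (U t u)\<bar> \<le> B * (L2norm u)\<^sup>2 * \<bar>s - t\<bar>"
        using field_differentiable_bound[of "{0..T}" "\<lambda>s. \<Phi> (U s u)" "\<lambda>t. \<Psi> (U t u)" "B * (L2norm u)\<^sup>2" s t] elim
        by simp
    qed
  qed
  show ?thesis
    unfolding has_field_derivative_iff tendsto_at_iff_sequentially
  proof (intro allI impI)
    fix X assume X: "\<forall>n. X n \<in> {0..T} - {t}" "X \<longlonglongrightarrow> t"
    have XT: "X n \<in> {0..T}" "X n \<noteq> t" for n using X by auto
    have "(\<lambda>n. \<integral>u. (\<Phi> (U (X n) u) - \<Phi> (U t u)) / (X n - t) \<partial>M) \<longlonglongrightarrow> (\<integral>u. \<Psi> (U t u) \<partial>M)"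
    proof (rule integral_dominated_convergence)
      show "integrable M (\<lambda>u. B * (L2norm u)\<^sup>2)" using moment by simp
      show "AE u in M. norm ((\<Phi> (U (X n) u) - \<Phi> (U t u)) / (X n - t)) \<le> B * (L2norm u)\<^sup>2" for n
        using lip
      proof eventually_elim
        case (elim u)
        then have "\<bar>\<Phi> (U (X n) u) - \<Phi> (U t u)\<bar> \<le> B * (L2norm u)\<^sup>2 * \<bar>X n - t\<bar>" using XT t by blast
        then show ?case using XT(2)[of n] by (simp add: divide_le_eq)
      qed
      show "AE u in M. (\<lambda>n. (\<Phi> (U (X n) u) - \<Phi> (U t u)) / (X n - t)) \<longlonglongrightarrow> \<Psi> (U t u)"
        using der
      proof eventually_elim
        case (elim u)
        then have "((\<lambda>s. (\<Phi> (U s u) - \<Phi> (U t u)) / (s - t)) \<longlongrightarrow> \<Psi> (U t u)) (at t within {0..T})"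
          using t by (simp add: has_field_derivative_iff)
        then show ?case using X unfolding tendsto_at_iff_sequentially by (auto simp: o_def)
      qed
      show "(\<lambda>u. \<Psi> (U t u)) \<in> borel_measurable M" by (rule F_U_measurable[OF \<Psi>_cont t])
      show "(\<lambda>u. (\<Phi> (U (X n) u) - \<Phi> (U t u)) / (X n - t)) \<in> borel_measurable M" for n
        using F_U_measurable[OF \<Phi>_cont XT(1)] F_U_measurable[OF \<Phi>_cont t] by measurable
    qed
    then show "((\<lambda>y. ((\<integral>u. \<Phi> (U y u) \<partial>M) - (\<integral>u. \<Phi> (U t u) \<partial>M)) / (y - t)) \<circ> X) \<longlonglongrightarrow> (\<integral>u. \<Psi> (U t u) \<partial>M)"
      using int[OF XT(1)] int[OF t] by (simp add: o_def)
  qed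
qed

text \<open>The derivative of the expectation is continuous in time by dominated convergence, so the
  fundamental theorem of calculus applies.\<close>

lemma law_evolution:
  shows "AE s in lebesgue_on {0..T}. integrable (law s) \<Psi>"
    and "set_integrable lborel {0..T} (\<lambda>s. \<integral>u. \<Psi> u \<partial>law s)"
    and "0 \<le> t' \<Longrightarrow> t' \<le> t \<Longrightarrow> t \<le> T \<Longrightarrow>
      (\<integral>u. \<Phi> u \<partial>law t) = (\<integral>u. \<Phi> u \<partial>law t') + (LINT s:{t'..t}|lborel. (\<integral>u. \<Psi> u \<partial>law s))"
proof -
  obtain B where B: "0 \<le> B" "\<And>u. u \<in> Hset \<Longrightarrow> \<bar>\<Psi> u\<bar> \<le> 0 + B * (L2norm u)\<^sup>2" using \<Psi>_bound by blast
  let ?G = "\<lambda>s. \<integral>u. \<Psi> (U s u) \<partial>M"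
  have cont: "continuous_on {0..T} ?G"
    by (rule expectation_continuous[OF \<Psi>_cont B(2,1)])
  have "integrable (law s) \<Psi>" if "s \<in> {0..T}" for s
    unfolding law_def
    by (subst integrable_distr_eq[OF U_meas[OF that] F_measurable[OF \<Psi>_cont]])
       (rule F_U_integrable[OF \<Psi>_cont B(2,1) that])
  then show "AE s in lebesgue_on {0..T}. integrable (law s) \<Psi>"
    by (intro AE_I2) simp
  have eq: "indicator S s *\<^sub>R (\<integral>u. \<Psi> u \<partial>law s) = indicator S s *\<^sub>R ?G s" if "S \<subseteq> {0..T}" for S s
    using that integral_law[OF \<Psi>_cont, of s] by (cases "s \<in> S") auto
  show "set_integrable lborel {0..T} (\<lambda>s. \<integral>u. \<Psi> u \<partial>law s)"
    unfolding set_integrable_def eq[OF order_refl]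
    by (rule borel_integrable_compact[OF compact_Icc cont])
  assume t: "0 \<le> t'" "t' \<le> t" "t \<le> T"
  have sub: "{t'..t} \<subseteq> {0..T}" using t by auto
  have "(\<integral>s. indicator {t'..t} s *\<^sub>R ?G s \<partial>lborel) = (\<integral>u. \<Phi> (U t u) \<partial>M) - (\<integral>u. \<Phi> (U t' u) \<partial>M)"
  proof (rule integral_FTC_Icc[OF t(2)])
    fix s assume "t' \<le> s" "s \<le> t"
    then have "s \<in> {0..T}" using t by auto
    then have "((\<lambda>s. \<integral>u. \<Phi> (U s u) \<partial>M) has_vector_derivative ?G s) (at s within {0..T})"
      using expectation_derivative by (simp add: has_real_derivative_iff_has_vector_derivative)
    then show "((\<lambda>s. \<integral>u. \<Phi> (U s u) \<partial>M) has_vector_derivative ?G s) (at s within {t'..t})"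
      by (rule has_vector_derivative_within_subset[OF _ sub])
  next
    show "continuous_on {t'..t} ?G" by (rule continuous_on_subset[OF cont sub])
  qed
  then show "(\<integral>u. \<Phi> u \<partial>law t) = (\<integral>u. \<Phi> u \<partial>law t') + (LINT s:{t'..t}|lborel. (\<integral>u. \<Psi> u \<partial>law s))"
    unfolding set_lebesgue_integral_def eq[OF sub]
    using t by (simp add: integral_law[OF \<Phi>_cont])
qed

end

theorem law_stat_sol:
  assumes L: "L > 2"
  shows "stat_sol L T M law"
proof -
  have BM: "Borel_prob_H M" unfolding Borel_prob_H_def using M prob_space_axioms by simp
  have fin: "(\<integral>\<^sup>+u. ennreal ((L2norm u)\<^sup>2) \<partial>M) < \<infinity>"
    using nn_integral_eq_integral[OF moment] by simp
  have weak: "(\<lambda>t. \<integral>u. \<psi> u \<partial>law t) \<in> borel_measurable (lebesgue_on {0..T})" if \<psi>: "Cb_weak \<psi>" for \<psi>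
  proof -
    obtain B where B: "\<And>u. u \<in> Hset \<Longrightarrow> \<bar>\<psi> u\<bar> \<le> B" using \<psi> unfolding Cb_weak_def by blast
    have "continuous_on {0..T} (\<lambda>t. \<integral>u. \<psi> (U t u) \<partial>M)"
      by (rule expectation_continuous[OF L2cont_Cb_weak[OF \<psi>], where B=B and C=0]) (use B in auto)
    then have "continuous_on {0..T} (\<lambda>t. \<integral>u. \<psi> u \<partial>law t)"
      by (rule continuous_on_eq) (simp add: integral_law[OF L2cont_Cb_weak[OF \<psi>]])
    then show ?thesis by (rule continuous_imp_measurable_on_sets_lebesgue) simp
  qed
  have cyl: "C1c k \<phi> d\<phi>" "\<And>j. j < k \<Longrightarrow> nice (gs j)" if "cyl L k \<phi> d\<phi> gs" for k \<phi> d\<phi> gs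
    using that HL_nice[OF L] by (auto simp: cyl_def)
  have ev: "(AE s in lebesgue_on {0..T}. integrable (law s) (\<lambda>u. nonlin (cylDPhi k d\<phi> gs u) u)) \<and>
      set_integrable lborel {0..T} (\<lambda>s. \<integral>u. nonlin (cylDPhi k d\<phi> gs u) u \<partial>law s) \<and>
      (\<forall>t' t. 0 \<le> t' \<and> t' \<le> t \<and> t \<le> T \<longrightarrow>
         (\<integral>u. cylPhi \<phi> gs u \<partial>law t) = (\<integral>u. cylPhi \<phi> gs u \<partial>law t') +
           (LINT s:{t'..t}|lborel. (\<integral>u. nonlin (cylDPhi k d\<phi> gs u) u \<partial>law s)))"
    if c: "cyl L k \<phi> d\<phi> gs" for k \<phi> d\<phi> gs
  proof -
    note C = cyl(1)[OF c] and gs = cyl(2)[OF c]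
    show ?thesis
      using law_evolution(1)[of k \<phi> d\<phi> gs, OF C gs] law_evolution(2)[of k \<phi> d\<phi> gs, OF C gs]
        law_evolution(3)[of k \<phi> d\<phi> gs, OF C gs]
      by simp
  qed
  have en: "AE t in lebesgue_on {0..T}.
      (\<integral>\<^sup>+u. ennreal ((L2norm u)\<^sup>2) \<partial>law t) \<le> (\<integral>\<^sup>+u. ennreal ((L2norm u)\<^sup>2) \<partial>M)"
    by (intro AE_I2 law_energy) simp
  show ?thesis
    unfolding stat_sol_def
    using BM fin law_Borel_prob law_0 weak en ev by blast
qed

end

section \<open>Existence\<close>

text \<open>Compares \<open>Hs_sq 1\<close> with a coefficient series that lies below it and is
  measurable by inspection; the division by 4 absorbs the constant of \<open>Hs_sq_coef\<close>. Its
  integral is finite, so almost every datum has finite enstrophy, and four times the series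
  dominates the energy.\<close>

lemma moment_bounds:
  assumes M: "space M = Hset" "sets M = HBorel" and fin: "(\<integral>\<^sup>+u. Hs_sq 1 u \<partial>M) < \<infinity>"
  shows "(\<lambda>u. \<Sum>n. ennreal ((1 + lam n) * (coef n u)\<^sup>2 / 4)) \<in> borel_measurable M" (is "?f \<in> _")
    and "AE u in M. (\<Sum>n. ennreal ((1 + lam n) * (coef n u)\<^sup>2 / 4)) < \<infinity>"
    and "(\<integral>\<^sup>+u. ennreal ((L2norm u)\<^sup>2) \<partial>M) < \<infinity>"
proof -
  have [measurable]: "coef n \<in> borel_measurable M" for n
    by (rule L2cont_measurable[OF L2cont_coef M])
  show meas: "?f \<in> borel_measurable M" by measurable
  have le: "?f u \<le> Hs_sq 1 u" if u: "u \<in> Hset" for u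
    unfolding suminf_eq_SUP
  proof (rule SUP_least)
    fix N
    have "4 * (\<Sum>n<N. ennreal ((1 + lam n) * (coef n u)\<^sup>2 / 4)) = (\<Sum>n<N. ennreal ((1 + lam n) powr 1 * (coef n u)\<^sup>2))"
    proof -
      have "4 * ennreal ((1 + lam n) * (coef n u)\<^sup>2 / 4) = ennreal ((1 + lam n) powr 1 * (coef n u)\<^sup>2)" for n
      proof -
        have "4 * ennreal ((1 + lam n) * (coef n u)\<^sup>2 / 4) = ennreal 4 * ennreal ((1 + lam n) * (coef n u)\<^sup>2 / 4)" by simp
        also have "\<dots> = ennreal (4 * ((1 + lam n) * (coef n u)\<^sup>2 / 4))"
          by (rule ennreal_mult'[symmetric]) simp
        also have "4 * ((1 + lam n) * (coef n u)\<^sup>2 / 4) = (1 + lam n) powr 1 * (coef n u)\<^sup>2"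
          using lam_nonneg[of n] by simp
        finally show ?thesis .
      qed
      then show ?thesis unfolding sum_distrib_left by (intro sum.cong refl)
    qed
    also have "\<dots> \<le> 4 * Hs_sq 1 u" by (rule Hs_sq_coef[OF Hset_L2[OF u]])
    finally show "(\<Sum>n<N. ennreal ((1 + lam n) * (coef n u)\<^sup>2 / 4)) \<le> Hs_sq 1 u"
      by (subst (asm) ennreal_mult_le_mult_iff) auto
  qed
  have "(\<integral>\<^sup>+u. ?f u \<partial>M) \<le> (\<integral>\<^sup>+u. Hs_sq 1 u \<partial>M)"
    using le M by (intro nn_integral_mono) auto
  then have f: "(\<integral>\<^sup>+u. ?f u \<partial>M) < \<infinity>" using fin by (rule le_less_trans)
  then have "AE u in M. ?f u \<noteq> \<infinity>"
    by (intro nn_integral_PInf_AE meas) auto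
  then show "AE u in M. ?f u < \<infinity>" by (simp add: top.not_eq_extremum)
  have "ennreal ((L2norm u)\<^sup>2) \<le> 4 * ?f u" if u: "u \<in> Hset" for u
  proof -
    have "ennreal ((L2norm u)\<^sup>2) = (\<Sum>n. ennreal ((coef n u)\<^sup>2))"
      using Parseval_norm[OF u] by (subst suminf_ennreal2) (auto simp: sums_iff)
    also have "\<dots> \<le> (\<Sum>n. 4 * ennreal ((1 + lam n) * (coef n u)\<^sup>2 / 4))"
    proof (rule suminf_le)
      fix n
      have "(coef n u)\<^sup>2 \<le> 4 * ((1 + lam n) * (coef n u)\<^sup>2 / 4)" by (simp add: distrib_right)
      then have "ennreal ((coef n u)\<^sup>2) \<le> ennreal (4 * ((1 + lam n) * (coef n u)\<^sup>2 / 4))" by (rule ennreal_leI)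
      also have "\<dots> = ennreal 4 * ennreal ((1 + lam n) * (coef n u)\<^sup>2 / 4)" by (rule ennreal_mult') simp
      finally show "ennreal ((coef n u)\<^sup>2) \<le> 4 * ennreal ((1 + lam n) * (coef n u)\<^sup>2 / 4)" by simp
    qed auto
    also have "\<dots> = 4 * ?f u" by (rule ennreal_suminf_cmult)
    finally show ?thesis .
  qed
  then have "(\<integral>\<^sup>+u. ennreal ((L2norm u)\<^sup>2) \<partial>M) \<le> (\<integral>\<^sup>+u. 4 * ?f u \<partial>M)"
    using M by (intro nn_integral_mono) auto
  also have "\<dots> = 4 * (\<integral>\<^sup>+u. ?f u \<partial>M)" by (rule nn_integral_cmult[OF meas])
  also have "\<dots> < \<infinity>" using f by (simp add: ennreal_mult_less_top)
  finally show "(\<integral>\<^sup>+u. ennreal ((L2norm u)\<^sup>2) \<partial>M) < \<infinity>" .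
qed

theorem mainTheorem8:
  fixes L T :: real and \<mu>bar :: "vf measure"
  assumes "L > 2" and "T > 0"
    and "Borel_prob_H \<mu>bar"
    and "(\<integral>\<^sup>+ u. Hs_sq 1 u \<partial>\<mu>bar) < \<infinity>"
  shows "\<exists>\<mu>. stat_sol L T \<mu>bar \<mu> \<and>
           (AE t in lebesgue_on {0..T}.
              (\<integral>\<^sup>+ u. ennreal ((L2norm u) ^ 2) \<partial>\<mu> t) \<le> (\<integral>\<^sup>+ u. ennreal ((L2norm u) ^ 2) \<partial>\<mu>bar))"
proof -
  have M: "space \<mu>bar = Hset" "sets \<mu>bar = HBorel" and P: "prob_space \<mu>bar"
    using assms(3) by (auto simp: Borel_prob_H_def)
  define f where "f u = (\<Sum>n. ennreal ((1 + lam n) * (coef n u)\<^sup>2 / 4))" for u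
  note f = moment_bounds[OF M assms(4), folded f_def]
  have [measurable]: "f \<in> borel_measurable \<mu>bar" using f(1) by (simp add: f_def[abs_def])
  have coef_m [measurable]: "coef n \<in> borel_measurable \<mu>bar" for n
    by (rule L2cont_measurable[OF L2cont_coef M])
  obtain a where a: "\<And>t k. (\<lambda>u. a u t k) \<in> borel_measurable \<mu>bar"
    "\<And>u. summable (\<lambda>k. (coef k u)\<^sup>2) \<Longrightarrow> summable (\<lambda>k. lam k * (coef k u)\<^sup>2) \<Longrightarrow> euler_path T (a u) (\<lambda>k. coef k u)"
    using measurable_euler_paths[OF assms(2), of "\<lambda>u k. coef k u" \<mu>bar] coef_m by blast
  \<comment> \<open>On the null set where the series \<open>f\<close> diverges the path is frozen at
    the datum. Thus \<open>U t\<close> maps H measurably into H everywhere, and \<open>U 0 u\<close>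
    has the coefficients of \<open>u\<close> without exception.\<close>
  define b where "b u t = (if f u < \<infinity> then a u t else (\<lambda>k. coef k u))" for u t
  define U where "U t u = synth (b u t)" for t u
  have ep: "euler_path T (a u) (\<lambda>k. coef k u)" if u: "u \<in> Hset" "f u < \<infinity>" for u
  proof (rule a(2))
    show "summable (\<lambda>k. (coef k u)\<^sup>2)" by (rule summable_coef[OF Hset_L2[OF u(1)]])
    have "summable (\<lambda>n. (1 + lam n) * (coef n u)\<^sup>2 / 4)"
      by (rule summable_suminf_not_top) (use u(2) in \<open>auto simp: f_def\<close>)
    then show "summable (\<lambda>k. lam k * (coef k u)\<^sup>2)"
      by (rule summable_comparison_test_ev[rotated, OF summable_mult[of _ 4]])
         (auto simp: distrib_right)
  qed
  have b: "U t u \<in> Hset" "coef k (U t u) = b u t k" if "t \<in> {0..T}" "u \<in> Hset" for t u k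
  proof -
    have "U t u \<in> Hset \<and> coef k (U t u) = b u t k"
    proof (cases "f u < \<infinity>")
      case True
      then show ?thesis
        using path_synth[OF assms(2) that(2) ep[OF that(2) True] that(1)] by (simp add: U_def b_def)
    next
      case False
      then show ?thesis
        using synth[OF summable_coef[OF Hset_L2[OF that(2)]]] by (simp add: U_def b_def)
    qed
    then show "U t u \<in> Hset" "coef k (U t u) = b u t k" by auto
  qed
  have good: "AE u in \<mu>bar. u \<in> Hset \<and> (\<forall>t. U t u = synth (a u t)) \<and> euler_path T (a u) (\<lambda>k. coef k u)"
    using f(2) AE_space by eventually_elim (use ep M in \<open>auto simp: U_def b_def\<close>)
  interpret prob_space \<mu>bar by (rule P)
  interpret euler_flow \<mu>bar T U
  proof
    show "T > 0" "space \<mu>bar = Hset" "sets \<mu>bar = HBorel" by (fact assms M)+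
    show "integrable \<mu>bar (\<lambda>u. (L2norm u)\<^sup>2)"
      using f(3) L2cont_measurable[OF L2cont_L2norm M] by (intro integrableI_bounded) auto
    show "U t \<in> measurable \<mu>bar \<mu>bar" if t: "t \<in> {0..T}" for t
    proof (rule measurable_into_Hset[OF M])
      show "U t u \<in> Hset" if "u \<in> space \<mu>bar" for u using b(1)[OF t] that M by simp
      have "(\<lambda>u. if f u < \<infinity> then a u t n else coef n u) \<in> borel_measurable \<mu>bar" for n
        using a(1)[of t n] by measurable
      moreover have "coef n (U t u) = (if f u < \<infinity> then a u t n else coef n u)" if "u \<in> space \<mu>bar" for n u
        using b(2)[OF t] that M by (simp add: b_def)
      ultimately show "(\<lambda>u. coef n (U t u)) \<in> borel_measurable \<mu>bar" for n
        by (simp cong: measurable_cong)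
    qed
    show "L2norm (\<lambda>x. U 0 u x - u x) = 0" if u: "u \<in> Hset" for u
    proof -
      have 0: "0 \<in> {0..T}" using assms(2) by simp
      have "coef k (U 0 u) = coef k u" for k
        using b(2)[OF 0 u, of k] ep[OF u] by (auto simp: b_def euler_path_def)
      then have "AE x in cell. U 0 u x = u x" by (rule Hset_eqI[OF b(1)[OF 0 u] u])
      then show ?thesis
        by (subst L2norm_eq_0_iff[OF L2_diff[OF Hset_L2[OF b(1)[OF 0 u]] Hset_L2[OF u]]]) simp
    qed
    show "AE u in \<mu>bar. \<forall>t\<in>{0..T}. L2norm (U t u) \<le> L2norm u"
      using good by eventually_elim (use path_norm[OF assms(2)] in auto)
    show "AE u in \<mu>bar. \<forall>X t. (\<forall>n::nat. X n \<in> {0..T}) \<longrightarrow> t \<in> {0..T} \<longrightarrow> X \<longlonglongrightarrow> t \<longrightarrow>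
        (\<lambda>n. L2norm (\<lambda>x. U (X n) u x - U t u x)) \<longlonglongrightarrow> 0"
      using good by eventually_elim (use path_continuous[OF assms(2)] in auto)
    show "AE u in \<mu>bar. \<forall>g t. nice g \<longrightarrow> t \<in> {0..T} \<longrightarrow>
        ((\<lambda>s. L2inner (U s u) g) has_real_derivative nonlin g (U t u)) (at t within {0..T})"
      using good by eventually_elim (use path_derivative[OF assms(2)] in auto)
  qed
  have "AE t in lebesgue_on {0..T}.
      (\<integral>\<^sup>+u. ennreal ((L2norm u)\<^sup>2) \<partial>law t) \<le> (\<integral>\<^sup>+u. ennreal ((L2norm u)\<^sup>2) \<partial>\<mu>bar)"
    by (intro AE_I2 law_energy) simp
  then show ?thesis using law_stat_sol[OF assms(1)] by blast
qed

end
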